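(* Let $K$ be a proper cone (closed, pointed, full-dimensional convex cone in $\mathbb{R}^n$) that admits a $\nu$-logarithmically homogeneous pairwise-self-concordant barrier. Then $\mathrm{sp}_K(\epsilon)\le\lceil 4\nu/\epsilon^2\rceil$ for all $\epsilon\in(0,1)$.
   Context: A convex cone $K\subseteq\mathbb{R}^n$ is pointed if $K\cap(-K)=\{0\}$ and full-dimensional if $\mathrm{span}(K)=\mathbb{R}^n$. Sparsification function. For a closed convex cone $K$ and $x,y\in\mathrm{span}(K)$, write $x\preceq_K y$ if $y-x\in K$. A sparsification function for $K$ is a monotonically non-increasing upper semi-continuous function $\alpha:(0,1)\to\mathbb{R}$ such that for any $x_1,\dots,x_m\in K$ with $\sum_{i=1}^m x_i=e\in\mathrm{relint}(K)$ and any $0<\epsilon<1$, there exist $S\subseteq[m]$ with $|S|\le\alpha(\epsilon)$ and positive scalars $(\lambda_i)_{i\in S}$ such that $(1-\epsilon)e\preceq_K\sum_{i\in S}\lambda_i x_i\preceq_K(1+\epsilon)e$. Let $\mathcal{F}_K$ be the collection of all sparsification functions for $K$; the sparsification function of $K$ is $\mathrm{sp}_K(\epsilon)=\inf_{\alpha\in\mathcal{F}_K}\alpha(\epsilon)$, $\epsilon\in(0,1)$. Barriers. $D^kf(x)[u_1,\dots,u_k]=\frac{\partial^k}{\partial t_1\cdots\partial t_k}f(x+t_1u_1+\cdots+t_ku_k)|_{t_1=\cdots=t_k=0}$. A three-times continuously differentiable closed convex function $\phi:\mathrm{dom}(\phi)\to\mathbb{R}$ with open domain $\mathrm{dom}(\phi)\subseteq\mathbb{R}^n$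 is standard self-concordant if $|D^3\phi(x)[u,u,u]|\le 2D^2\phi(x)[u,u]^{3/2}$ for all $x\in\mathrm{dom}(\phi)$, $u\in\mathbb{R}^n$. It is a $\nu$-logarithmically homogeneous self-concordant barrier for a closed full-dimensional convex cone $K$ if in addition $\mathrm{cl}(\mathrm{dom}(\phi))=K$ and $\phi(tx)=\phi(x)-\nu\log t$ for all $x\in\mathrm{dom}(\phi)$, $t>0$. For $x\in\mathrm{int}(K)$ put $|u|_x=\inf\{t\in\mathbb{R}: -tx\preceq_K u\preceq_K tx\}$. A logarithmically homogeneous self-concordant barrier $\phi$ for a proper cone $K$ is pairwise-self-concordant if for all $u,v\in K$ and all $x\in\mathrm{int}(K)$, $0\le -D^3\phi(x)[v,u,u]\le 2D^2\phi(x)[v,u]\,|u|_x$. *)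

theory Defs
  imports "HOL-Analysis.Analysis"
begin

definition pointed :: "'a::euclidean_space set \<Rightarrow> bool" where
  "pointed K \<longleftrightarrow> K \<inter> uminus ` K = {0}"

definition full_dimensional :: "'a::euclidean_space set \<Rightarrow> bool" where
  "full_dimensional K \<longleftrightarrow> span K = UNIV"

definition proper_cone :: "'a::euclidean_space set \<Rightarrow> bool" where
  "proper_cone K \<longleftrightarrow> closed K \<and> convex_cone K \<and> pointed K \<and> full_dimensional K"

definition cone_le :: "'a::euclidean_space set \<Rightarrow> 'a \<Rightarrow> 'a \<Rightarrow> bool" where
  "cone_le K x y \<longleftrightarrow> y - x \<in> K"

definition upper_semicontinuous_on :: "real set \<Rightarrow> (real \<Rightarrow> real) \<Rightarrow> bool" where
  "upper_semicontinuous_on S f \<longleftrightarrow>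
     (\<forall>x\<in>S. \<forall>a>f x. eventually (\<lambda>y. f y < a) (at x within S))"

text \<open>Only the values of \<open>\<alpha>\<close> on the open unit interval are relevant.\<close>

definition sparsification_function :: "'a::euclidean_space set \<Rightarrow> (real \<Rightarrow> real) \<Rightarrow> bool" where
  "sparsification_function K \<alpha> \<longleftrightarrow>
     antimono_on {0<..<1} \<alpha> \<and>
     upper_semicontinuous_on {0<..<1} \<alpha> \<and>
     (\<forall>(m::nat) (x::nat \<Rightarrow> 'a) e \<epsilon>.
        (\<forall>i\<in>{1..m}. x i \<in> K) \<and> (\<Sum>i=1..m. x i) = e \<and> e \<in> rel_interior K \<and> 0 < \<epsilon> \<and> \<epsilon> < 1 \<longrightarrow>
        (\<exists>S (c::nat \<Rightarrow> real).
           S \<subseteq> {1..m} \<and> real (card S) \<le> \<alpha> \<epsilon> \<and> (\<forall>i\<in>S. 0 < c i) \<and>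
           cone_le K ((1 - \<epsilon>) *\<^sub>R e) (\<Sum>i\<in>S. c i *\<^sub>R x i) \<and>
           cone_le K (\<Sum>i\<in>S. c i *\<^sub>R x i) ((1 + \<epsilon>) *\<^sub>R e)))"

text \<open>The infimum is taken in the extended reals, so that it is \<open>\<infinity>\<close> when there is no
  sparsification function (on \<open>real\<close>, the infimum of the empty set is a junk value).\<close>

definition sp :: "'a::euclidean_space set \<Rightarrow> real \<Rightarrow> ereal" where
  "sp K \<epsilon> = (INF \<alpha>\<in>{\<alpha>. sparsification_function K \<alpha>}. ereal (\<alpha> \<epsilon>))"

text \<open>\<open>Dk f x [u\<^sub>1, \<dots>, u\<^sub>k]\<close> is
  \<open>\<partial>\<^sup>k/(\<partial>t\<^sub>1 \<dots> \<partial>t\<^sub>k) f (x + t\<^sub>1 u\<^sub>1 + \<dots> + t\<^sub>k u\<^sub>k)\<close> at \<open>t\<^sub>1 = \<dots> = t\<^sub>k = 0\<close>: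
  the outermost derivative is the one in \<open>t\<^sub>1\<close>.\<close>

fun Dk :: "('a::euclidean_space \<Rightarrow> real) \<Rightarrow> 'a \<Rightarrow> 'a list \<Rightarrow> real" where
  "Dk f x [] = f x"
| "Dk f x (u # us) = deriv (\<lambda>t. Dk f (x + t *\<^sub>R u) us) 0"

text \<open>\<open>k\<close>-times continuous differentiability on an open set. In finite dimension, continuity of
  \<open>x \<mapsto> Df(x)\<close> (and likewise of higher derivatives) is continuity of \<open>x \<mapsto> Df(x)[v]\<close> for every
  \<open>v\<close>.\<close>

fun continuously_differentiable_on :: "nat \<Rightarrow> 'a::euclidean_space set \<Rightarrow> ('a \<Rightarrow> real) \<Rightarrow> bool" where
  "continuously_differentiable_on 0 S f \<longleftrightarrow> continuous_on S f"
| "continuously_differentiable_on (Suc k) S f \<longleftrightarrow>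
     (\<forall>x\<in>S. f differentiable (at x)) \<and>
     (\<forall>v. continuously_differentiable_on k S (\<lambda>x. frechet_derivative f (at x) v))"

text \<open>A partial function \<open>\<phi> : dom(\<phi>) \<rightarrow> \<real>\<close> is represented by its domain \<open>D\<close> and a total function
  whose values outside \<open>D\<close> are irrelevant. A convex function is closed if its epigraph is
  closed.\<close>

definition self_concordant :: "'a::euclidean_space set \<Rightarrow> ('a \<Rightarrow> real) \<Rightarrow> bool" where
  "self_concordant D \<phi> \<longleftrightarrow>
     open D \<and> continuously_differentiable_on 3 D \<phi> \<and>
     convex_on D \<phi> \<and> closed (epigraph D \<phi>) \<and>
     (\<forall>x\<in>D. \<forall>u. \<bar>Dk \<phi> x [u, u, u]\<bar> \<le> 2 * (Dk \<phi> x [u, u]) powr (3/2))"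

definition log_homogeneous_barrier ::
    "real \<Rightarrow> 'a::euclidean_space set \<Rightarrow> 'a set \<Rightarrow> ('a \<Rightarrow> real) \<Rightarrow> bool" where
  "log_homogeneous_barrier \<nu> K D \<phi> \<longleftrightarrow>
     self_concordant D \<phi> \<and> closure D = K \<and>
     (\<forall>x\<in>D. \<forall>t>0. \<phi> (t *\<^sub>R x) = \<phi> x - \<nu> * ln t)"

definition local_norm :: "'a::euclidean_space set \<Rightarrow> 'a \<Rightarrow> 'a \<Rightarrow> real" where
  "local_norm K x u = Inf {t::real. cone_le K (- t *\<^sub>R x) u \<and> cone_le K u (t *\<^sub>R x)}"

definition pairwise_self_concordant_barrier ::
    "real \<Rightarrow> 'a::euclidean_space set \<Rightarrow> 'a set \<Rightarrow> ('a \<Rightarrow> real) \<Rightarrow> bool" where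
  "pairwise_self_concordant_barrier \<nu> K D \<phi> \<longleftrightarrow>
     log_homogeneous_barrier \<nu> K D \<phi> \<and>
     (\<forall>u\<in>K. \<forall>v\<in>K. \<forall>x\<in>interior K.
        0 \<le> - Dk \<phi> x [v, u, u] \<and>
        - Dk \<phi> x [v, u, u] \<le> 2 * Dk \<phi> x [v, u] * local_norm K x u)"

end

theory Submission
  imports Defs
begin

text \<open>
  The elements are chosen one at a time, in the manner of Batson, Spielman and Srivastava, while two
  barriers \<open>l e\<close> and \<open>u e\<close> move upwards on either side of the current sum \<open>A\<close>. With
  \<open>Q z v = - D\<phi>(z)[v]\<close>, the distance from the upper barrier is controlled by \<open>Q (u e - A) e\<close>, and an
  averaging argument over the \<open>x\<^sub>i\<close> finds a single \<open>t x\<^sub>i\<close> that keeps both potentials bounded.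
  Pairwise self-concordance replaces the Sherman--Morrison formula.

  For a lower potential \<open>Q (A - l e) e\<close>, the classical argument needs \<open>s \<mapsto> 1 / Q (z + s e) e\<close> to be
  concave, which pairwise self-concordance does not give. If this fails, \<open>D\<^sup>2\<phi>[e, e]\<close> is nearly constant
  along some stretch of the ray; but then the convex functions \<open>q\<^sub>i(s) = Q (z + s e) x\<^sub>i\<close> are nearly linear
  there, and since \<open>x\<^sub>i\<close> is dominated by the harmonic interpolation of \<open>q\<^sub>i\<close>, which lies below the linear
  one, something is gained elsewhere. To see this effect at the relevant scale, the lower potential is
  averaged over a window \<open>A - l e + [0, M] e\<close>, with \<open>M\<close> of the order of the distance to the boundary.
  For large \<open>\<epsilon>\<close> the potential at a point suffices.
\<close>

section \<open>Barriers on a cone\<close>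

text \<open>The constant 4 leaves only a cubic margin. Put \<delta> = sqrt (\<nu> / N). If the lower
  potential were kept below \<delta> with the full step budget 1 - \<delta>, the barriers would end
  with ratio ((1 + \<delta>) / (1 - \<delta>))^2, that is, with accuracy 2 \<delta> / (1 +
  \<delta>^2); the target is 2 \<delta>. Hence a budget loss of order \<eta>^3 is affordable, but
  for small \<eta> one of order \<eta>^2 is not. The potential at a point loses about \<eta>^2 / 2;
  the window reduces this to 17/5 \<eta>^3. The switch at 7/50 lies where the quadratic loss already
  fits into the cubic margin and the window estimate still holds. The local norm of \<open>x\<close>
  at \<open>z\<close> is not additive in \<open>x\<close>, so it cannot be summed over the
  \<open>x i\<close>. It is therefore bounded by \<open>Q z x\<close> (\<open>dominated_Q\<close>),
  which is linear in \<open>x\<close> and sums to \<open>Q z e\<close>.\<close>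

locale closed_pointed_cone =
  fixes K :: "'a::euclidean_space set"
  assumes closed_K: "closed K" and cone_K: "convex_cone K"
    and pointed_K: "\<And>x. x \<in> K \<Longrightarrow> - x \<in> K \<Longrightarrow> x = 0"
begin

lemma K_add: "x \<in> K \<Longrightarrow> y \<in> K \<Longrightarrow> x + y \<in> K"
  using cone_K convex_cone_add by blast

lemma K_scale: "x \<in> K \<Longrightarrow> 0 \<le> t \<Longrightarrow> t *\<^sub>R x \<in> K"
  using cone_K by (simp add: convex_cone_def conic_def)

lemma K_0: "0 \<in> K"
  using cone_K convex_cone_contains_0 by blast

lemma int_K: "z \<in> interior K \<Longrightarrow> z \<in> K"
  using interior_subset by blast

lemma int_add:
  assumes "z \<in> interior K" "x \<in> K" shows "z + x \<in> interior K"
proof -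
  obtain e where e: "e > 0" "ball z e \<subseteq> K" using assms(1) mem_interior by blast
  have "ball (z + x) e \<subseteq> K"
  proof
    fix y assume "y \<in> ball (z + x) e"
    then have "y - x \<in> ball z e" by (simp add: dist_norm algebra_simps)
    then show "y \<in> K" using e(2) K_add[of "y - x" x] assms(2) by auto
  qed
  then show ?thesis using e(1) mem_interior by blast
qed

lemma int_scale:
  assumes "z \<in> interior K" "0 < t" shows "t *\<^sub>R z \<in> interior K"
proof -
  obtain e where e: "e > 0" "ball z e \<subseteq> K" using assms(1) mem_interior by blast
  have "ball (t *\<^sub>R z) (t * e) \<subseteq> K"
  proof
    fix y assume y: "y \<in> ball (t *\<^sub>R z) (t * e)"
    have "t *\<^sub>R (z - (1/t) *\<^sub>R y) = t *\<^sub>R z - y"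
      using assms(2) by (simp add: scaleR_diff_right)
    then have "norm (t *\<^sub>R z - y) = t * norm (z - (1/t) *\<^sub>R y)"
      using assms(2) by (metis abs_of_pos norm_scaleR)
    then have "(1/t) *\<^sub>R y \<in> ball z e" using y assms(2) by (simp add: dist_norm)
    then have "t *\<^sub>R ((1/t) *\<^sub>R y) \<in> K" using e(2) K_scale assms(2) by (meson less_imp_le subsetD)
    then show "y \<in> K" using assms(2) by simp
  qed
  then show ?thesis using e(1) assms(2) mem_interior by (metis mult_pos_pos)
qed

lemma int_sub:
  assumes "z \<in> interior K" "h *\<^sub>R z - x \<in> K" "0 \<le> t" "t * h < 1"
  shows "z - t *\<^sub>R x \<in> interior K"
proof -
  have "(1 - t * h) *\<^sub>R z + t *\<^sub>R (h *\<^sub>R z - x) \<in> interior K"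
    using assms by (intro int_add int_scale K_scale) auto
  moreover have "(1 - t * h) *\<^sub>R z + t *\<^sub>R (h *\<^sub>R z - x) = z - t *\<^sub>R x"
    by (simp add: algebra_simps)
  ultimately show ?thesis by simp
qed

lemma int_dominates:
  assumes "z \<in> interior K" obtains h where "0 < h" "h *\<^sub>R z - u \<in> K"
proof -
  obtain e where e: "e > 0" "ball z e \<subseteq> K" using assms mem_interior by blast
  define d where "d = e / (norm u + 1)"
  have d: "0 < d" using e(1) by (simp add: d_def add_nonneg_pos)
  have "norm (d *\<^sub>R u) = d * norm u" using d by simp
  also have "\<dots> < d * (norm u + 1)" using d by simp
  also have "\<dots> = e" by (simp add: d_def add_nonneg_eq_0_iff)
  finally have "z - d *\<^sub>R u \<in> ball z e" by (simp add: dist_norm)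
  then have "(1/d) *\<^sub>R (z - d *\<^sub>R u) \<in> K" using e(2) d by (intro K_scale) auto
  then have "(1/d) *\<^sub>R z - u \<in> K" using d by (simp add: algebra_simps)
  then show ?thesis using that[of "1/d"] d by simp
qed

text \<open>If \<open>0\<close> were interior, it would dominate both \<open>u\<close> and
  \<open>- u\<close>, which would then both lie in \<open>K\<close>. The vector \<open>u\<close>
  witnesses that the space is nontrivial.\<close>

lemma int_nonzero: "z \<in> interior K \<Longrightarrow> (u::'a) \<noteq> 0 \<Longrightarrow> z \<noteq> 0"
proof
  assume a: "z \<in> interior K" "u \<noteq> 0" "z = 0"
  have "u \<in> K" using int_dominates[OF a(1), of "- u"] a(3) by auto
  moreover have "- u \<in> K" using int_dominates[OF a(1), of u] a(3) by auto
  ultimately show False using pointed_K a(2) by blast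
qed

text \<open>For \<open>h > 0\<close>, \<open>z\<close> dominates \<open>u / h\<close>, so
  \<open>z + t u\<close> dominates \<open>(1 / h + t) u\<close>; the new coefficient is the
  reciprocal of \<open>1 / h + t\<close>.\<close>

lemma dominated_add:
  assumes "h *\<^sub>R z - u \<in> K" "0 \<le> h" "0 \<le> t"
  shows "(h / (1 + h * t)) *\<^sub>R (z + t *\<^sub>R u) - u \<in> K"
proof -
  have p: "0 < 1 + h * t" using assms by (simp add: add_pos_nonneg)
  have "(1 / (1 + h * t)) *\<^sub>R (h *\<^sub>R z - u) \<in> K" using assms p by (intro K_scale) auto
  moreover have "(1 / (1 + h * t)) *\<^sub>R (h *\<^sub>R z - u) = (h / (1 + h * t)) *\<^sub>R (z + t *\<^sub>R u) - u"
  proof -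
    have "(1 + h * t) *\<^sub>R ((h / (1 + h * t)) *\<^sub>R (z + t *\<^sub>R u) - u) = h *\<^sub>R (z + t *\<^sub>R u) - (1 + h*t) *\<^sub>R u"
      using p by (simp add: scaleR_diff_right)
    also have "\<dots> = h *\<^sub>R z - u" by (simp add: algebra_simps)
    finally have "(1 / (1 + h * t)) *\<^sub>R ((1 + h * t) *\<^sub>R ((h / (1 + h * t)) *\<^sub>R (z + t *\<^sub>R u) - u))
       = (1 / (1 + h * t)) *\<^sub>R (h *\<^sub>R z - u)" by simp
    then show ?thesis using p by simp
  qed
  ultimately show ?thesis by simp
qed

lemma dominated_sub:
  assumes "h *\<^sub>R z - u \<in> K" "0 \<le> h" "0 \<le> t" "t * h < 1"
  shows "(h / (1 - h * t)) *\<^sub>R (z - t *\<^sub>R u) - u \<in> K"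
proof -
  have p: "0 < 1 - h * t" using assms by (simp add: mult.commute)
  have "(1 / (1 - h * t)) *\<^sub>R (h *\<^sub>R z - u) \<in> K" using assms p by (intro K_scale) auto
  moreover have "(1 / (1 - h * t)) *\<^sub>R (h *\<^sub>R z - u) = (h / (1 - h * t)) *\<^sub>R (z - t *\<^sub>R u) - u"
  proof -
    have "(1 - h * t) *\<^sub>R ((h / (1 - h * t)) *\<^sub>R (z - t *\<^sub>R u) - u) = h *\<^sub>R (z - t *\<^sub>R u) - (1 - h*t) *\<^sub>R u"
      using p by (simp add: scaleR_diff_right)
    also have "\<dots> = h *\<^sub>R z - u" by (simp add: algebra_simps)
    finally have "(1 / (1 - h * t)) *\<^sub>R ((1 - h * t) *\<^sub>R ((h / (1 - h * t)) *\<^sub>R (z - t *\<^sub>R u) - u))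
       = (1 / (1 - h * t)) *\<^sub>R (h *\<^sub>R z - u)" by simp
    then show ?thesis using p by simp
  qed
  ultimately show ?thesis by simp
qed

end

text \<open>\<open>H z a b\<close> stands for the second derivative of the barrier at
  \<open>z\<close>. The local norm is replaced by every \<open>h \<ge> 0\<close> with
  \<open>h z - u\<close> in \<open>K\<close>, which avoids infima. Through \<open>dikin\<close>
  enter the standard self-concordance inequality and the closed epigraph.\<close>

locale pairwise_barrier = closed_pointed_cone K for K :: "'a::euclidean_space set" +
  fixes \<nu> :: real and Q :: "'a \<Rightarrow> 'a \<Rightarrow> real" and H :: "'a \<Rightarrow> 'a \<Rightarrow> 'a \<Rightarrow> real"
  assumes Q_linear: "\<And>z. z \<in> interior K \<Longrightarrow> linear (Q z)"
    and H_linear: "\<And>z a. z \<in> interior K \<Longrightarrow> linear (H z a)"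
    and H_sym: "\<And>z a b. z \<in> interior K \<Longrightarrow> H z a b = H z b a"
    and Q_deriv0: "\<And>z a b. z \<in> interior K \<Longrightarrow>
      ((\<lambda>t. Q (z + t *\<^sub>R a) b) has_real_derivative - H z a b) (at 0)"
    and H_deriv0: "\<And>z u v. z \<in> interior K \<Longrightarrow> u \<in> K \<Longrightarrow> v \<in> K \<Longrightarrow>
      \<exists>T. ((\<lambda>t. H (z + t *\<^sub>R u) v u) has_real_derivative - T) (at 0) \<and> 0 \<le> T \<and>
          (\<forall>h\<ge>0. h *\<^sub>R z - u \<in> K \<longrightarrow> T \<le> 2 * H z v u * h)"
    and Q_self: "\<And>z. z \<in> interior K \<Longrightarrow> Q z z = \<nu>"
    and H_self: "\<And>z v. z \<in> interior K \<Longrightarrow> H z z v = Q z v"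
    and Q_scale: "\<And>z t v. z \<in> interior K \<Longrightarrow> 0 < t \<Longrightarrow> Q (t *\<^sub>R z) v = Q z v / t"
    and dikin: "\<And>z x. z \<in> interior K \<Longrightarrow> x \<in> K \<Longrightarrow> sqrt (H z x x) *\<^sub>R z - x \<in> K"
begin

lemma Q_deriv:
  assumes "z + t *\<^sub>R a \<in> interior K"
  shows "((\<lambda>t. Q (z + t *\<^sub>R a) b) has_real_derivative - H (z + t *\<^sub>R a) a b) (at t)"
proof -
  have "((\<lambda>s. Q (z + (s + t) *\<^sub>R a) b) has_real_derivative - H (z + t *\<^sub>R a) a b) (at 0)"
    using Q_deriv0[OF assms, of a b] by (simp add: algebra_simps)
  then show ?thesis using DERIV_shift[of "\<lambda>s. Q (z + s *\<^sub>R a) b" _ 0 t] by simp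
qed

lemma H_deriv:
  assumes "z + t *\<^sub>R u \<in> interior K" "u \<in> K" "v \<in> K"
  shows "\<exists>T. ((\<lambda>t. H (z + t *\<^sub>R u) v u) has_real_derivative - T) (at t) \<and> 0 \<le> T \<and>
          (\<forall>h\<ge>0. h *\<^sub>R (z + t *\<^sub>R u) - u \<in> K \<longrightarrow> T \<le> 2 * H (z + t *\<^sub>R u) v u * h)"
proof -
  obtain T where T: "((\<lambda>s. H (z + t *\<^sub>R u + s *\<^sub>R u) v u) has_real_derivative - T) (at 0)" "0 \<le> T"
     "\<forall>h\<ge>0. h *\<^sub>R (z + t *\<^sub>R u) - u \<in> K \<longrightarrow> T \<le> 2 * H (z + t *\<^sub>R u) v u * h"
    using H_deriv0[OF assms] by blast
  have "((\<lambda>s. H (z + (s + t) *\<^sub>R u) v u) has_real_derivative - T) (at 0)"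
    using T(1) by (simp add: algebra_simps)
  then have "((\<lambda>s. H (z + s *\<^sub>R u) v u) has_real_derivative - T) (at t)"
    using DERIV_shift[of "\<lambda>s. H (z + s *\<^sub>R u) v u" _ 0 t] by simp
  then show ?thesis using T by blast
qed

text \<open>The third derivative is squeezed, \<open>0 \<le> T \<le> 2 * H z v u * h\<close> with
  \<open>h > 0\<close>, and this forces the sign of the second.\<close>

lemma H_nonneg:
  assumes "z \<in> interior K" "u \<in> K" "v \<in> K" shows "0 \<le> H z u v"
proof -
  obtain h where h: "0 < h" "h *\<^sub>R z - u \<in> K" using int_dominates[OF assms(1)] by blast
  obtain T where "0 \<le> T" "T \<le> 2 * H z v u * h" using H_deriv0[OF assms] h by (meson less_imp_le)
  then have "0 \<le> H z v u * h" by linarith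
  then show ?thesis using h(1) H_sym[OF assms(1)] by (simp add: zero_le_mult_iff)
qed

text \<open>Makes \<open>Q (z + s u) v\<close> convex in \<open>s\<close>, the source of the tangent
  and chord estimates along rays.\<close>

lemma H_antimono:
  assumes "z \<in> interior K" "u \<in> K" "v \<in> K" "0 \<le> s" "s \<le> t"
  shows "H (z + t *\<^sub>R u) v u \<le> H (z + s *\<^sub>R u) v u"
proof (rule DERIV_nonpos_imp_nonincreasing[OF assms(5)])
  fix x assume "s \<le> x" "x \<le> t"
  then have "z + x *\<^sub>R u \<in> interior K" using assms by (intro int_add K_scale) auto
  from H_deriv[OF this assms(2,3)]
  show "\<exists>y. ((\<lambda>t. H (z + t *\<^sub>R u) v u) has_real_derivative y) (at x) \<and> y \<le> 0"
    by (meson neg_le_0_iff_le)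
qed

lemma Q_nonneg: "z \<in> interior K \<Longrightarrow> v \<in> K \<Longrightarrow> 0 \<le> Q z v"
  using H_nonneg[of z z v] H_self[of z v] int_K by simp

lemma Q_mono:
  assumes "z \<in> interior K" "x \<in> K" "v \<in> K" shows "Q (z + x) v \<le> Q z v"
proof -
  have "Q (z + 1 *\<^sub>R x) v \<le> Q (z + 0 *\<^sub>R x) v"
  proof (rule DERIV_nonpos_imp_nonincreasing[of 0 1 "\<lambda>t. Q (z + t *\<^sub>R x) v"])
    fix t :: real assume t: "0 \<le> t" "t \<le> 1"
    have i: "z + t *\<^sub>R x \<in> interior K" using assms t by (intro int_add K_scale) auto
    show "\<exists>y. ((\<lambda>t. Q (z + t *\<^sub>R x) v) has_real_derivative y) (at t) \<and> y \<le> 0"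
      using Q_deriv[OF i, of v] H_nonneg[OF i assms(2,3)] by (meson neg_le_0_iff_le)
  qed simp
  then show ?thesis by simp
qed

text \<open>Analogues of the Sherman--Morrison formula: for \<open>u = x x\<^sup>T\<close> and the barrier \<open>- log det\<close>, both
  hold with equality.\<close>

lemma sherman_morrison_add:
  assumes z: "z \<in> interior K" and u: "u \<in> K" and v: "v \<in> K"
    and h: "0 \<le> h" "h *\<^sub>R z - u \<in> K" and t: "0 \<le> t"
  shows "Q (z + t *\<^sub>R u) v \<le> Q z v - H z v u * t / (1 + h * t)"
proof -
  have i: "z + s *\<^sub>R u \<in> interior K" if "0 \<le> s" for s using that z u by (intro int_add K_scale)
  have p: "0 < 1 + h * s" if "0 \<le> s" for s using that h by (simp add: add_pos_nonneg)
  \<comment> \<open>By \<open>dominated_add\<close>, \<open>z + s u\<close> dominates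
    \<open>u\<close> with coefficient \<open>h / (1 + h s)\<close>, so the derivative of
    \<open>H\<close> is at least \<open>- 2 h / (1 + h s)\<close> times \<open>H\<close>. The factor
    \<open>(1 + h s)^2\<close> compensates exactly this decay.\<close>
  have W: "H z v u \<le> H (z + s *\<^sub>R u) v u * (1 + h * s)\<^sup>2" if s: "0 \<le> s" for s
  proof -
    have "H (z + 0 *\<^sub>R u) v u * (1 + h * 0)\<^sup>2 \<le> H (z + s *\<^sub>R u) v u * (1 + h * s)\<^sup>2"
    proof (rule DERIV_nonneg_imp_nondecreasing[OF s])
      fix x assume x: "0 \<le> x" "x \<le> s"
      obtain T where T: "((\<lambda>t. H (z + t *\<^sub>R u) v u) has_real_derivative - T) (at x)"
          "T \<le> 2 * H (z + x *\<^sub>R u) v u * (h / (1 + h * x))"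
        using H_deriv[OF i[OF x(1)] u v] dominated_add[OF h(2,1) x(1)] h(1) p[OF x(1)]
        by (metis divide_nonneg_pos)
      have "((\<lambda>t. H (z + t *\<^sub>R u) v u * (1 + h * t)\<^sup>2) has_real_derivative
         - T * (1 + h * x)\<^sup>2 + H (z + x *\<^sub>R u) v u * (2 * (1 + h * x) * h)) (at x)"
        by (auto intro!: derivative_eq_intros T(1) simp: algebra_simps power2_eq_square)
      moreover have le: "T * (1 + h * x)\<^sup>2 \<le> 2 * H (z + x *\<^sub>R u) v u * (h / (1 + h * x)) * (1 + h * x)\<^sup>2"
        using T(2) by (intro mult_right_mono) auto
      have "0 \<le> - T * (1 + h * x)\<^sup>2 + H (z + x *\<^sub>R u) v u * (2 * (1 + h * x) * h)"
      proof -
        have "(h / (1 + h * x)) * (1 + h * x)\<^sup>2 = h * (1 + h * x)"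
          using p[OF x(1)] by (simp add: power2_eq_square)
        then have "2 * H (z + x *\<^sub>R u) v u * (h / (1 + h * x)) * (1 + h * x)\<^sup>2 =
            H (z + x *\<^sub>R u) v u * (2 * (1 + h * x) * h)"
          by (simp only: mult.assoc) simp
        then show ?thesis using le by simp
      qed
      ultimately show "\<exists>y. ((\<lambda>t. H (z + t *\<^sub>R u) v u * (1 + h * t)\<^sup>2) has_real_derivative y) (at x) \<and> 0 \<le> y"
        by blast
    qed
    then show ?thesis by simp
  qed
  have "Q (z + t *\<^sub>R u) v + H z v u * (t / (1 + h * t)) \<le> Q (z + 0 *\<^sub>R u) v + H z v u * (0 / (1 + h * 0))"
  proof (rule DERIV_nonpos_imp_nonincreasing[OF t])
    fix x assume x: "0 \<le> x" "x \<le> t"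
    have "((\<lambda>t. Q (z + t *\<^sub>R u) v + H z v u * (t / (1 + h * t))) has_real_derivative
      - H (z + x *\<^sub>R u) u v + H z v u * (1 / (1 + h * x)\<^sup>2)) (at x)"
      using p[OF x(1)] by (auto intro!: derivative_eq_intros Q_deriv i x simp: power2_eq_square) (simp add: algebra_simps)
    moreover have "- H (z + x *\<^sub>R u) u v + H z v u * (1 / (1 + h * x)\<^sup>2) \<le> 0"
      using W[OF x(1)] p[OF x(1)] H_sym[OF i[OF x(1)], of u v] by (simp add: divide_simps)
    ultimately show "\<exists>y. ((\<lambda>t. Q (z + t *\<^sub>R u) v + H z v u * (t / (1 + h * t))) has_real_derivative y) (at x) \<and> y \<le> 0"
      by blast
  qed
  then show ?thesis by simp
qed

lemma sherman_morrison_sub: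
  assumes z: "z \<in> interior K" and u: "u \<in> K" and v: "v \<in> K"
    and h: "0 \<le> h" "h *\<^sub>R z - u \<in> K" and t: "0 \<le> t" "t * h < 1"
  shows "Q (z - t *\<^sub>R u) v \<le> Q z v + H z v u * t / (1 - h * t)"
proof -
  define y where "y = z - t *\<^sub>R u"
  have th: "x * h < 1" if "0 \<le> x" "x \<le> t" for x
    using mult_right_mono[OF that(2) h(1)] t(2) by linarith
  have i: "z - x *\<^sub>R u \<in> interior K" if "0 \<le> x" "x \<le> t" for x
    using int_sub[OF z h(2) that(1) th[OF that]] .
  have i': "z + (- x) *\<^sub>R u \<in> interior K" if "0 \<le> x" "x \<le> t" for x
    using i[OF that] by simp
  have p: "0 < 1 - h * x" if "0 \<le> x" "x \<le> t" for x using th[OF that] by (simp add: mult.commute)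
  have Hd: "\<exists>T. ((\<lambda>t. H (z - t *\<^sub>R u) v u) has_real_derivative T) (at x) \<and>
      T \<le> 2 * H (z - x *\<^sub>R u) v u * (h / (1 - h * x))" if x: "0 \<le> x" "x \<le> t" for x
  proof -
    obtain T where T: "((\<lambda>t. H (z + t *\<^sub>R u) v u) has_real_derivative - T) (at (- x))"
          "T \<le> 2 * H (z - x *\<^sub>R u) v u * (h / (1 - h * x))"
      using H_deriv[OF i'[OF x] u v] dominated_sub[OF h(2,1) x(1) th[OF x]] h(1) p[OF x]
      by (metis divide_nonneg_pos diff_conv_add_uminus scaleR_minus_left)
    have "((\<lambda>s. H (z + (- s) *\<^sub>R u) v u) has_real_derivative - (- T)) (at x)"
      using T(1) DERIV_mirror[of "\<lambda>t. H (z + t *\<^sub>R u) v u" "- T" x] by simp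
    then show ?thesis using T(2) by auto
  qed
  have Qd: "((\<lambda>t. Q (z - t *\<^sub>R u) v) has_real_derivative H (z - x *\<^sub>R u) u v) (at x)"
    if x: "0 \<le> x" "x \<le> t" for x
  proof -
    have "((\<lambda>s. Q (z + (- s) *\<^sub>R u) v) has_real_derivative - (- H (z + (- x) *\<^sub>R u) u v)) (at x)"
      using Q_deriv[OF i'[OF x], of v] DERIV_mirror[of "\<lambda>t. Q (z + t *\<^sub>R u) v" _ x] by metis
    then show ?thesis by simp
  qed
  have W: "H (z - s *\<^sub>R u) v u * (1 - h * s)\<^sup>2 \<le> H z v u" if s: "0 \<le> s" "s \<le> t" for s
  proof -
    have "H (z - s *\<^sub>R u) v u * (1 - h * s)\<^sup>2 \<le> H (z - 0 *\<^sub>R u) v u * (1 - h * 0)\<^sup>2"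
    proof (rule DERIV_nonpos_imp_nonincreasing[OF s(1)])
      fix x assume x: "0 \<le> x" "x \<le> s"
      then have xt: "x \<le> t" using s by linarith
      obtain T where T: "((\<lambda>t. H (z - t *\<^sub>R u) v u) has_real_derivative T) (at x)"
          "T \<le> 2 * H (z - x *\<^sub>R u) v u * (h / (1 - h * x))" using Hd[OF x(1) xt] by blast
      have "((\<lambda>t. H (z - t *\<^sub>R u) v u * (1 - h * t)\<^sup>2) has_real_derivative
         T * (1 - h * x)\<^sup>2 - H (z - x *\<^sub>R u) v u * (2 * (1 - h * x) * h)) (at x)"
        by (auto intro!: derivative_eq_intros T(1) simp: algebra_simps power2_eq_square)
      moreover have le: "T * (1 - h * x)\<^sup>2 \<le> 2 * H (z - x *\<^sub>R u) v u * (h / (1 - h * x)) * (1 - h * x)\<^sup>2"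
        using T(2) by (intro mult_right_mono) auto
      have "T * (1 - h * x)\<^sup>2 - H (z - x *\<^sub>R u) v u * (2 * (1 - h * x) * h) \<le> 0"
      proof -
        have "(h / (1 - h * x)) * (1 - h * x)\<^sup>2 = h * (1 - h * x)"
          using p[OF x(1) xt] by (simp add: power2_eq_square)
        then have "2 * H (z - x *\<^sub>R u) v u * (h / (1 - h * x)) * (1 - h * x)\<^sup>2 =
            H (z - x *\<^sub>R u) v u * (2 * (1 - h * x) * h)"
          by (simp only: mult.assoc) simp
        then show ?thesis using le by simp
      qed
      ultimately show "\<exists>y. ((\<lambda>t. H (z - t *\<^sub>R u) v u * (1 - h * t)\<^sup>2) has_real_derivative y) (at x) \<and> y \<le> 0"
        by blast
    qed
    then show ?thesis by simp
  qed
  have "Q (z - t *\<^sub>R u) v - H z v u * (t / (1 - h * t)) \<le> Q (z - 0 *\<^sub>R u) v - H z v u * (0 / (1 - h * 0))"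
  proof (rule DERIV_nonpos_imp_nonincreasing[OF t(1)])
    fix x assume x: "0 \<le> x" "x \<le> t"
    have "((\<lambda>t. Q (z - t *\<^sub>R u) v - H z v u * (t / (1 - h * t))) has_real_derivative
      H (z - x *\<^sub>R u) u v - H z v u * (1 / (1 - h * x)\<^sup>2)) (at x)"
      using p[OF x] by (auto intro!: derivative_eq_intros Qd x simp: power2_eq_square) (simp add: algebra_simps)
    moreover have "H (z - x *\<^sub>R u) u v - H z v u * (1 / (1 - h * x)\<^sup>2) \<le> 0"
      using W[OF x] p[OF x] H_sym[OF i[OF x], of u v] by (simp add: divide_simps)
    ultimately show "\<exists>y. ((\<lambda>t. Q (z - t *\<^sub>R u) v - H z v u * (t / (1 - h * t))) has_real_derivative y) (at x) \<and> y \<le> 0"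
      by blast
  qed
  then show ?thesis by simp
qed

text \<open>With \<open>n = sqrt (H z x x)\<close> from \<open>dikin\<close>,
  \<open>sherman_morrison_add\<close> in direction \<open>x\<close> gives
  \<open>n^2 t / (1 + n t) \<le> Q z x\<close>, because \<open>Q\<close> stays nonnegative. As
  \<open>t\<close> grows, the left side tends to \<open>n\<close>, so
  \<open>n \<le> Q z x\<close>.\<close>

lemma dominated_Q:
  assumes z: "z \<in> interior K" and x: "x \<in> K"
  shows "Q z x *\<^sub>R z - x \<in> K"
proof (cases "H z x x = 0")
  case True
  then have "x = 0" using dikin[OF z x] pointed_K[OF x] by simp
  moreover have "Q z 0 = 0" using Q_linear[OF z] linear_0 by blast
  ultimately show ?thesis using K_0 by simp
next
  case False
  define n where "n = sqrt (H z x x)"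
  have n: "0 < n" using H_nonneg[OF z x x] False by (simp add: n_def)
  have nn: "H z x x = n * n" using H_nonneg[OF z x x] by (simp add: n_def)
  have "n * n * t / (1 + n * t) \<le> Q z x" if t: "0 < t" for t
  proof -
    have "Q (z + t *\<^sub>R x) x \<le> Q z x - n * n * t / (1 + n * t)"
      using sherman_morrison_add[OF z x x less_imp_le[OF n] dikin[OF z x, folded n_def]] t nn by simp
    moreover have "0 \<le> Q (z + t *\<^sub>R x) x"
      using t by (intro Q_nonneg int_add z K_scale x) auto
    ultimately show ?thesis by linarith
  qed
  moreover have "((\<lambda>t. n * n * t / (1 + n * t)) \<longlongrightarrow> n) at_top"
  proof -
    have "((\<lambda>t. n * n / (1 / t + n)) \<longlongrightarrow> n * n / (0 + n)) at_top"
      using n by (intro tendsto_intros tendsto_divide_0[OF tendsto_const] filterlim_at_top_imp_at_infinity filterlim_ident) auto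
    moreover have "eventually (\<lambda>t. n * n / (1 / t + n) = n * n * t / (1 + n * t)) at_top"
      using eventually_gt_at_top[of 0]
      by eventually_elim (use n in \<open>simp add: field_simps add_pos_pos\<close>)
    ultimately show ?thesis using n by (simp add: tendsto_cong)
  qed
  ultimately have "n \<le> Q z x"
    by (intro tendsto_upperbound[OF _ _ trivial_limit_at_top_linorder])
      (auto intro: eventually_mono[OF eventually_gt_at_top[of 0]])
  then have "(Q z x - n) *\<^sub>R z + (n *\<^sub>R z - x) \<in> K"
    using dikin[OF z x] int_K[OF z] by (intro K_add K_scale) (auto simp: n_def)
  then show ?thesis by (simp add: algebra_simps)
qed

lemma Q_pos:
  assumes "z \<in> interior K" "x \<in> K" "x \<noteq> 0" shows "0 < Q z x"
proof (rule ccontr)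
  assume "\<not> 0 < Q z x"
  then have "Q z x = 0" using Q_nonneg assms by force
  then show False using dominated_Q[OF assms(1,2)] pointed_K[OF assms(2)] assms(3) by simp
qed

text \<open>\<open>H z x x = 0\<close> would put \<open>- x\<close> into \<open>K\<close> by
  \<open>dikin\<close>; positivity passes to \<open>H z e x\<close> because a multiple of
  \<open>e\<close> dominates \<open>x\<close>.\<close>

lemma H_pos:
  assumes "z \<in> interior K" "e \<in> interior K" "x \<in> K" "x \<noteq> 0" shows "0 < H z e x"
proof -
  obtain h where h: "0 < h" "h *\<^sub>R e - x \<in> K" using int_dominates[OF assms(2)] by blast
  have "H z x x \<noteq> 0" using dikin[OF assms(1,3)] pointed_K[OF assms(3)] assms(4) by auto
  then have "0 < H z x x" using H_nonneg[OF assms(1,3,3)] by simp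
  also have "\<dots> \<le> H z x (h *\<^sub>R e)"
  proof -
    have "0 \<le> H z x (h *\<^sub>R e - x)" using H_nonneg assms h by blast
    then show ?thesis using linear_diff[OF H_linear[OF assms(1)]] by simp
  qed
  also have "\<dots> = h * H z x e" using linear_scale[OF H_linear[OF assms(1)]] by simp
  finally show ?thesis using h(1) H_sym[OF assms(1)] by (simp add: zero_less_mult_iff)
qed

text \<open>\<open>dominated_Q\<close> for \<open>x = z\<close> puts \<open>(\<nu> - 1) z\<close>
  into \<open>K\<close>, which pointedness forbids for \<open>\<nu> < 1\<close>.\<close>

lemma \<nu>_ge_1:
  assumes "z \<in> interior K" "u \<noteq> (0::'a)" shows "1 \<le> \<nu>"
proof (rule ccontr)
  assume "\<not> 1 \<le> \<nu>"
  then have "(1 / (1 - \<nu>)) *\<^sub>R (\<nu> *\<^sub>R z - z) \<in> K"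
    using dominated_Q[OF assms(1) int_K[OF assms(1)]] Q_self[OF assms(1)] by (intro K_scale) auto
  moreover have "(1 / (1 - \<nu>)) *\<^sub>R (\<nu> *\<^sub>R z - z) = ((1 / (1 - \<nu>)) * (\<nu> - 1)) *\<^sub>R z"
    by (simp only: scaleR_scaleR[symmetric] scaleR_diff_left scaleR_one)
  moreover have "(1 / (1 - \<nu>)) * (\<nu> - 1) = -1" using \<open>\<not> 1 \<le> \<nu>\<close> by (simp add: divide_simps)
  ultimately have "- z \<in> K" by simp
  then show False using pointed_K int_K int_nonzero assms by blast
qed

end

section \<open>Convex functions on a window\<close>

lemma chord_of_convex:
  assumes "convex_on S g" "a \<in> S" "b \<in> S" "0 \<le> u" "u \<le> (1::real)"
  shows "g ((1 - u) *\<^sub>R a + u *\<^sub>R b) \<le> (1 - u) * g a + u * g b"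
  using convex_onD[OF assms(1,4,5,2,3)] .

text \<open>Here \<open>B - J\<close> measures the curvature of \<open>g\<close> on the whole window \<open>{0..M}\<close>; the other two quantities
  are the curvature terms lost in the averaging argument below.\<close>

lemma convex_window:
  fixes g :: "real \<Rightarrow> real" and M w :: real
  assumes M: "2 \<le> M" and cvx: "convex_on {0..M + 1} g" and cont: "continuous_on {0..M + 1} g"
    and tangent: "\<And>s. s \<in> {0..M + 1} \<Longrightarrow> g M - (s - M) * w \<le> g s"
  defines "B \<equiv> g 0 - g M" and "J \<equiv> integral {0..1} g - integral {M..M + 1} g"
  shows "B - M * w \<le> 2 * M * (B - J)"
    and "g 0 + g M - 2 / M * integral {0..M} g \<le> M / 2 * (B - J)"
proof -
  have int: "g integrable_on {a..b}" if "0 \<le> a" "b \<le> M + 1" for a b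
    using that by (intro integrable_continuous_real continuous_on_subset[OF cont]) auto
  \<comment> \<open>A lower bound for \<open>B - J\<close>, obtained by replacing \<open>g\<close>
    on \<open>{M..M + 1}\<close> by its supporting line at \<open>M\<close>. Both claims are bounded
    by a multiple of \<open>X\<close>.\<close>
  define X where "X = g 0 - integral {0..1} g - w / 2"
  have "integral {M..M+1} (\<lambda>s. g M - (s - M) * w) \<le> integral {M..M + 1} g"
    using M by (intro integral_le int tangent integrable_continuous_real continuous_intros) auto
  moreover have "((\<lambda>s. g M - (s - M) * w) has_integral g M - w / 2) {M..M+1}"
  proof -
    have "((\<lambda>s. g M - (s - M) * w) has_integral
       (g M * (M + 1) - (M + 1 - M)\<^sup>2 / 2 * w) - (g M * M - (M - M)\<^sup>2 / 2 * w)) {M..M+1}"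
      by (rule fundamental_theorem_of_calculus)
        (auto intro!: derivative_eq_intros simp flip: has_real_derivative_iff_has_vector_derivative)
    then show ?thesis by (simp add: algebra_simps)
  qed
  ultimately have EX: "X \<le> B - J" by (simp add: X_def B_def J_def integral_unique)
  have "integral {0..1} g \<le> integral {0..1} (\<lambda>s. g 0 - s * (B / M))"
  proof (intro integral_le int integrable_continuous_real continuous_intros)
    fix s :: real assume s: "s \<in> {0..1}"
    have "g ((1 - s / M) *\<^sub>R 0 + (s / M) *\<^sub>R M) \<le> (1 - s / M) * g 0 + s / M * g M"
      using s M by (intro chord_of_convex[OF cvx]) auto
    then show "g s \<le> g 0 - s * (B / M)" using M by (simp add: B_def field_simps)
  qed (use M in auto)
  moreover have "((\<lambda>s. g 0 - s * (B / M)) has_integral g 0 - B / M / 2) {0..1::real}"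
  proof -
    have "((\<lambda>s. g 0 - s * (B / M)) has_integral
       (g 0 * 1 - 1\<^sup>2 / 2 * (B / M)) - (g 0 * 0 - 0\<^sup>2 / 2 * (B / M))) {0..1::real}"
      by (rule fundamental_theorem_of_calculus)
        (use M in \<open>auto intro!: derivative_eq_intros simp flip: has_real_derivative_iff_has_vector_derivative\<close>)
    then show ?thesis by (simp add: mult.commute)
  qed
  ultimately have "B / M / 2 - w / 2 \<le> X" by (simp add: X_def integral_unique)
  then have "B / M / 2 - w / 2 \<le> B - J" using EX by linarith
  then have "2 * M * (B / M / 2 - w / 2) \<le> 2 * M * (B - J)" using M by (intro mult_left_mono) auto
  then show "B - M * w \<le> 2 * M * (B - J)" using M by (simp add: algebra_simps)
  \<comment> \<open>The window is cut at its midpoint. The right half is bounded below by the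
    supporting line at \<open>M\<close>, the left half by extrapolating the chord from
    \<open>0\<close> through \<open>s\<close> in \<open>{0..1}\<close> out to
    \<open>k s\<close>.\<close>
  define k where "k = M / 2"
  have k: "1 \<le> k" "M = 2 * k" using M by (auto simp: k_def)
  have split: "integral {0..M} g = integral {0..k} g + integral {k..M} g"
    using k by (intro Henstock_Kurzweil_Integration.integral_combine[symmetric] int) auto
  have "integral {k..M} (\<lambda>s. g M - (s - M) * w) \<le> integral {k..M} g"
    using k by (intro integral_le int tangent integrable_continuous_real continuous_intros) auto
  moreover have "((\<lambda>s. g M - (s - M) * w) has_integral k * g M + k * k * w / 2) {k..M}"
  proof -
    have "((\<lambda>s. g M - (s - M) * w) has_integral
       (g M * M - (M - M)\<^sup>2 / 2 * w) - (g M * k - (k - M)\<^sup>2 / 2 * w)) {k..M}"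
      by (rule fundamental_theorem_of_calculus)
        (use k in \<open>auto intro!: derivative_eq_intros simp flip: has_real_derivative_iff_has_vector_derivative\<close>)
    moreover have "(g M * M - (M - M)\<^sup>2 / 2 * w) - (g M * k - (k - M)\<^sup>2 / 2 * w) = k * g M + k * k * w / 2"
      unfolding k(2) by (simp add: algebra_simps power2_eq_square)
    ultimately show ?thesis by (simp only:)
  qed
  ultimately have right: "k * g M + k * k * w / 2 \<le> integral {k..M} g" by (simp add: integral_unique)
  have stretch: "((\<lambda>s. g (k * s)) has_integral integral {0..k} g / k) {0..1}"
  proof -
    have "(g has_integral integral {0..k} g) (cbox 0 k)"
      using k int[of 0 k] by (simp add: has_integral_integrable_integral)
    from has_integral_affinity[OF this, of k 0]
    have "((\<lambda>s. g (k * s)) has_integral integral {0..k} g / k) ((\<lambda>s. s / k) ` {0..k})"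
      using k by (simp add: divide_inverse mult.commute)
    moreover have "(\<lambda>s. s / k) ` {0..k} = {0..1}" using k by simp
    ultimately show ?thesis by simp
  qed
  have g01: "continuous_on {0..1} g" using M by (intro continuous_on_subset[OF cont]) auto
  have "integral {0..1} (\<lambda>s. k * g s - (k - 1) * g 0) \<le> integral {0..k} g / k"
    unfolding integral_unique[OF stretch, symmetric]
  proof (rule integral_le)
    show "(\<lambda>s. k * g s - (k - 1) * g 0) integrable_on {0..1}"
      by (intro integrable_continuous_real continuous_intros g01)
    show "(\<lambda>s. g (k * s)) integrable_on {0..1}" using stretch by blast
    fix s :: real assume s: "s \<in> {0..1}"
    have "k * s \<le> k * 1" using s k by (intro mult_left_mono) auto
    then have "k * s \<le> M + 1" using k by linarith
    then have "g ((1 - 1 / k) *\<^sub>R 0 + (1 / k) *\<^sub>R (k * s)) \<le> (1 - 1 / k) * g 0 + 1 / k * g (k * s)"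
      using s k by (intro chord_of_convex[OF cvx]) auto
    then show "k * g s - (k - 1) * g 0 \<le> g (k * s)" using k by (simp add: field_simps)
  qed
  moreover have "integral {0..1} (\<lambda>s. k * g s - (k - 1) * g 0) = k * integral {0..1} g - (k - 1) * g 0"
    using has_integral_diff[OF has_integral_mult_right[OF integrable_integral[OF int[of 0 1]], of k]
        has_integral_const_real[of "(k - 1) * g 0" 0 1]] M
    by (intro integral_unique) simp
  ultimately have left: "k * integral {0..1} g - (k - 1) * g 0 \<le> integral {0..k} g / k" by simp
  have "g 0 + g M - 2 / M * integral {0..M} g = g 0 + g M - integral {0..k} g / k - integral {k..M} g / k"
  proof -
    have "2 / M = 1 / k" using k by simp
    then show ?thesis unfolding split by (simp only: add_divide_distrib ring_distribs) simp
  qed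
  also have "\<dots> \<le> g 0 + g M - (k * integral {0..1} g - (k - 1) * g 0) - (g M + k * w / 2)"
  proof -
    have "(k * g M + k * k * w / 2) / k \<le> integral {k..M} g / k" using right k by (intro divide_right_mono) auto
    moreover have "(k * g M + k * k * w / 2) / k = g M + k * w / 2" using k by (simp add: field_simps)
    ultimately show ?thesis using left by linarith
  qed
  also have "\<dots> = k * X" by (simp add: X_def algebra_simps)
  also have "\<dots> \<le> k * (B - J)" using EX k by (intro mult_left_mono) auto
  finally show "g 0 + g M - 2 / M * integral {0..M} g \<le> M / 2 * (B - J)" by (simp add: k_def)
qed

text \<open>The Cauchy-Schwarz inequality in quotient form: each term lies above its linearization
  at the common ratio \<open>l\<close>, and the linearizations sum to the left side.\<close>

lemma sum_square_ratio:
  fixes a b :: "'i \<Rightarrow> real"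
  assumes "finite I" "\<And>i. i \<in> I \<Longrightarrow> 0 < b i" "0 < sum b I"
  shows "(sum a I)\<^sup>2 / sum b I \<le> (\<Sum>i\<in>I. (a i)\<^sup>2 / b i)"
proof -
  define l where "l = sum a I / sum b I"
  have "(\<Sum>i\<in>I. 2 * l * a i - l\<^sup>2 * b i) \<le> (\<Sum>i\<in>I. (a i)\<^sup>2 / b i)"
  proof (rule sum_mono)
    fix i assume i: "i \<in> I"
    have "0 \<le> (a i - l * b i)\<^sup>2" by simp
    then show "2 * l * a i - l\<^sup>2 * b i \<le> (a i)\<^sup>2 / b i"
      using assms(2)[OF i] by (simp add: field_simps power2_eq_square)
  qed
  moreover have "(\<Sum>i\<in>I. 2 * l * a i - l\<^sup>2 * b i) = 2 * l * sum a I - l\<^sup>2 * sum b I"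
    by (simp add: sum_subtractf sum_distrib_left)
  moreover have "\<dots> = (sum a I)\<^sup>2 / sum b I"
    using assms(3) by (simp add: l_def power2_eq_square)
  ultimately show ?thesis by simp
qed

section \<open>Gain of a single step\<close>

context pairwise_barrier begin

section \<open>Monotonicity and convexity along a ray\<close>

lemma ray_int: "z \<in> interior K \<Longrightarrow> e \<in> K \<Longrightarrow> 0 \<le> s \<Longrightarrow> z + s *\<^sub>R e \<in> interior K"
  by (intro int_add K_scale)

text \<open>\<open>z + s e\<close> is dominated by \<open>(1 + s h) z\<close>, and \<open>Q\<close>
  is antitone and homogeneous of degree -1.\<close>

lemma Q_ray_lower:
  assumes z: "z \<in> interior K" and e: "e \<in> K" and v: "v \<in> K"
    and h: "0 \<le> h" "h *\<^sub>R z - e \<in> K" and s: "0 \<le> s"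
  shows "Q z v / (1 + s * h) \<le> Q (z + s *\<^sub>R e) v"
proof -
  have p: "0 < 1 + s * h" using h s by (simp add: add_pos_nonneg)
  have "Q (z + s *\<^sub>R e + s *\<^sub>R (h *\<^sub>R z - e)) v \<le> Q (z + s *\<^sub>R e) v"
    using assms by (intro Q_mono ray_int K_scale)
  moreover have "z + s *\<^sub>R e + s *\<^sub>R (h *\<^sub>R z - e) = (1 + s * h) *\<^sub>R z" by (simp add: algebra_simps)
  ultimately show ?thesis using Q_scale[OF z p] by simp
qed

text \<open>The rate of decrease \<open>H\<close> itself decreases along the ray, so the drop is at
  least \<open>d\<close> times the final rate.\<close>

lemma Q_drop:
  assumes z: "z \<in> interior K" and e: "e \<in> K" and v: "v \<in> K" and d: "0 \<le> d"
  shows "d * H (z + d *\<^sub>R e) v e \<le> Q z v - Q (z + d *\<^sub>R e) v"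
proof -
  define k where "k = H (z + d *\<^sub>R e) v e"
  have "Q (z + d *\<^sub>R e) v + d * k \<le> Q (z + 0 *\<^sub>R e) v + 0 * k"
  proof (rule DERIV_nonpos_imp_nonincreasing[OF d])
    fix s assume s: "0 \<le> s" "s \<le> d"
    have zs: "z + s *\<^sub>R e \<in> interior K" using s by (intro ray_int z e)
    have "((\<lambda>s. Q (z + s *\<^sub>R e) v + s * k) has_real_derivative - H (z + s *\<^sub>R e) e v + k) (at s)"
      by (auto intro!: derivative_eq_intros Q_deriv zs)
    moreover have "- H (z + s *\<^sub>R e) e v + k \<le> 0"
      using H_antimono[OF z e v s] H_sym[OF zs] by (simp add: k_def)
    ultimately show "\<exists>f'. ((\<lambda>s. Q (z + s *\<^sub>R e) v + s * k) has_real_derivative f') (at s) \<and> f' \<le> 0"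
      by blast
  qed
  then show ?thesis by (simp add: k_def)
qed

lemma Q_ray_continuous:
  assumes "z \<in> interior K" "e \<in> K" "A \<subseteq> {0..}"
  shows "continuous_on A (\<lambda>s. Q (z + s *\<^sub>R e) v)"
proof (intro continuous_at_imp_continuous_on ballI)
  fix s assume "s \<in> A"
  then have "z + s *\<^sub>R e \<in> interior K" using assms by (intro ray_int) auto
  from Q_deriv[OF this] show "isCont (\<lambda>s. Q (z + s *\<^sub>R e) v) s" by (rule DERIV_isCont)
qed

lemma H_ray_continuous:
  assumes "z \<in> interior K" "e \<in> K" "v \<in> K" "A \<subseteq> {0..}"
  shows "continuous_on A (\<lambda>s. H (z + s *\<^sub>R e) v e)"
proof (intro continuous_at_imp_continuous_on ballI)
  fix s assume "s \<in> A"
  then have "z + s *\<^sub>R e \<in> interior K" using assms by (intro ray_int) auto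
  from H_deriv[OF this assms(2,3)] show "isCont (\<lambda>s. H (z + s *\<^sub>R e) v e) s"
    using DERIV_isCont by blast
qed

lemma H_ray_integral:
  assumes z: "z \<in> interior K" and e: "e \<in> K" and ab: "0 \<le> a" "a \<le> b"
  shows "((\<lambda>s. H (z + s *\<^sub>R e) e v) has_integral Q (z + a *\<^sub>R e) v - Q (z + b *\<^sub>R e) v) {a..b}"
proof -
  have "((\<lambda>s. - H (z + s *\<^sub>R e) e v) has_integral Q (z + b *\<^sub>R e) v - Q (z + a *\<^sub>R e) v) {a..b}"
    using ab assms by (intro fundamental_theorem_of_calculus)
      (auto intro!: has_field_derivative_at_within Q_deriv ray_int
        simp flip: has_real_derivative_iff_has_vector_derivative)
  from has_integral_neg[OF this] show ?thesis by simp
qed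

text \<open>Jensen's inequality for \<open>h \<mapsto> t / (1 + h t)\<close>: \<open>p\<close> bounds the average of \<open>h\<close> with respect to the
  weight \<open>D\<^sup>2\<phi>[e, x]\<close>.\<close>

lemma window_gain:
  fixes h :: "real \<Rightarrow> real"
  assumes z: "z \<in> interior K" and e: "e \<in> K" and x: "x \<in> K" and L: "0 \<le> L"
    and h: "continuous_on {0..L} h" "\<And>s. s \<in> {0..L} \<Longrightarrow> 0 \<le> h s"
      "\<And>s. s \<in> {0..L} \<Longrightarrow> h s *\<^sub>R (z + s *\<^sub>R e) - x \<in> K"
    and p: "0 \<le> p" "integral {0..L} (\<lambda>s. H (z + s *\<^sub>R e) e x * h s) \<le> (Q z x - Q (z + L *\<^sub>R e) x) * p"
    and t: "0 \<le> t"
  shows "(Q z x - Q (z + L *\<^sub>R e) x) * t / (1 + p * t) \<le>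
     integral {0..L} (\<lambda>s. Q (z + s *\<^sub>R e) e - Q (z + s *\<^sub>R e + t *\<^sub>R x) e)"
proof -
  define w where "w = (\<lambda>s. H (z + s *\<^sub>R e) e x)"
  define B where "B = Q z x - Q (z + L *\<^sub>R e) x"
  define P where "P = 1 + p * t"
  have P: "0 < P" using p t by (simp add: P_def add_pos_nonneg)
  have w_sym: "w s = H (z + s *\<^sub>R e) x e" if "0 \<le> s" for s
    using H_sym ray_int z e that by (simp add: w_def)
  have w_cont: "continuous_on {0..L} w"
    using H_ray_continuous[OF z e x, of "{0..L}"] by (rule continuous_on_cong[THEN iffD1, rotated 2]) (auto simp: w_sym)
  have wB: "(w has_integral B) {0..L}"
    using H_ray_integral[OF z e order_refl L, of x] by (simp add: w_def B_def)
  define W where "W = integral {0..L} (\<lambda>s. w s * h s)"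
  have wh: "((\<lambda>s. w s * h s) has_integral W) {0..L}"
    unfolding W_def by (intro integrable_integral integrable_continuous_real continuous_intros w_cont h)
  \<comment> \<open>The integrand is \<open>t * w s\<close> times the tangent of
    \<open>1 / k\<close> at \<open>k = P\<close>, where \<open>k = 1 + h s * t\<close>. Being affine
    in \<open>h s\<close>, it needs only the weighted mean of \<open>h\<close>, which
    \<open>p\<close> bounds.\<close>
  have "((\<lambda>s. t / P\<^sup>2 * ((1 + 2 * p * t) * w s - t * (w s * h s))) has_integral
      t / P\<^sup>2 * ((1 + 2 * p * t) * B - t * W)) {0..L}"
    by (intro has_integral_mult_right has_integral_diff wB wh)
  moreover have "((\<lambda>s. Q (z + s *\<^sub>R e) e - Q (z + s *\<^sub>R e + t *\<^sub>R x) e) has_integral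
     integral {0..L} (\<lambda>s. Q (z + s *\<^sub>R e) e - Q (z + s *\<^sub>R e + t *\<^sub>R x) e)) {0..L}"
  proof (intro integrable_integral integrable_continuous_real continuous_on_diff Q_ray_continuous z e)
    have "continuous_on {0..L} (\<lambda>s. Q ((z + t *\<^sub>R x) + s *\<^sub>R e) e)"
      by (intro Q_ray_continuous ray_int z x t e) auto
    then show "continuous_on {0..L} (\<lambda>s. Q (z + s *\<^sub>R e + t *\<^sub>R x) e)" by (simp add: algebra_simps)
  qed auto
  moreover have "t / P\<^sup>2 * ((1 + 2 * p * t) * w s - t * (w s * h s)) \<le>
     Q (z + s *\<^sub>R e) e - Q (z + s *\<^sub>R e + t *\<^sub>R x) e" if s: "s \<in> {0..L}" for s
  proof -
    define k where "k = 1 + h s * t"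
    have k: "0 < k" using h(2)[OF s] t by (simp add: k_def add_pos_nonneg)
    have zs: "z + s *\<^sub>R e \<in> interior K" using s by (intro ray_int z e) auto
    have w0: "0 \<le> w s" unfolding w_def by (intro H_nonneg zs e x)
    have "0 \<le> (P - k)\<^sup>2" by simp
    then have "(2 * P - k) / P\<^sup>2 \<le> 1 / k"
      using P k by (simp add: divide_simps power2_eq_square algebra_simps)
    then have "t * w s * ((2 * P - k) / P\<^sup>2) \<le> t * w s * (1 / k)" using t w0 by (intro mult_left_mono) auto
    moreover have "t / P\<^sup>2 * ((1 + 2 * p * t) * w s - t * (w s * h s)) = t * w s * ((2 * P - k) / P\<^sup>2)"
    proof -
      have "(1 + 2 * p * t) * w s - t * (w s * h s) = w s * (2 * P - k)"
        by (simp add: P_def k_def algebra_simps)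
      then show ?thesis by simp
    qed
    moreover have "t * w s * (1 / k) \<le> Q (z + s *\<^sub>R e) e - Q (z + s *\<^sub>R e + t *\<^sub>R x) e"
      using sherman_morrison_add[OF zs x e h(2,3)[OF s] t] by (simp add: k_def w_def mult.commute)
    ultimately show ?thesis by linarith
  qed
  ultimately have "t / P\<^sup>2 * ((1 + 2 * p * t) * B - t * W) \<le>
      integral {0..L} (\<lambda>s. Q (z + s *\<^sub>R e) e - Q (z + s *\<^sub>R e + t *\<^sub>R x) e)"
    by (rule has_integral_le)
  moreover have "B * t / P = t / P\<^sup>2 * ((1 + 2 * p * t) * B - t * (B * p))"
    using P by (simp add: P_def power2_eq_square divide_simps) (simp add: algebra_simps)
  moreover have "t / P\<^sup>2 * ((1 + 2 * p * t) * B - t * (B * p)) \<le> t / P\<^sup>2 * ((1 + 2 * p * t) * B - t * W)"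
  proof -
    have "t * W \<le> t * (B * p)" using p(2) t by (intro mult_left_mono) (auto simp: W_def w_def B_def)
    then show ?thesis using t by (intro mult_left_mono) auto
  qed
  ultimately show ?thesis by (simp add: B_def P_def)
qed

end

text \<open>Zero vectors are excluded so that every \<open>Q z (x i)\<close> and
  \<open>H z e (x i)\<close> is positive and can be divided by or compared strictly.\<close>

locale sparsification_instance = pairwise_barrier K \<nu> Q H
  for K :: "'a::euclidean_space set" and \<nu> Q H +
  fixes I :: "'i set" and x :: "'i \<Rightarrow> 'a" and e :: 'a
  assumes finite_I: "finite I" and x_K: "\<And>i. i \<in> I \<Longrightarrow> x i \<in> K" and x_nz: "\<And>i. i \<in> I \<Longrightarrow> x i \<noteq> 0"
    and sum_x: "sum x I = e" and e_int: "e \<in> interior K" and I_ne: "I \<noteq> {}"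
begin

lemma e_K: "e \<in> K" using e_int int_K by blast

lemma e_nz: "e \<noteq> 0" using int_nonzero[OF e_int] x_nz I_ne by blast

lemma sum_Q: "z \<in> interior K \<Longrightarrow> (\<Sum>i\<in>I. Q z (x i)) = Q z e"
  using linear_sum[OF Q_linear, of z x I] sum_x by simp

lemma sum_H: "z \<in> interior K \<Longrightarrow> (\<Sum>i\<in>I. H z a (x i)) = H z a e"
  using linear_sum[OF H_linear, of z a x I] sum_x by simp

text \<open>Here \<open>z\<close> is the distance from the current sum to the upper barrier. Moving
  the barrier by \<open>d e\<close> lowers the potential by \<Delta>; adding \<open>t x i\<close>
  raises it by at most \<open>H t / (1 - Q t)\<close>, taken at \<open>z + d e\<close>. This is at
  most \<Delta> once \<open>1 / t \<ge> Q + H / \<Delta>\<close>, the choice of \<theta>. The sum is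
  controlled by \<open>d * H y e e \<le> \<Delta>\<close>, which is convexity.\<close>

lemma upper_step:
  assumes z: "z \<in> interior K" "Q z e \<le> c" and d: "0 < d"
  obtains \<theta> where "sum \<theta> I \<le> c + 1 / d"
    and "\<And>i. i \<in> I \<Longrightarrow> 0 < \<theta> i"
    and "\<And>i t. i \<in> I \<Longrightarrow> 0 < t \<Longrightarrow> \<theta> i \<le> 1 / t \<Longrightarrow>
       z + d *\<^sub>R e - t *\<^sub>R x i \<in> interior K \<and> Q (z + d *\<^sub>R e - t *\<^sub>R x i) e \<le> c"
proof -
  define y where "y = z + d *\<^sub>R e"
  have y: "y \<in> interior K" unfolding y_def using d by (intro ray_int z e_K) auto
  define \<Delta> where "\<Delta> = Q z e - Q y e"
  have Hy: "0 < H y e e" using H_pos[OF y e_int e_K e_nz] .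
  have "d * H y e e \<le> \<Delta>"
    using Q_drop[OF z(1) e_K e_K, of d] d by (simp add: \<Delta>_def y_def)
  moreover have "0 < d * H y e e" using d Hy by simp
  ultimately have \<Delta>0: "0 < \<Delta>" by linarith
  have \<Delta>: "0 < \<Delta>" "H y e e / \<Delta> \<le> 1 / d"
    using \<open>d * H y e e \<le> \<Delta>\<close> d \<Delta>0 by (auto simp: field_simps)
  define \<theta> where "\<theta> i = Q y (x i) + H y e (x i) / \<Delta>" for i
  have "sum \<theta> I = Q y e + H y e e / \<Delta>"
    unfolding \<theta>_def by (simp add: sum.distrib sum_Q[OF y] sum_H[OF y] flip: sum_divide_distrib)
  moreover have "Q y e \<le> c" using \<Delta>(1) z(2) by (simp add: \<Delta>_def)
  ultimately have 1: "sum \<theta> I \<le> c + 1 / d" using \<Delta>(2) by linarith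
  have Hx: "0 < H y e (x i)" if "i \<in> I" for i using that y e_int x_K x_nz H_pos by blast
  have Qx: "0 < Q y (x i)" if "i \<in> I" for i using that y x_K x_nz Q_pos by blast
  have 2: "0 < \<theta> i" if "i \<in> I" for i
    using Hx[OF that] Qx[OF that] \<Delta>(1) by (simp add: \<theta>_def add_pos_pos)
  have 3: "y - t *\<^sub>R x i \<in> interior K \<and> Q (y - t *\<^sub>R x i) e \<le> c"
    if i: "i \<in> I" and t: "0 < t" "\<theta> i \<le> 1 / t" for i t
  proof -
    have a: "t * Q y (x i) + t * H y e (x i) / \<Delta> \<le> 1" using t by (simp add: \<theta>_def field_simps)
    moreover have "0 < t * H y e (x i) / \<Delta>" using t Hx[OF i] \<Delta> by simp
    ultimately have b: "t * Q y (x i) < 1" by linarith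
    have dom: "Q y (x i) *\<^sub>R y - x i \<in> K" using dominated_Q[OF y x_K[OF i]] .
    have "Q (y - t *\<^sub>R x i) e \<le> Q y e + H y e (x i) * t / (1 - Q y (x i) * t)"
      using sherman_morrison_sub[OF y x_K[OF i] e_K _ dom] Qx[OF i] t b by simp
    also have "H y e (x i) * t / (1 - Q y (x i) * t) \<le> \<Delta>"
      using a b \<Delta>(1) by (simp add: divide_simps) (simp add: algebra_simps)
    also have "Q y e + \<Delta> \<le> c" using z(2) by (simp add: \<Delta>_def)
    finally show ?thesis using int_sub[OF y dom _ b] t by simp
  qed
  show ?thesis using that[OF 1 2] 3 by (simp add: y_def)
qed

text \<open>The gain at \<open>y = z - e\<close> is bounded below by its mean over the segment from
  \<open>y\<close> to \<open>z\<close>. There the weight \<open>H\<close> is minus the derivative of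
  the dominating coefficient \<open>Q\<close>, so the weighted mean of \<open>Q\<close> is exactly
  the mean \<open>p\<close> of its two end values. Summed over \<open>I\<close> this costs
  \<open>(Q y e + Q z e) / 2\<close>, and \<open>Q y e \<le> c / (1 - c)\<close> accounts for the
  quadratic loss.\<close>

lemma lower_step_point:
  assumes z: "z \<in> interior K" "Q z e \<le> c" and c: "c < 1"
  obtains \<theta> where "1 - c - c\<^sup>2 / (2 * (1 - c)) \<le> sum \<theta> I"
    and "\<And>i t. i \<in> I \<Longrightarrow> 0 < t \<Longrightarrow> 1 / t \<le> \<theta> i \<Longrightarrow>
       z - e + t *\<^sub>R x i \<in> interior K \<and> Q (z - e + t *\<^sub>R x i) e \<le> c"
proof -
  define y where "y = z - e"
  define g where "g = Q z e"
  have g: "0 < g" "g \<le> c" using Q_pos[OF z(1) e_K e_nz] z(2) by (auto simp: g_def)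
  have y: "y \<in> interior K"
    using int_sub[OF z(1) dominated_Q[OF z(1) e_K], of 1] g c by (simp add: y_def g_def)
  have yz: "y + 1 *\<^sub>R e = z" by (simp add: y_def)
  have Qye: "Q y e \<le> c / (1 - c)"
  proof -
    have p: "0 < Q y e" using Q_pos[OF y e_K e_nz] .
    have "Q y e / (1 + Q y e) \<le> g"
      using Q_ray_lower[OF y e_K e_K _ dominated_Q[OF y e_K], of 1] p yz by (simp add: g_def)
    then have "Q y e / (1 + Q y e) \<le> c" using g by linarith
    then show ?thesis using p c by (simp add: field_simps)
  qed
  define B where "B = Q y e - Q z e"
  define b where "b i = Q y (x i) - Q z (x i)" for i
  define \<theta> where "\<theta> i = b i / B - (Q y (x i) + Q z (x i)) / 2" for i
  have "0 < B"
  proof -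
    have "0 < H z e e" using H_pos[OF z(1) e_int e_K e_nz] .
    moreover have "1 * H z e e \<le> B"
      using Q_drop[OF y e_K e_K, of 1] yz by (simp add: B_def)
    ultimately show ?thesis by linarith
  qed
  have "sum b I = B" unfolding b_def B_def by (simp add: sum_subtractf sum_Q y z)
  moreover have "sum \<theta> I = sum b I / B - ((\<Sum>i\<in>I. Q y (x i)) + (\<Sum>i\<in>I. Q z (x i))) / 2"
    by (simp add: \<theta>_def sum_subtractf sum_divide_distrib sum.distrib add_divide_distrib)
  ultimately have sum_\<theta>: "sum \<theta> I = 1 - (Q y e + Q z e) / 2"
    using \<open>0 < B\<close> sum_Q[OF y] sum_Q[OF z(1)] by simp
  have c_eq: "1 - c - c\<^sup>2 / (2 * (1 - c)) = 1 - (c / (1 - c) + c) / 2"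
    using c by (simp add: field_simps power2_eq_square)
  have 1: "1 - c - c\<^sup>2 / (2 * (1 - c)) \<le> sum \<theta> I"
  proof -
    have "(Q y e + Q z e) / 2 \<le> (c / (1 - c) + c) / 2" using Qye z(2) by (intro divide_right_mono add_mono) auto
    then show ?thesis unfolding sum_\<theta> c_eq by (rule diff_left_mono)
  qed
  have 2: "y + t *\<^sub>R x i \<in> interior K \<and> Q (y + t *\<^sub>R x i) e \<le> c"
    if i: "i \<in> I" and t: "0 < t" "1 / t \<le> \<theta> i" for i t
  proof -
    have xi: "x i \<in> K" using x_K i by blast
    define p where "p = (Q y (x i) + Q z (x i)) / 2"
    have p: "0 \<le> p" using Q_nonneg[OF y xi] Q_nonneg[OF z(1) xi] by (simp add: p_def)
    define D where "D s = Q (y + s *\<^sub>R e) e - Q (y + s *\<^sub>R e + t *\<^sub>R x i) e" for s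
    have sq: "((\<lambda>s. H (y + s *\<^sub>R e) e (x i) * Q (y + s *\<^sub>R e) (x i)) has_integral b i * p) {0..1}"
    proof -
      have "((\<lambda>s. H (y + s *\<^sub>R e) e (x i) * Q (y + s *\<^sub>R e) (x i)) has_integral
         (- (Q (y + 1 *\<^sub>R e) (x i))\<^sup>2 / 2) - (- (Q (y + 0 *\<^sub>R e) (x i))\<^sup>2 / 2)) {0..1}"
      proof (rule fundamental_theorem_of_calculus)
        fix s :: real assume s: "s \<in> {0..1}"
        have d: "((\<lambda>s. Q (y + s *\<^sub>R e) (x i)) has_real_derivative - H (y + s *\<^sub>R e) e (x i)) (at s within {0..1})"
          using s by (intro has_field_derivative_at_within[OF Q_deriv[OF ray_int[OF y e_K]]]) auto
        have "((\<lambda>s. - (Q (y + s *\<^sub>R e) (x i))\<^sup>2 / 2) has_real_derivative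
          H (y + s *\<^sub>R e) e (x i) * Q (y + s *\<^sub>R e) (x i)) (at s within {0..1})"
          by (auto intro!: derivative_eq_intros d)
        then show "((\<lambda>s. - (Q (y + s *\<^sub>R e) (x i))\<^sup>2 / 2) has_vector_derivative
          H (y + s *\<^sub>R e) e (x i) * Q (y + s *\<^sub>R e) (x i)) (at s within {0..1})"
          by (simp add: has_real_derivative_iff_has_vector_derivative)
      qed simp
      then show ?thesis unfolding b_def p_def yz by (simp add: field_simps power2_eq_square)
    qed
    have "b i * t / (1 + p * t) \<le> integral {0..1} D"
      unfolding b_def D_def yz[symmetric]
    proof (rule window_gain)
      show "continuous_on {0..1} (\<lambda>s. Q (y + s *\<^sub>R e) (x i))" by (intro Q_ray_continuous y e_K) auto
      show "0 \<le> Q (y + s *\<^sub>R e) (x i)" if "s \<in> {0..1}" for s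
        using that by (intro Q_nonneg ray_int y e_K xi) auto
      show "Q (y + s *\<^sub>R e) (x i) *\<^sub>R (y + s *\<^sub>R e) - x i \<in> K" if "s \<in> {0..1}" for s
        using that by (intro dominated_Q ray_int y e_K xi) auto
      show "integral {0..1} (\<lambda>s. H (y + s *\<^sub>R e) e (x i) * Q (y + s *\<^sub>R e) (x i))
         \<le> (Q y (x i) - Q (y + 1 *\<^sub>R e) (x i)) * p"
        unfolding integral_unique[OF sq] yz by (simp add: b_def)
    qed (use y e_K xi p t in auto)
    also have "integral {0..1} D \<le> integral {0..1} (\<lambda>s::real. D 0)"
    proof (rule integral_le)
      have "continuous_on {0..1} (\<lambda>s. Q (y + s *\<^sub>R e) e)"
        by (intro Q_ray_continuous y e_K) auto
      moreover have "continuous_on {0..1} (\<lambda>s. Q ((y + t *\<^sub>R x i) + s *\<^sub>R e) e)"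
        using t by (intro Q_ray_continuous ray_int y e_K xi) auto
      ultimately show "D integrable_on {0..1}"
        unfolding D_def by (intro integrable_continuous_real continuous_on_diff) (simp_all add: algebra_simps)
      fix s :: real assume s: "s \<in> {0..1}"
      \<comment> \<open>The gain from \<open>t x i\<close> shrinks along \<open>e\<close>: as a
        function of the amount \<open>r\<close> of \<open>x i\<close>, its rate is \<open>H\<close>
        in the directions \<open>x i\<close> and \<open>e\<close>, which is antitone in
        \<open>s\<close>.\<close>
      have "Q (y + 0 *\<^sub>R x i + s *\<^sub>R e) e - Q (y + 0 *\<^sub>R x i) e \<le> Q (y + t *\<^sub>R x i + s *\<^sub>R e) e - Q (y + t *\<^sub>R x i) e"
      proof (rule DERIV_nonneg_imp_nondecreasing[OF less_imp_le[OF t(1)]])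
        fix r assume r: "0 \<le> r" "r \<le> t"
        have yr: "y + r *\<^sub>R x i \<in> interior K" using r by (intro ray_int y xi)
        have ys: "(y + s *\<^sub>R e) + r *\<^sub>R x i \<in> interior K" using r s by (intro ray_int y xi e_K) auto
        have "((\<lambda>r. Q ((y + s *\<^sub>R e) + r *\<^sub>R x i) e - Q (y + r *\<^sub>R x i) e) has_real_derivative
           - H ((y + s *\<^sub>R e) + r *\<^sub>R x i) (x i) e - - H (y + r *\<^sub>R x i) (x i) e) (at r)"
          by (intro DERIV_diff Q_deriv ys yr)
        moreover have "H (y + r *\<^sub>R x i + s *\<^sub>R e) (x i) e \<le> H (y + r *\<^sub>R x i + 0 *\<^sub>R e) (x i) e"
          using s by (intro H_antimono yr e_K xi) auto
        ultimately show "\<exists>f'. ((\<lambda>r. Q (y + r *\<^sub>R x i + s *\<^sub>R e) e - Q (y + r *\<^sub>R x i) e) has_real_derivative f') (at r) \<and> 0 \<le> f'"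
          by (intro exI[of _ "- H ((y + s *\<^sub>R e) + r *\<^sub>R x i) (x i) e - - H (y + r *\<^sub>R x i) (x i) e"])
            (simp add: algebra_simps)
      qed
      then show "D s \<le> D 0" by (simp add: D_def algebra_simps)
    qed (intro integrable_continuous_real continuous_intros)
    also have "\<dots> = Q y e - Q (y + t *\<^sub>R x i) e" by (simp add: D_def)
    finally have gain: "b i * t / (1 + p * t) \<le> Q y e - Q (y + t *\<^sub>R x i) e" .
    have "B \<le> b i * t / (1 + p * t)"
    proof -
      have "1 / t + p \<le> b i / B" using t by (simp add: \<theta>_def p_def)
      moreover have "0 < 1 + p * t" using p t by (simp add: add_pos_nonneg)
      ultimately show ?thesis using t \<open>0 < B\<close> by (simp add: field_simps)
    qed
    then have "Q (y + t *\<^sub>R x i) e \<le> c" using gain z(2) by (simp add: B_def)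
    then show ?thesis using ray_int[OF y xi, of t] t by simp
  qed
  show ?thesis using that[OF 1] 2 by (simp add: y_def)
qed

end

text \<open>\<open>E = B - J\<close> measures curvature. It costs \<open>M / 2 * E + A / 6\<close>,
  at most \<open>5 * M / 6 * E\<close>; the surplus \<open>B / J - 1 \<ge> E / B\<close> pays for
  exactly that, thanks to \<open>M * B \<le> 6 / 5\<close>. What remains is
  \<open>gbar \<le> c + 5 / 4 * c * B\<close>, whose excess over \<open>c\<close> is balanced by the
  term in \<open>B^2\<close> up to a cubic error.\<close>

lemma window_arithmetic:
  fixes B J M c g0 gM gbar A :: real
  assumes c: "0 < c" "c \<le> 7 / 50" and M: "M * c = 4 / 5"
    and J: "0 < J" "J \<le> B" and MB: "M * B \<le> 6 / 5"
    and A: "A \<le> 2 * M * (B - J)" and L: "g0 + gM - 2 * gbar \<le> M / 2 * (B - J)"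
    and gbar: "M * gbar \<le> c * M + J" and g: "B = g0 - gM" "0 < gM" "gM \<le> c"
  shows "1 - c - 17 / 5 * c ^ 3 \<le> B / J - (g0 + gM - gbar - B\<^sup>2 / (3 * (g0 + gM)) + A / 6)"
proof -
  define E where "E = B - J"
  have E: "0 \<le> E" using J by (simp add: E_def)
  have B: "0 < B" using J by linarith
  have M0: "0 < M" using M c by (metis less_numeral_extra(3) mult_pos_pos zero_less_divide_iff zero_less_mult_pos2 zero_less_numeral)
  have i: "1 / M = 5 / 4 * c" using M M0 by (simp add: field_simps)
  have 1: "1 + E / B \<le> B / J"
  proof -
    have "B / J = 1 + E / J" using J by (simp add: E_def field_simps)
    moreover have "E / B \<le> E / J" using J E by (intro divide_left_mono) auto
    ultimately show ?thesis by simp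
  qed
  have 2: "5 * M / 6 * E \<le> E / B"
  proof -
    have "5 * M / 6 * B \<le> 1" using MB by simp
    then have "5 * M / 6 \<le> 1 / B" using B by (simp add: field_simps)
    then have "5 * M / 6 * E \<le> 1 / B * E" using E by (intro mult_right_mono) auto
    then show ?thesis by simp
  qed
  have 3: "gbar \<le> c + 5 / 4 * c * B"
  proof -
    have "gbar \<le> c + 1 / M * J" using gbar M0 by (simp add: field_simps)
    also have "1 / M * J \<le> 1 / M * B" using J M0 by (intro mult_left_mono) auto
    finally show ?thesis by (simp add: i)
  qed
  have g0M: "0 < g0 + gM" "g0 + gM \<le> 2 * c + B" using g B by auto
  have "B\<^sup>2 / (3 * (2 * c + B)) \<le> B\<^sup>2 / (3 * (g0 + gM))"
    using g0M c B by (intro divide_left_mono) auto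
  moreover have "5 / 4 * c * B - 17 / 5 * c ^ 3 \<le> B\<^sup>2 / (3 * (2 * c + B))"
  proof -
    \<comment> \<open>Clearing the denominator leaves the quadratic \<open>a B^2 + b B + d\<close>.
      Its discriminant is nonpositive for the coefficient 17/5 as long as
      \<open>c \<le> 7 / 50\<close>.\<close>
    define a where "a = 1 - 15 / 4 * c"
    define b where "b = (51 / 5 * c\<^sup>2 - 15 / 2 * c) * c"
    define d where "d = 102 / 5 * c ^ 4"
    have a: "0 < a" using c by (simp add: a_def)
    have "0 \<le> (2 * a * B + b)\<^sup>2" by simp
    moreover have "0 \<le> 4 * a * d - b\<^sup>2"
    proof -
      have e: "4 * a * d - b\<^sup>2 = c ^ 4 * (507 / 20 - 153 * c - 2601 / 25 * c\<^sup>2)"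
        unfolding a_def b_def d_def by (simp add: field_simps power2_eq_square power4_eq_xxxx)
      have "c\<^sup>2 \<le> (7 / 50)\<^sup>2" using c by (intro power_mono) auto
      then have "0 \<le> 507 / 20 - 153 * c - 2601 / 25 * c\<^sup>2" using c by (simp add: power2_eq_square)
      then show ?thesis unfolding e using c by (intro mult_nonneg_nonneg) auto
    qed
    ultimately have "0 \<le> 4 * a * (a * B\<^sup>2 + b * B + d)"
      by (simp add: algebra_simps power2_eq_square)
    then have "0 \<le> a * B\<^sup>2 + b * B + d" using a by (simp add: zero_le_mult_iff)
    moreover have "a * B\<^sup>2 + b * B + d = B\<^sup>2 - (5 / 4 * c * B - 17 / 5 * c ^ 3) * (3 * (2 * c + B))"
      unfolding a_def b_def d_def by (simp add: field_simps power2_eq_square power3_eq_cube power4_eq_xxxx)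
    ultimately show ?thesis using c B by (simp add: pos_le_divide_eq)
  qed
  moreover have "5 * M / 6 * E = M / 2 * E + 2 * M * E / 6" by simp
  ultimately show ?thesis using 1 2 3 A L unfolding E_def[symmetric] by argo
qed

section \<open>Tangents and harmonic interpolation over a whole window\<close>

context pairwise_barrier begin

lemma ray_tangent:
  assumes z: "z \<in> interior K" and e: "e \<in> K" and v: "v \<in> K" and s: "0 \<le> s" and r: "0 \<le> r"
  shows "Q (z + r *\<^sub>R e) v - (s - r) * H (z + r *\<^sub>R e) v e \<le> Q (z + s *\<^sub>R e) v"
proof (cases "s \<le> r")
  case True
  then show ?thesis
    using Q_drop[OF ray_int[OF z e s] e v, of "r - s"] by (simp add: algebra_simps)
next
  case False
  define k where "k = H (z + r *\<^sub>R e) v e"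
  have "Q (z + r *\<^sub>R e) v + r * k \<le> Q (z + s *\<^sub>R e) v + s * k"
  proof (rule DERIV_nonneg_imp_nondecreasing[of r s "\<lambda>s. Q (z + s *\<^sub>R e) v + s * k"])
    fix u assume u: "r \<le> u" "u \<le> s"
    have zu: "z + u *\<^sub>R e \<in> interior K" using u r by (intro ray_int z e) auto
    have "((\<lambda>s. Q (z + s *\<^sub>R e) v + s * k) has_real_derivative - H (z + u *\<^sub>R e) e v + k) (at u)"
      by (auto intro!: derivative_eq_intros Q_deriv zu)
    moreover have "0 \<le> - H (z + u *\<^sub>R e) e v + k"
      using H_antimono[OF z e v r u(1)] H_sym[OF zu] by (simp add: k_def)
    ultimately show "\<exists>f'. ((\<lambda>s. Q (z + s *\<^sub>R e) v + s * k) has_real_derivative f') (at u) \<and> 0 \<le> f'"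
      by blast
  qed (use False in simp)
  then show ?thesis by (simp add: k_def algebra_simps)
qed

lemma ray_convex:
  assumes z: "z \<in> interior K" and e: "e \<in> K" and v: "v \<in> K"
  shows "convex_on {0..L} (\<lambda>s. Q (z + s *\<^sub>R e) v)"
proof (rule convex_on_realI)
  fix s assume "s \<in> {0..L}"
  then show "((\<lambda>s. Q (z + s *\<^sub>R e) v) has_real_derivative - H (z + s *\<^sub>R e) e v) (at s)"
    by (intro Q_deriv ray_int z e) auto
next
  fix s t assume st: "s \<in> {0..L}" "t \<in> {0..L}" "s \<le> t"
  then show "- H (z + s *\<^sub>R e) e v \<le> - H (z + t *\<^sub>R e) e v"
    using H_antimono[OF z e v, of s t] H_sym[OF ray_int[OF z e]] by simp
qed simp

text \<open>Along the ray, \<open>x\<close> is dominated by the multiple of \<open>z + s e\<close> obtained by interpolating the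
  reciprocals of \<open>Q z x\<close> and \<open>Q (z + M e) x\<close>, because \<open>K\<close> is convex.\<close>

lemma harmonic_window:
  assumes z: "z \<in> interior K" and e: "e \<in> K" and x: "x \<in> K" "x \<noteq> 0" and M: "0 < M"
  defines "q \<equiv> \<lambda>s. Q (z + s *\<^sub>R e) x" and "b \<equiv> Q z x - Q (z + M *\<^sub>R e) x"
    and "wM \<equiv> H (z + M *\<^sub>R e) x e"
  obtains h where "continuous_on {0..M} h" and "\<And>s. s \<in> {0..M} \<Longrightarrow> 0 \<le> h s"
    and "\<And>s. s \<in> {0..M} \<Longrightarrow> h s *\<^sub>R (z + s *\<^sub>R e) - x \<in> K"
    and "integral {0..M} (\<lambda>s. H (z + s *\<^sub>R e) e x * h s) \<le>
      b * (q 0 + q M - integral {0..M} q / M - M * wM * b / (3 * (q 0 + q M)))"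
proof -
  define w where "w = (\<lambda>s. H (z + s *\<^sub>R e) e x)"
  \<comment> \<open>\<open>l\<close> interpolates the end values of \<open>q\<close> linearly,
    \<open>Y\<close> does so with the ends exchanged, and \<open>h\<close> is the harmonic
    interpolation. Thus \<open>Y + l = 2 y\<close>.\<close>
  define Y where "Y s = (1 - s / M) * q M + s / M * q 0" for s
  define l where "l s = q 0 - s / M * b" for s
  define h where "h s = q 0 * q M / Y s" for s
  define y where "y = (q 0 + q M) / 2"
  have zM: "z + M *\<^sub>R e \<in> interior K" using M by (intro ray_int z e) auto
  have q0: "0 < q 0" using Q_pos[OF z x] by (simp add: q_def)
  have qM: "0 < q M" using Q_pos[OF zM x] by (simp add: q_def)
  have y: "0 < y" using q0 qM by (simp add: y_def)
  have b: "b = q 0 - q M" by (simp add: b_def q_def)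
  have Y: "0 < Y s" if "s \<in> {0..M}" for s
  proof (cases "s = 0")
    case False
    then have "0 < s / M * q 0" "0 \<le> (1 - s / M) * q M" using that M q0 qM by auto
    then show ?thesis by (simp add: Y_def)
  qed (use qM in \<open>simp add: Y_def\<close>)
  have q_cont: "continuous_on {0..M} q" unfolding q_def by (intro Q_ray_continuous z e) auto
  have w_sym: "w s = H (z + s *\<^sub>R e) x e" if "0 \<le> s" for s
    using H_sym[OF ray_int[OF z e that]] by (simp add: w_def)
  have w_cont: "continuous_on {0..M} w"
    using H_ray_continuous[OF z e x(1), of "{0..M}"] by (rule continuous_on_cong[THEN iffD1, rotated 2]) (auto simp: w_sym)
  have w_ge: "wM \<le> w s" if "s \<in> {0..M}" for s
    using H_antimono[OF z e x(1), of s M] that by (simp add: w_sym wM_def)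
  have wM: "0 \<le> wM" unfolding wM_def by (intro H_nonneg zM e x)
  have h_cont: "continuous_on {0..M} h"
    unfolding h_def Y_def by (intro continuous_intros) (use M Y in \<open>auto simp: Y_def less_imp_neq[symmetric]\<close>)
  have h_pos: "0 \<le> h s" if "s \<in> {0..M}" for s
    using Y[OF that] q0 qM by (simp add: h_def)
  have h_dom: "h s *\<^sub>R (z + s *\<^sub>R e) - x \<in> K" if s: "s \<in> {0..M}" for s
  proof -
    define u where "u = s / M"
    have u: "0 \<le> u" "u \<le> 1" "s = u * M" using s M by (auto simp: u_def)
    \<comment> \<open>The two weights sum to 1 and are chosen so that the coefficients of
      \<open>z\<close> and \<open>M e\<close> become \<open>h s\<close> and
      \<open>h s * s / M\<close>.\<close>
    have "(q M * (1 - u) / Y s) *\<^sub>R (q 0 *\<^sub>R z - x) + (q 0 * u / Y s) *\<^sub>R (q M *\<^sub>R (z + M *\<^sub>R e) - x) \<in> K"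
      using dominated_Q[OF z x(1)] dominated_Q[OF zM x(1)] u q0 qM Y[OF s]
      by (intro K_add K_scale) (auto simp: q_def)
    moreover have "(q M * (1 - u) / Y s) *\<^sub>R (q 0 *\<^sub>R z - x) + (q 0 * u / Y s) *\<^sub>R (q M *\<^sub>R (z + M *\<^sub>R e) - x)
       = (1 / Y s) *\<^sub>R ((q M * (1 - u)) *\<^sub>R (q 0 *\<^sub>R z - x) + (q 0 * u) *\<^sub>R (q M *\<^sub>R (z + M *\<^sub>R e) - x))"
      by (simp add: scaleR_add_right)
    moreover have "(q M * (1 - u)) *\<^sub>R (q 0 *\<^sub>R z - x) + (q 0 * u) *\<^sub>R (q M *\<^sub>R (z + M *\<^sub>R e) - x)
       = (q 0 * q M) *\<^sub>R (z + s *\<^sub>R e) - Y s *\<^sub>R x"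
      using M by (simp add: Y_def u algebra_simps)
    moreover have "(1 / Y s) *\<^sub>R ((q 0 * q M) *\<^sub>R (z + s *\<^sub>R e) - Y s *\<^sub>R x) = h s *\<^sub>R (z + s *\<^sub>R e) - x"
      using Y[OF s] by (simp add: h_def scaleR_diff_right)
    ultimately show ?thesis by metis
  qed
  \<comment> \<open>Integration by parts, with \<open>w\<close> minus the derivative of
    \<open>q\<close>; it turns the part linear in \<open>s\<close> into the mean of
    \<open>q\<close>.\<close>
  have "((\<lambda>s. (1 - s / M) * w s + q s / M) has_integral - ((1 - M / M) * q M) - - ((1 - 0 / M) * q 0)) {0..M}"
  proof (rule fundamental_theorem_of_calculus)
    fix s assume s: "s \<in> {0..M}"
    have d: "(q has_real_derivative - w s) (at s)"
      unfolding q_def w_def using s by (intro Q_deriv ray_int z e) auto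
    have "((\<lambda>s. - ((1 - s / M) * q s)) has_real_derivative (1 - s / M) * w s + q s / M) (at s)"
      using M by (auto intro!: derivative_eq_intros d simp: field_simps)
    then show "((\<lambda>s. - ((1 - s / M) * q s)) has_vector_derivative (1 - s / M) * w s + q s / M) (at s within {0..M})"
      by (simp add: has_field_derivative_at_within flip: has_real_derivative_iff_has_vector_derivative)
  qed (use M in simp)
  moreover have "((\<lambda>s. q s / M) has_integral integral {0..M} q / M) {0..M}"
    by (intro has_integral_divide integrable_integral integrable_continuous_real q_cont)
  ultimately have "((\<lambda>s. ((1 - s / M) * w s + q s / M) - q s / M) has_integral
      - ((1 - M / M) * q M) - - ((1 - 0 / M) * q 0) - integral {0..M} q / M) {0..M}"
    by (rule has_integral_diff)
  then have i1: "((\<lambda>s. (1 - s / M) * w s) has_integral q 0 - integral {0..M} q / M) {0..M}"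
    using M by simp
  have i2: "(w has_integral b) {0..M}"
    using H_ray_integral[OF z e order_refl less_imp_le[OF M], of x] by (simp add: w_def b_def)
  have "((\<lambda>s. s / M * (1 - s / M) * l s) has_integral
     ((M\<^sup>2 / (2 * M) - M ^ 3 / (3 * M\<^sup>2)) * q 0 - (M ^ 3 / (3 * M\<^sup>2) - M ^ 4 / (4 * M ^ 3)) * b) -
     ((0\<^sup>2 / (2 * M) - 0 ^ 3 / (3 * M\<^sup>2)) * q 0 - (0 ^ 3 / (3 * M\<^sup>2) - 0 ^ 4 / (4 * M ^ 3)) * b)) {0..M}"
    unfolding l_def
    by (rule fundamental_theorem_of_calculus)
      (use M in \<open>auto intro!: derivative_eq_intros simp: field_simps power2_eq_square power3_eq_cube
        simp flip: has_real_derivative_iff_has_vector_derivative\<close>)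
  moreover have "((M\<^sup>2 / (2 * M) - M ^ 3 / (3 * M\<^sup>2)) * q 0 - (M ^ 3 / (3 * M\<^sup>2) - M ^ 4 / (4 * M ^ 3)) * b) = M * y / 6"
    using M by (simp add: y_def b power2_eq_square power3_eq_cube power4_eq_xxxx field_simps)
  ultimately have i3: "((\<lambda>s. s / M * (1 - s / M) * l s) has_integral M * y / 6) {0..M}" by simp
  have i4: "((\<lambda>s. (q M * w s + b * ((1 - s / M) * w s)) - wM * b\<^sup>2 / y\<^sup>2 * (s / M * (1 - s / M) * l s)) has_integral
      (q M * b + b * (q 0 - integral {0..M} q / M)) - wM * b\<^sup>2 / y\<^sup>2 * (M * y / 6)) {0..M}"
    by (intro has_integral_diff has_integral_add has_integral_mult_right i1 i2 i3)
  have i5: "((\<lambda>s. w s * h s) has_integral integral {0..M} (\<lambda>s. w s * h s)) {0..M}"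
    by (intro integrable_integral integrable_continuous_real continuous_intros w_cont h_cont)
  have "w s * h s \<le> (q M * w s + b * ((1 - s / M) * w s)) - wM * b\<^sup>2 / y\<^sup>2 * (s / M * (1 - s / M) * l s)"
    if s: "s \<in> {0..M}" for s
  proof -
    define u where "u = s / M"
    have u: "0 \<le> u" "u \<le> 1" using s M by (auto simp: u_def)
    have l_pos: "0 \<le> l s"
    proof -
      have "l s = (1 - u) * q 0 + u * q M" by (simp add: l_def b u_def algebra_simps)
      then show ?thesis using u q0 qM by simp
    qed
    have Yl: "Y s + l s = 2 * y" by (simp add: Y_def l_def b y_def algebra_simps)
    \<comment> \<open>Hence \<open>h\<close> falls short of \<open>l\<close> by
      \<open>u (1 - u) b^2 / Y\<close>. Since \<open>l\<close> and \<open>Y\<close> have mean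
      \<open>y\<close>, also \<open>1 / Y \<ge> l / y^2\<close>, and \<open>w \<ge> wM\<close>; this
      makes the shortfall a polynomial in \<open>s\<close> that integrates explicitly.\<close>
    have prod: "l s * Y s = q 0 * q M + u * (1 - u) * b\<^sup>2"
      by (simp add: l_def Y_def b u_def[symmetric] power2_eq_square algebra_simps)
    have "l s * Y s \<le> y\<^sup>2"
    proof -
      have "0 \<le> (Y s - l s)\<^sup>2" by simp
      then have "4 * (l s * Y s) \<le> (Y s + l s)\<^sup>2" by (simp add: power2_eq_square algebra_simps)
      then show ?thesis unfolding Yl by (simp add: power2_eq_square)
    qed
    then have "l s / y\<^sup>2 \<le> 1 / Y s" using Y[OF s] y by (simp add: field_simps)
    then have "u * (1 - u) * b\<^sup>2 * (l s / y\<^sup>2) \<le> u * (1 - u) * b\<^sup>2 * (1 / Y s)"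
      using u by (intro mult_left_mono) auto
    moreover have "h s = l s - u * (1 - u) * b\<^sup>2 * (1 / Y s)"
      using prod Y[OF s] by (simp add: h_def field_simps)
    ultimately have "h s \<le> l s - u * (1 - u) * b\<^sup>2 * (l s / y\<^sup>2)" by linarith
    then have "w s * h s \<le> w s * (l s - u * (1 - u) * b\<^sup>2 * (l s / y\<^sup>2))"
      using w_ge[OF s] wM by (intro mult_left_mono) auto
    also have "\<dots> = w s * l s - w s * (u * (1 - u) * b\<^sup>2 * (l s / y\<^sup>2))" by (simp add: algebra_simps)
    also have "\<dots> \<le> w s * l s - wM * (u * (1 - u) * b\<^sup>2 * (l s / y\<^sup>2))"
      using w_ge[OF s] u l_pos by (intro diff_left_mono mult_right_mono) auto
    also have "w s * l s = q M * w s + b * ((1 - s / M) * w s)"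
      unfolding l_def u_def[symmetric] by (simp add: b algebra_simps)
    also have "wM * (u * (1 - u) * b\<^sup>2 * (l s / y\<^sup>2)) = wM * b\<^sup>2 / y\<^sup>2 * (s / M * (1 - s / M) * l s)"
      by (simp add: u_def mult_ac)
    finally show ?thesis .
  qed
  then have "integral {0..M} (\<lambda>s. w s * h s) \<le>
     (q M * b + b * (q 0 - integral {0..M} q / M)) - wM * b\<^sup>2 / y\<^sup>2 * (M * y / 6)"
    by (rule has_integral_le[OF i5 i4])
  also have "wM * b\<^sup>2 / y\<^sup>2 * (M * y / 6) = b * (M * wM * b / (3 * (q 0 + q M)))"
  proof -
    have "3 * (q 0 + q M) = 6 * y" by (simp add: y_def)
    then show ?thesis using y by (simp only:) (simp add: power2_eq_square mult_ac)
  qed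
  finally have "integral {0..M} (\<lambda>s. w s * h s) \<le>
      b * (q 0 + q M - integral {0..M} q / M - M * wM * b / (3 * (q 0 + q M)))"
    by (simp add: algebra_simps)
  then show ?thesis using that[OF h_cont h_pos h_dom] by (simp add: w_def)
qed

end

context sparsification_instance begin

text \<open>Advancing the barrier raises the window integral by \<open>J\<close>, and
  \<open>t x i\<close> wins back at least \<open>b i * t / (1 + p i * t)\<close>; requiring this to
  be \<open>J\<close> or more gives \<theta>. The constant 4/5 keeps the window short enough for
  \<open>y = z - e\<close> to stay interior and for \<open>M * B \<le> 6 / 5\<close>.\<close>

lemma lower_step_window:
  assumes z: "z \<in> interior K" and c: "0 < c" "c \<le> 7 / 50" and M: "M * c = 4 / 5"
    and pot: "integral {0..M} (\<lambda>s. Q (z + s *\<^sub>R e) e) \<le> c * M"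
  obtains \<theta> where "1 - c - 17 / 5 * c ^ 3 \<le> sum \<theta> I"
    and "\<And>i t. i \<in> I \<Longrightarrow> 0 < t \<Longrightarrow> 1 / t \<le> \<theta> i \<Longrightarrow> z - e + t *\<^sub>R x i \<in> interior K \<and>
       integral {0..M} (\<lambda>s. Q (z - e + t *\<^sub>R x i + s *\<^sub>R e) e) \<le> c * M"
proof -
  have M0: "0 < M" using M c by (metis less_numeral_extra(3) mult_pos_pos zero_less_divide_iff zero_less_mult_pos2 zero_less_numeral)
  have M2: "2 \<le> M"
  proof (rule ccontr)
    assume "\<not> 2 \<le> M"
    then have "M * c \<le> 2 * c" using c by (intro mult_right_mono) auto
    then show False using M c by linarith
  qed
  define zm where "zm = z + (M / 2) *\<^sub>R e"
  have zm: "zm \<in> interior K" unfolding zm_def using M0 by (intro ray_int z e_K) auto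
  \<comment> \<open>The mean of a convex function over an interval is at least its value at the
    midpoint: the tangent there has that value as its mean.\<close>
  have Qzm: "Q zm e \<le> c"
  proof -
    define k where "k = H zm e e"
    have "((\<lambda>s. Q zm e - (s - M / 2) * k) has_integral
        (M * Q zm e - (M - M / 2)\<^sup>2 / 2 * k) - (0 * Q zm e - (0 - M / 2)\<^sup>2 / 2 * k)) {0..M}"
      by (rule fundamental_theorem_of_calculus)
        (use M0 in \<open>auto intro!: derivative_eq_intros simp: field_simps
          simp flip: has_real_derivative_iff_has_vector_derivative\<close>)
    then have "((\<lambda>s. Q zm e - (s - M / 2) * k) has_integral M * Q zm e) {0..M}"
      by (simp add: power2_eq_square)
    moreover have "((\<lambda>s. Q (z + s *\<^sub>R e) e) has_integral integral {0..M} (\<lambda>s. Q (z + s *\<^sub>R e) e)) {0..M}"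
      by (intro integrable_integral integrable_continuous_real Q_ray_continuous z e_K) auto
    ultimately have "M * Q zm e \<le> integral {0..M} (\<lambda>s. Q (z + s *\<^sub>R e) e)"
    proof (rule has_integral_le)
      fix s assume "s \<in> {0..M}"
      then show "Q zm e - (s - M / 2) * k \<le> Q (z + s *\<^sub>R e) e"
        using ray_tangent[OF z e_K e_K, of s "M / 2"] M0 by (simp add: zm_def k_def)
    qed
    then have "M * Q zm e \<le> M * c" using pot by (simp add: mult.commute)
    then show ?thesis using M0 by simp
  qed
  define y where "y = z - e"
  \<comment> \<open>Only the midpoint has a pointwise bound on the potential, so \<open>y\<close> is
    reached from it by going back \<open>(M / 2 + 1) e\<close>. This is possible because
    \<open>(M / 2 + 1) * c = 2 / 5 + c < 1\<close>.\<close>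
  have y_zm: "y = zm - (M / 2 + 1) *\<^sub>R e" by (simp add: y_def zm_def algebra_simps)
  have y: "y \<in> interior K"
    unfolding y_zm
  proof (rule int_sub[OF zm])
    have "(c - Q zm e) *\<^sub>R zm + (Q zm e *\<^sub>R zm - e) \<in> K"
      using Qzm by (intro K_add K_scale int_K zm dominated_Q e_K) auto
    then show "c *\<^sub>R zm - e \<in> K" by (simp add: algebra_simps)
    show "(M / 2 + 1) * c < 1" using M c by (simp add: algebra_simps)
  qed (use M0 in auto)
  define yM where "yM = y + M *\<^sub>R e"
  have yM: "yM \<in> interior K" unfolding yM_def using M0 by (intro ray_int y e_K) auto
  define g where "g = (\<lambda>s. Q (y + s *\<^sub>R e) e)"
  have g0: "g 0 = Q y e" "0 < g 0" using Q_pos[OF y e_K e_nz] by (auto simp: g_def)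
  have gM: "g M = Q yM e" "0 < g M" using Q_pos[OF yM e_K e_nz] by (auto simp: g_def yM_def)
  have yzm: "y + (1 + M / 2) *\<^sub>R e = zm" by (simp add: y_zm algebra_simps)
  \<comment> \<open>\<open>23 / 50 = 3 / 5 - 7 / 50\<close>, and \<open>4 / 5\<close> divided by
    \<open>23 / 50\<close> is \<open>40 / 23 < 9 / 5\<close>.\<close>
  have Mg0: "M * g 0 \<le> 9 / 5"
  proof -
    have "g 0 / (1 + (1 + M / 2) * g 0) \<le> c"
      using Q_ray_lower[OF y e_K e_K _ dominated_Q[OF y e_K], of "1 + M / 2"] g0 M0 Qzm yzm by simp
    moreover have "0 < 1 + (1 + M / 2) * g 0" using g0 M0 by (intro add_pos_pos mult_pos_pos) auto
    ultimately have "g 0 \<le> c * (1 + (1 + M / 2) * g 0)" by (simp add: pos_divide_le_eq)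
    also have "\<dots> = c + c * g 0 + M * c / 2 * g 0" by (simp add: algebra_simps)
    also have "\<dots> = c + c * g 0 + 2 / 5 * g 0" by (simp add: M)
    finally have "(3 / 5 - c) * g 0 \<le> c" by (simp add: algebra_simps)
    moreover have "23 / 50 * g 0 \<le> (3 / 5 - c) * g 0" using c g0 by (intro mult_right_mono) auto
    ultimately have "23 / 50 * g 0 \<le> c" by linarith
    then have "M * (23 / 50 * g 0) \<le> M * c" using M0 by (intro mult_left_mono) auto
    then show ?thesis using M by simp
  qed
  have ratio: "Q y v / (1 + M * g 0) \<le> Q yM v" if "v \<in> K" for v
    using Q_ray_lower[OF y e_K that _ dominated_Q[OF y e_K], of M] g0 M0 by (simp add: yM_def)
  define B where "B = g 0 - g M"
  have MB: "M * B \<le> 6 / 5"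
  proof -
    have p: "0 < 1 + M * g 0" using M0 g0 by (simp add: add_pos_pos)
    have "B \<le> g 0 - g 0 / (1 + M * g 0)" using ratio[OF e_K] g0 gM by (simp add: B_def)
    also have "\<dots> = M * g 0 * g 0 / (1 + M * g 0)" using p by (simp add: field_simps)
    finally have "M * B \<le> M * (M * g 0 * g 0 / (1 + M * g 0))" using M0 by (intro mult_left_mono) auto
    also have "\<dots> = (M * g 0)\<^sup>2 / (1 + M * g 0)" by (simp add: power2_eq_square)
    also have "\<dots> \<le> 6 / 5"
    proof -
      have "(M * g 0) * (M * g 0) \<le> 9 / 5 * (M * g 0)" using Mg0 M0 g0 by (intro mult_right_mono) auto
      then have "(M * g 0)\<^sup>2 \<le> 6 / 5 * (1 + M * g 0)" using Mg0 by (simp add: power2_eq_square)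
      then show ?thesis using p by (simp add: pos_divide_le_eq)
    qed
    finally show ?thesis .
  qed
  have gMc: "g M \<le> c"
  proof -
    have "Q (zm + (M / 2 - 1) *\<^sub>R e) e \<le> Q zm e" using M2 by (intro Q_mono zm K_scale e_K) auto
    moreover have "zm + (M / 2 - 1) *\<^sub>R e = yM"
    proof -
      have "(M / 2) *\<^sub>R e + (M / 2) *\<^sub>R e = M *\<^sub>R e" by (simp flip: scaleR_add_left)
      then show ?thesis by (simp add: yM_def y_zm algebra_simps)
    qed
    ultimately show ?thesis using Qzm gM by simp
  qed
  have g_cont: "continuous_on A g" if "A \<subseteq> {0..}" for A
    unfolding g_def by (intro Q_ray_continuous y e_K that)
  have g_int: "g integrable_on {a..b}" if "0 \<le> a" for a b
    using that by (intro integrable_continuous_real g_cont) auto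
  \<comment> \<open>\<open>J_eq\<close> rewrites this as the integral over \<open>{0..M}\<close>
    minus that over \<open>{1..M + 1}\<close>, the change of the potential when the window moves
    from \<open>z\<close> to \<open>y\<close>.\<close>
  define J where "J = integral {0..1} g - integral {M..M + 1} g"
  have shift: "integral {1..M + 1} g = integral {0..M} (\<lambda>s. Q (z + s *\<^sub>R e) e)"
  proof -
    have "integral {0..M} (g \<circ> (\<lambda>s. s + 1)) = integral {0 + 1..M + 1} g"
      by (rule integral_shift) (use g_cont in auto)
    moreover have "g \<circ> (\<lambda>s. s + 1) = (\<lambda>s. Q (z + s *\<^sub>R e) e)"
      by (auto simp: g_def y_def fun_eq_iff algebra_simps)
    ultimately show ?thesis by simp
  qed
  have J_eq: "J = integral {0..M} g - integral {1..M + 1} g"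
  proof -
    have "integral {0..1} g + integral {1..M} g = integral {0..M} g"
      using M2 by (intro Henstock_Kurzweil_Integration.integral_combine g_int) auto
    moreover have "integral {1..M} g + integral {M..M + 1} g = integral {1..M + 1} g"
      using M2 by (intro Henstock_Kurzweil_Integration.integral_combine g_int) auto
    ultimately show ?thesis by (simp add: J_def)
  qed
  have win: "B - M * H yM e e \<le> 2 * M * (B - J)" "g 0 + g M - 2 / M * integral {0..M} g \<le> M / 2 * (B - J)"
  proof -
    have tan: "g M - (s - M) * H yM e e \<le> g s" if "s \<in> {0..M + 1}" for s
      using ray_tangent[OF y e_K e_K, of s M] that M0 by (simp add: g_def yM_def)
    have cvx: "convex_on {0..M + 1} g" unfolding g_def by (intro ray_convex y e_K)
    have cont: "continuous_on {0..M + 1} g" by (intro g_cont) auto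
    show "B - M * H yM e e \<le> 2 * M * (B - J)" "g 0 + g M - 2 / M * integral {0..M} g \<le> M / 2 * (B - J)"
      using convex_window[OF M2 cvx cont tan] by (simp_all add: B_def J_def)
  qed
  have B0: "M * H yM e e \<le> B"
    using Q_drop[OF y e_K e_K less_imp_le[OF M0]] by (simp add: B_def g0 gM yM_def)
  have JB: "J \<le> B"
  proof -
    have "0 \<le> 2 * M * (B - J)" using win(1) B0 by linarith
    then show ?thesis using M0 by (simp add: zero_le_mult_iff)
  qed
  have J0: "0 < J"
  proof -
    have g_anti: "g t \<le> g s" if "0 \<le> s" "s \<le> t" for s t
    proof -
      have "Q (y + s *\<^sub>R e + (t - s) *\<^sub>R e) e \<le> Q (y + s *\<^sub>R e) e"
        using that by (intro Q_mono ray_int y K_scale e_K) auto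
      then show ?thesis by (simp add: g_def algebra_simps)
    qed
    have "integral {0..1} (\<lambda>s::real. g 1) \<le> integral {0..1} g"
      by (intro integral_le g_int g_anti) auto
    moreover have "integral {M..M + 1} g \<le> integral {M..M + 1} (\<lambda>s. g M)"
      using M0 by (intro integral_le g_int g_anti) auto
    moreover have "g M < g 1"
    proof -
      have y1: "y + 1 *\<^sub>R e \<in> interior K" by (intro ray_int y e_K) auto
      have "(M - 1) * H (y + 1 *\<^sub>R e + (M - 1) *\<^sub>R e) e e \<le> g 1 - Q (y + 1 *\<^sub>R e + (M - 1) *\<^sub>R e) e"
        using Q_drop[OF y1 e_K e_K, of "M - 1"] M2 by (simp add: g_def)
      moreover have "y + 1 *\<^sub>R e + (M - 1) *\<^sub>R e = yM" by (simp add: yM_def algebra_simps)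
      moreover have "0 < (M - 1) * H yM e e" using H_pos[OF yM e_int e_K e_nz] M2 by simp
      ultimately show ?thesis using gM by simp
    qed
    ultimately show ?thesis by (simp add: J_def)
  qed
  define b where "b i = Q y (x i) - Q yM (x i)" for i
  define S where "S i = Q y (x i) + Q yM (x i)" for i
  \<comment> \<open>The curvature of \<open>Q (y + s e) (x i)\<close> over the window: the drop
    minus what the tangent at \<open>M\<close> accounts for. So \<open>b i - a i\<close> is the
    product of \<open>M\<close> and \<open>wM\<close> in \<open>harmonic_window\<close>.\<close>
  define a where "a i = b i - M * H yM (x i) e" for i
  define p where "p i = S i - integral {0..M} (\<lambda>s. Q (y + s *\<^sub>R e) (x i)) / M - (b i - a i) * b i / (3 * S i)" for i
  define \<theta> where "\<theta> i = b i / J - p i" for i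
  have S: "0 < S i" if "i \<in> I" for i
    using Q_pos[OF y x_K[OF that] x_nz[OF that]] Q_pos[OF yM x_K[OF that] x_nz[OF that]] by (simp add: S_def)
  have b0: "0 < b i" if "i \<in> I" for i
  proof -
    have "0 < M * H yM (x i) e"
      using H_pos[OF yM e_int x_K[OF that] x_nz[OF that]] H_sym[OF yM] M0 by simp
    also have "\<dots> \<le> b i" using Q_drop[OF y e_K x_K[OF that] less_imp_le[OF M0]] by (simp add: b_def yM_def)
    finally show ?thesis .
  qed
  have sum_b: "sum b I = B" unfolding b_def by (simp add: sum_subtractf sum_Q y yM B_def g0 gM)
  have sum_S: "sum S I = g 0 + g M" unfolding S_def by (simp add: sum.distrib sum_Q y yM g0 gM)
  have sum_a: "sum a I = B - M * H yM e e"
  proof -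
    have "sum a I = sum b I - M * (\<Sum>i\<in>I. H yM e (x i))"
      unfolding a_def by (simp add: sum_subtractf sum_distrib_left H_sym[OF yM, of _ e])
    then show ?thesis by (simp add: sum_b sum_H[OF yM])
  qed
  have sum_int: "(\<Sum>i\<in>I. integral {0..M} (\<lambda>s. Q (y + s *\<^sub>R e) (x i))) = integral {0..M} g"
  proof -
    have "(\<Sum>i\<in>I. integral {0..M} (\<lambda>s. Q (y + s *\<^sub>R e) (x i))) = integral {0..M} (\<lambda>s. \<Sum>i\<in>I. Q (y + s *\<^sub>R e) (x i))"
      by (intro integral_sum[symmetric] finite_I integrable_continuous_real Q_ray_continuous y e_K) auto
    also have "\<dots> = integral {0..M} g"
      by (intro integral_cong) (auto simp: g_def intro!: sum_Q ray_int y e_K)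
    finally show ?thesis .
  qed
  \<comment> \<open>Since \<open>1 + M * g 0 \<le> 14 / 5 < 3\<close>, the end values differ by a
    factor of at most 3, so \<open>b i \<le> S i / 2\<close>. This is the origin of the 1/6.\<close>
  have slack: "(b i)\<^sup>2 / (3 * S i) - a i / 6 \<le> (b i - a i) * b i / (3 * S i)" if i: "i \<in> I" for i
  proof -
    have "Q y (x i) / (1 + M * g 0) \<le> Q yM (x i)" using ratio[OF x_K[OF i]] .
    then have "Q y (x i) \<le> Q yM (x i) * (1 + M * g 0)"
      using M0 g0 by (simp add: pos_divide_le_eq add_pos_pos)
    also have "\<dots> \<le> Q yM (x i) * 3"
      using Mg0 Q_nonneg[OF yM x_K[OF i]] by (intro mult_left_mono) auto
    finally have "b i \<le> S i / 2" by (simp add: b_def S_def)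
    then have "b i / (3 * S i) \<le> 1 / 6" using S[OF i] by (simp add: field_simps)
    moreover have "0 \<le> a i"
      using Q_drop[OF y e_K x_K[OF i] less_imp_le[OF M0]] by (simp add: a_def b_def yM_def)
    ultimately have "a i * (b i / (3 * S i)) \<le> a i * (1 / 6)" by (intro mult_left_mono)
    moreover have "(b i - a i) * b i / (3 * S i) = (b i)\<^sup>2 / (3 * S i) - a i * (b i / (3 * S i))"
      by (simp add: power2_eq_square left_diff_distrib diff_divide_distrib)
    ultimately show ?thesis by simp
  qed
  have sum_p: "sum p I \<le> g 0 + g M - integral {0..M} g / M - B\<^sup>2 / (3 * (g 0 + g M)) + (B - M * H yM e e) / 6"
  proof -
    have "B\<^sup>2 / (g 0 + g M) \<le> (\<Sum>i\<in>I. (b i)\<^sup>2 / S i)"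
      using sum_square_ratio[OF finite_I, of S b] S g0 gM by (simp add: sum_b sum_S)
    then have "B\<^sup>2 / (g 0 + g M) / 3 \<le> (\<Sum>i\<in>I. (b i)\<^sup>2 / S i) / 3" by (intro divide_right_mono) auto
    then have "B\<^sup>2 / (3 * (g 0 + g M)) \<le> (\<Sum>i\<in>I. (b i)\<^sup>2 / (3 * S i))"
      by (simp add: sum_divide_distrib mult.commute)
    moreover have "(\<Sum>i\<in>I. (b i)\<^sup>2 / (3 * S i)) - sum a I / 6 = (\<Sum>i\<in>I. (b i)\<^sup>2 / (3 * S i) - a i / 6)"
      by (simp add: sum_subtractf sum_divide_distrib)
    moreover have "\<dots> \<le> (\<Sum>i\<in>I. (b i - a i) * b i / (3 * S i))" by (intro sum_mono slack)
    moreover have "sum p I = g 0 + g M - integral {0..M} g / M - (\<Sum>i\<in>I. (b i - a i) * b i / (3 * S i))"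
      unfolding p_def by (simp only: sum_subtractf sum_S sum_divide_distrib[symmetric] sum_int)
    ultimately show ?thesis by (simp add: sum_a)
  qed
  have arith: "1 - c - 17 / 5 * c ^ 3 \<le>
    B / J - (g 0 + g M - integral {0..M} g / M - B\<^sup>2 / (3 * (g 0 + g M)) + (B - M * H yM e e) / 6)"
  proof (rule window_arithmetic[OF c M J0 JB MB win(1) _ _ B_def gM(2) gMc])
    show "g 0 + g M - 2 * (integral {0..M} g / M) \<le> M / 2 * (B - J)" using win(2) by simp
    show "M * (integral {0..M} g / M) \<le> c * M + J" using M0 pot shift J_eq by simp
  qed
  have "sum \<theta> I = B / J - sum p I" unfolding \<theta>_def by (simp add: sum_subtractf sum_b flip: sum_divide_distrib)
  then have 1: "1 - c - 17 / 5 * c ^ 3 \<le> sum \<theta> I" using arith sum_p by linarith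
  have 2: "y + t *\<^sub>R x i \<in> interior K \<and> integral {0..M} (\<lambda>s. Q (y + t *\<^sub>R x i + s *\<^sub>R e) e) \<le> c * M"
    if i: "i \<in> I" and t: "0 < t" "1 / t \<le> \<theta> i" for i t
  proof -
    have xi: "x i \<in> K" "x i \<noteq> 0" using x_K x_nz i by auto
    have yt: "y + t *\<^sub>R x i \<in> interior K" using t by (intro ray_int y xi) auto
    obtain h where h: "continuous_on {0..M} h" "\<And>s. s \<in> {0..M} \<Longrightarrow> 0 \<le> h s"
      "\<And>s. s \<in> {0..M} \<Longrightarrow> h s *\<^sub>R (y + s *\<^sub>R e) - x i \<in> K"
      and "integral {0..M} (\<lambda>s. H (y + s *\<^sub>R e) e (x i) * h s) \<le>
       (Q y (x i) - Q (y + M *\<^sub>R e) (x i)) * (Q (y + 0 *\<^sub>R e) (x i) + Q (y + M *\<^sub>R e) (x i)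
       - integral {0..M} (\<lambda>s. Q (y + s *\<^sub>R e) (x i)) / M
       - M * H (y + M *\<^sub>R e) (x i) e * (Q y (x i) - Q (y + M *\<^sub>R e) (x i)) /
         (3 * (Q (y + 0 *\<^sub>R e) (x i) + Q (y + M *\<^sub>R e) (x i))))"
      using harmonic_window[OF y e_K xi M0] by blast
    then have W: "integral {0..M} (\<lambda>s. H (y + s *\<^sub>R e) e (x i) * h s) \<le> b i * p i"
      by (simp add: p_def S_def a_def b_def yM_def)
    have "0 \<le> integral {0..M} (\<lambda>s. H (y + s *\<^sub>R e) e (x i) * h s)"
    proof (rule integral_nonneg)
      have "continuous_on {0..M} (\<lambda>s. H (y + s *\<^sub>R e) (x i) e)"
        by (intro H_ray_continuous y e_K xi) auto
      then have "continuous_on {0..M} (\<lambda>s. H (y + s *\<^sub>R e) e (x i))"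
        by (rule continuous_on_cong[THEN iffD1, rotated 2]) (auto intro!: H_sym ray_int y e_K)
      then show "(\<lambda>s. H (y + s *\<^sub>R e) e (x i) * h s) integrable_on {0..M}"
        by (intro integrable_continuous_real continuous_intros h)
      show "0 \<le> H (y + s *\<^sub>R e) e (x i) * h s" if "s \<in> {0..M}" for s
        using that h(2) by (intro mult_nonneg_nonneg H_nonneg ray_int y e_K xi) auto
    qed
    then have "0 \<le> b i * p i" using W by linarith
    then have p: "0 \<le> p i" using b0[OF i] by (simp add: zero_le_mult_iff)
    have gain: "b i * t / (1 + p i * t) \<le> integral {0..M} (\<lambda>s. g s - Q (y + s *\<^sub>R e + t *\<^sub>R x i) e)"
      unfolding b_def g_def yM_def
      using window_gain[OF y e_K xi(1) less_imp_le[OF M0] h p _ less_imp_le[OF t(1)]] W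
      by (simp add: b_def yM_def)
    have comm: "Q (y + s *\<^sub>R e + t *\<^sub>R x i) e = Q (y + t *\<^sub>R x i + s *\<^sub>R e) e" for s
      by (simp add: algebra_simps)
    have "integral {0..M} (\<lambda>s. g s - Q (y + s *\<^sub>R e + t *\<^sub>R x i) e) =
        integral {0..M} g - integral {0..M} (\<lambda>s. Q (y + t *\<^sub>R x i + s *\<^sub>R e) e)"
      unfolding comm by (intro integral_diff g_int integrable_continuous_real Q_ray_continuous yt e_K) auto
    moreover have "J \<le> b i * t / (1 + p i * t)"
    proof -
      have "1 / t + p i \<le> b i / J" using t by (simp add: \<theta>_def)
      moreover have "0 < 1 + p i * t" using p t by (simp add: add_pos_nonneg)
      ultimately show ?thesis using t J0 by (simp add: field_simps)
    qed
    moreover have "integral {0..M} g - J \<le> c * M" using J_eq shift pot by simp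
    ultimately show ?thesis using gain yt by linarith
  qed
  show ?thesis using that[OF 1] 2 by (simp add: y_def)
qed

end

section \<open>Iteration and choice of parameters\<close>

context sparsification_instance begin

text \<open>As the upper thresholds sum to at most \<open>R\<close> and the lower ones to at least
  \<open>R\<close>, some index has \<theta>' below \<theta>; then \<open>t = 1 / \<theta>'\<close>
  satisfies both conditions. Abstract predicates \<open>Lo\<close> and \<open>Up\<close> let both
  kinds of lower potential share the iteration.\<close>

lemma iterate_steps:
  assumes lower: "\<And>z. Lo z \<Longrightarrow> \<exists>\<theta>. R \<le> sum \<theta> I \<and>
      (\<forall>i\<in>I. \<forall>t>0. 1 / t \<le> \<theta> i \<longrightarrow> Lo (z - e + t *\<^sub>R x i))"
    and upper: "\<And>z. Up z \<Longrightarrow> \<exists>\<theta>. sum \<theta> I \<le> R \<and>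
      (\<forall>i\<in>I. 0 < \<theta> i \<and> (\<forall>t>0. \<theta> i \<le> 1 / t \<longrightarrow> Up (z + d *\<^sub>R e - t *\<^sub>R x i)))"
    and init: "Lo z0" "Up z1"
  shows "\<exists>S c. S \<subseteq> I \<and> card S \<le> N \<and> (\<forall>i\<in>S. 0 < c i) \<and>
      Lo (z0 - real N *\<^sub>R e + (\<Sum>i\<in>S. c i *\<^sub>R x i)) \<and>
      Up (z1 + (real N * d) *\<^sub>R e - (\<Sum>i\<in>S. c i *\<^sub>R x i))"
proof (induction N)
  case 0
  show ?case using init by (intro exI[of _ "{}"]) auto
next
  case (Suc N)
  then obtain S c where S: "S \<subseteq> I" "card S \<le> N" "\<And>i. i \<in> S \<Longrightarrow> 0 < c i"
    and Lo: "Lo (z0 - real N *\<^sub>R e + (\<Sum>i\<in>S. c i *\<^sub>R x i))"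
    and Up: "Up (z1 + (real N * d) *\<^sub>R e - (\<Sum>i\<in>S. c i *\<^sub>R x i))" by blast
  define A where "A = (\<Sum>i\<in>S. c i *\<^sub>R x i)"
  obtain \<theta> where \<theta>: "R \<le> sum \<theta> I"
     "\<And>i t. i \<in> I \<Longrightarrow> 0 < t \<Longrightarrow> 1 / t \<le> \<theta> i \<Longrightarrow> Lo (z0 - real N *\<^sub>R e + A - e + t *\<^sub>R x i)"
    using lower[OF Lo] unfolding A_def by blast
  obtain \<theta>' where \<theta>': "sum \<theta>' I \<le> R" "\<And>i. i \<in> I \<Longrightarrow> 0 < \<theta>' i"
     "\<And>i t. i \<in> I \<Longrightarrow> 0 < t \<Longrightarrow> \<theta>' i \<le> 1 / t \<Longrightarrow>
        Up (z1 + (real N * d) *\<^sub>R e - A + d *\<^sub>R e - t *\<^sub>R x i)"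
    using upper[OF Up] unfolding A_def by blast
  have "\<exists>i\<in>I. \<theta>' i \<le> \<theta> i"
  proof (rule ccontr)
    assume "\<not> ?thesis"
    then have "sum \<theta> I < sum \<theta>' I" using finite_I I_ne by (intro sum_strict_mono) auto
    then show False using \<theta>(1) \<theta>'(1) by linarith
  qed
  then obtain i where i: "i \<in> I" "\<theta>' i \<le> \<theta> i" by blast
  define t where "t = 1 / \<theta>' i"
  have t: "0 < t" "1 / t = \<theta>' i" using \<theta>'(2)[OF i(1)] by (auto simp: t_def)
  \<comment> \<open>An index may be picked repeatedly: its coefficient then grows and the support
    does not, so the cardinality is only bounded by the number of steps.\<close>
  define c' where "c' = c(i := (if i \<in> S then c i else 0) + t)"
  have fin: "finite S" using S(1) finite_I finite_subset by blast
  have A': "(\<Sum>j\<in>insert i S. c' j *\<^sub>R x j) = A + t *\<^sub>R x i"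
  proof -
    have "(\<Sum>j\<in>S - {i}. c' j *\<^sub>R x j) = (\<Sum>j\<in>S - {i}. c j *\<^sub>R x j)"
      by (intro sum.cong) (auto simp: c'_def)
    moreover have "A = (if i \<in> S then c i else 0) *\<^sub>R x i + (\<Sum>j\<in>S - {i}. c j *\<^sub>R x j)"
      using fin by (auto simp: A_def sum.remove)
    ultimately show ?thesis
      using fin by (simp add: sum.insert_remove c'_def scaleR_add_left)
  qed
  have "Lo (z0 - real (Suc N) *\<^sub>R e + (A + t *\<^sub>R x i))"
    using \<theta>(2)[OF i(1) t(1)] i(2) t(2) by (simp add: algebra_simps)
  moreover have "Up (z1 + (real (Suc N) * d) *\<^sub>R e - (A + t *\<^sub>R x i))"
    using \<theta>'(3)[OF i(1) t(1)] t(2) by (simp add: algebra_simps)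
  moreover have "card (insert i S) \<le> Suc N" using S(2) fin by (simp add: card_insert_if)
  moreover have "\<forall>j\<in>insert i S. 0 < c' j" using S(3) t(1) by (auto simp: c'_def add_pos_pos)
  ultimately show ?case
    using S(1) i(1) A' by (intro exI[of _ "insert i S"] exI[of _ c']) auto
qed

end

text \<open>The parameter \<open>\<eta>\<close> is the bound kept on the lower potential, the lower barrier moving by \<open>e\<close> in each
  step. For \<open>y = 6 \<eta> / (3 - 2 \<eta>)\<close>, that is \<open>1 / \<eta> = 2 / y + 2 / 3\<close>, and \<open>N = 4 \<nu> / y\<^sup>2\<close> steps the
  barriers end up at \<open>lower_end\<close> and \<open>upper_end\<close>.\<close>

definition step_budget :: "real \<Rightarrow> real" where
  "step_budget \<eta> = (if \<eta> \<le> 7 / 50 then 1 - \<eta> - 17 / 5 * \<eta> ^ 3 else 1 - \<eta> - \<eta>\<^sup>2 / (2 * (1 - \<eta>)))"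

definition upper_end :: "real \<Rightarrow> real \<Rightarrow> real" where
  "upper_end \<nu> \<eta> = \<nu> * (3 + \<eta>)\<^sup>2 / (9 * \<eta>\<^sup>2 * step_budget \<eta>)"

definition lower_end :: "real \<Rightarrow> real \<Rightarrow> real" where
  "lower_end \<nu> \<eta> = \<nu> * (9 - 21 * \<eta> + 4 * \<eta>\<^sup>2) / (9 * \<eta>\<^sup>2)"

lemma lower_end_numerator_pos:
  fixes \<eta> :: real
  assumes "0 < \<eta>" "\<eta> < 3 / 8" shows "0 < 9 - 21 * \<eta> + 4 * \<eta>\<^sup>2"
  using assms by (simp add: add_pos_nonneg)

text \<open>The inequality of \<open>ends_close\<close> without denominators. A budget of 1 - \<eta>
  would leave the margin \<open>16 * \<eta> ^ 3 * (6 - \<eta>)\<close> against \<open>P\<close>. As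
  \<eta> tends to 0 these behave like 96 \<eta>^3 and 27, so a cubic loss needs a coefficient below
  32/9, which 17/5 is. The quadratic loss fits once
  \<open>152 * \<eta>\<^sup>2 - 219 * \<eta> + 27 < 0\<close>, that is from about 0.136 on.\<close>

lemma step_budget_large:
  assumes \<eta>: "0 < \<eta>" "\<eta> < 3 / 8"
  shows "(3 + \<eta>)\<^sup>2 * (3 - 8 * \<eta>) < step_budget \<eta> * ((3 + 4 * \<eta>) * (9 - 21 * \<eta> + 4 * \<eta>\<^sup>2))"
proof -
  define P where "P = (3 + 4 * \<eta>) * (9 - 21 * \<eta> + 4 * \<eta>\<^sup>2)"
  have P: "P = 27 - 27 * \<eta> - 72 * \<eta>\<^sup>2 + 16 * \<eta> ^ 3"
    by (simp add: P_def algebra_simps power2_eq_square power3_eq_cube)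
  have base: "(1 - \<eta>) * P = (3 + \<eta>)\<^sup>2 * (3 - 8 * \<eta>) + 16 * \<eta> ^ 3 * (6 - \<eta>)"
    unfolding P by (simp add: algebra_simps power2_eq_square power3_eq_cube)
  have c3: "0 < \<eta> ^ 3" using \<eta> by simp
  have cube: "\<eta> ^ 3 \<le> \<eta>\<^sup>2"
    using \<eta> by (simp add: power2_eq_square power3_eq_cube mult_left_le)
  show ?thesis
  proof (cases "\<eta> \<le> 7 / 50")
    case True
    have "P \<le> 27 - 27 * \<eta>" unfolding P using cube zero_le_power2[of \<eta>] by linarith
    then have "17 / 5 * P \<le> 17 / 5 * (27 - 27 * \<eta>)" by simp
    also have "\<dots> < 16 * (6 - \<eta>)" using \<eta> by simp
    finally have "17 / 5 * P < 16 * (6 - \<eta>)" .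
    then have "\<eta> ^ 3 * (17 / 5 * P) < \<eta> ^ 3 * (16 * (6 - \<eta>))" using c3 by (rule mult_strict_left_mono)
    moreover have "step_budget \<eta> * P = (1 - \<eta>) * P - \<eta> ^ 3 * (17 / 5 * P)"
      using True by (simp add: step_budget_def left_diff_distrib)
    ultimately show ?thesis using base unfolding P_def[symmetric] by (simp add: algebra_simps)
  next
    case False
    \<comment> \<open>The square lies below its chord on the interval from 7/50 to 3/8, so the
      quadratic condition becomes linear.\<close>
    have "(\<eta> - 7 / 50) * (3 / 8 - \<eta>) \<ge> 0" using False \<eta> by (intro mult_nonneg_nonneg) auto
    then have sq: "\<eta>\<^sup>2 \<le> 103 / 200 * \<eta> - 21 / 400" by (simp add: power2_eq_square field_simps)
    have "7 / 50 < \<eta>" using False by simp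
    with sq have "152 * \<eta>\<^sup>2 - 219 * \<eta> + 27 < 0" by linarith
    then have "P < 32 * \<eta> * (1 - \<eta>) * (6 - \<eta>)"
      unfolding P using c3 by (simp add: algebra_simps power2_eq_square power3_eq_cube)
    then have "\<eta>\<^sup>2 / (2 * (1 - \<eta>)) * P < \<eta>\<^sup>2 / (2 * (1 - \<eta>)) * (32 * \<eta> * (1 - \<eta>) * (6 - \<eta>))"
      using \<eta> by (intro mult_strict_left_mono) auto
    also have "\<dots> = 16 * \<eta> ^ 3 * (6 - \<eta>)"
    proof -
      have "\<eta>\<^sup>2 / (2 * k) * (32 * \<eta> * k * (6 - \<eta>)) = 16 * \<eta> ^ 3 * (6 - \<eta>)" if "0 < k" for k
        using that by (simp add: power2_eq_square power3_eq_cube)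
      from this[of "1 - \<eta>"] show ?thesis using \<eta> by simp
    qed
    finally have "\<eta>\<^sup>2 / (2 * (1 - \<eta>)) * P < 16 * \<eta> ^ 3 * (6 - \<eta>)" .
    moreover have "step_budget \<eta> * P = (1 - \<eta>) * P - \<eta>\<^sup>2 / (2 * (1 - \<eta>)) * P"
      using False by (simp add: step_budget_def left_diff_distrib)
    ultimately show ?thesis using base unfolding P_def[symmetric] by linarith
  qed
qed

lemma step_budget_pos:
  assumes \<eta>: "0 < \<eta>" "\<eta> < 3 / 8" shows "0 < step_budget \<eta>"
proof -
  have "0 < (3 + \<eta>)\<^sup>2 * (3 - 8 * \<eta>)" using \<eta> by simp
  also note step_budget_large[OF \<eta>]
  finally show ?thesis
    by (rule zero_less_mult_pos2) (use \<eta> lower_end_numerator_pos[OF \<eta>] in simp)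
qed

lemma lower_end_pos: "1 \<le> \<nu> \<Longrightarrow> 0 < \<eta> \<Longrightarrow> \<eta> < 3 / 8 \<Longrightarrow> 0 < lower_end \<nu> \<eta>"
  unfolding lower_end_def using lower_end_numerator_pos by simp

text \<open>Rearranged, this says that the difference of the ends divided by their sum is less than
  \<open>y\<close>. The strictness is what later provides an accuracy strictly below the one
  demanded.\<close>

lemma ends_close:
  assumes \<nu>: "1 \<le> \<nu>" and \<eta>: "0 < \<eta>" "\<eta> < 3 / 8"
  defines "y \<equiv> 6 * \<eta> / (3 - 2 * \<eta>)"
  shows "upper_end \<nu> \<eta> * (1 - y) < lower_end \<nu> \<eta> * (1 + y)"
proof -
  define k where "k = \<nu> / (9 * \<eta>\<^sup>2 * (3 - 2 * \<eta>))"
  have k: "0 < k" using \<nu> \<eta> by (simp add: k_def)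
  have R: "0 < step_budget \<eta>" using step_budget_pos \<eta> .
  have y: "1 - y = (3 - 8 * \<eta>) / (3 - 2 * \<eta>)" "1 + y = (3 + 4 * \<eta>) / (3 - 2 * \<eta>)"
    using \<eta> by (auto simp: y_def field_simps)
  have "upper_end \<nu> \<eta> * (1 - y) = k * ((3 + \<eta>)\<^sup>2 * (3 - 8 * \<eta>) / step_budget \<eta>)"
    unfolding y upper_end_def k_def by (simp add: mult_ac)
  also have "\<dots> < k * ((3 + 4 * \<eta>) * (9 - 21 * \<eta> + 4 * \<eta>\<^sup>2))"
    using step_budget_large[OF \<eta>] R k by (intro mult_strict_left_mono) (simp_all add: pos_divide_less_eq mult.commute)
  also have "\<dots> = lower_end \<nu> \<eta> * (1 + y)"
    unfolding y lower_end_def k_def by (simp add: mult_ac)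
  finally show ?thesis .
qed

section \<open>Starting positions and the two-sided bound after \<open>N\<close> steps\<close>

context sparsification_instance begin

text \<open>Hides behind \<open>Lo\<close> which of the two potentials is in use. From
  \<open>Q e e = \<nu>\<close> and homogeneity, the potential at \<open>(\<nu> / \<eta>) e\<close>
  is exactly \<eta>, and it only decreases along the window.\<close>

lemma lower_start:
  assumes \<eta>: "0 < \<eta>" "\<eta> < 3 / 8"
  shows "\<exists>Lo. (\<forall>z. Lo z \<longrightarrow> z \<in> interior K) \<and> Lo ((\<nu> / \<eta>) *\<^sub>R e) \<and>
    (\<forall>z. Lo z \<longrightarrow> (\<exists>\<theta>. step_budget \<eta> \<le> sum \<theta> I \<and>
      (\<forall>i\<in>I. \<forall>t>0. 1 / t \<le> \<theta> i \<longrightarrow> Lo (z - e + t *\<^sub>R x i))))"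
proof -
  define z0 where "z0 = (\<nu> / \<eta>) *\<^sub>R e"
  have \<nu>: "1 \<le> \<nu>" using \<nu>_ge_1[OF e_int e_nz] .
  have z0: "z0 \<in> interior K" unfolding z0_def using \<nu> \<eta> by (intro int_scale e_int) auto
  have Qz0: "Q z0 e = \<eta>"
    unfolding z0_def using Q_scale[OF e_int, of "\<nu> / \<eta>" e] Q_self[OF e_int] \<nu> \<eta> by simp
  show ?thesis
  proof (cases "\<eta> \<le> 7 / 50")
    case True
    define M where "M = 4 / (5 * \<eta>)"
    have M: "0 < M" "M * \<eta> = 4 / 5" using \<eta> by (auto simp: M_def)
    define Lo where "Lo z \<longleftrightarrow> z \<in> interior K \<and> integral {0..M} (\<lambda>s. Q (z + s *\<^sub>R e) e) \<le> \<eta> * M" for z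
    have "Lo z0"
    proof -
      have "integral {0..M} (\<lambda>s. Q (z0 + s *\<^sub>R e) e) \<le> integral {0..M} (\<lambda>s. \<eta>)"
      proof (rule integral_le)
        show "(\<lambda>s. Q (z0 + s *\<^sub>R e) e) integrable_on {0..M}"
          by (intro integrable_continuous_real Q_ray_continuous z0 e_K) auto
        show "Q (z0 + s *\<^sub>R e) e \<le> \<eta>" if "s \<in> {0..M}" for s
          using Q_mono[OF z0 K_scale[OF e_K] e_K, of s] that Qz0 by simp
      qed (intro integrable_continuous_real continuous_intros)
      then show ?thesis using z0 M by (simp add: Lo_def mult.commute)
    qed
    moreover have "\<exists>\<theta>. step_budget \<eta> \<le> sum \<theta> I \<and>
      (\<forall>i\<in>I. \<forall>t>0. 1 / t \<le> \<theta> i \<longrightarrow> Lo (z - e + t *\<^sub>R x i))" if "Lo z" for z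
    proof -
      have z: "z \<in> interior K" "integral {0..M} (\<lambda>s. Q (z + s *\<^sub>R e) e) \<le> \<eta> * M"
        using that by (auto simp: Lo_def)
      show ?thesis
      proof (rule lower_step_window[OF z(1) \<eta>(1) True M(2) z(2)], goal_cases)
        case (1 \<theta>)
        then show ?case using True by (intro exI[of _ \<theta>]) (auto simp: Lo_def step_budget_def)
      qed
    qed
    ultimately show ?thesis unfolding z0_def by (intro exI[of _ Lo]) (auto simp: Lo_def)
  next
    case False
    define Lo where "Lo z \<longleftrightarrow> z \<in> interior K \<and> Q z e \<le> \<eta>" for z
    have "Lo z0" using z0 Qz0 by (simp add: Lo_def)
    moreover have "\<exists>\<theta>. step_budget \<eta> \<le> sum \<theta> I \<and>
      (\<forall>i\<in>I. \<forall>t>0. 1 / t \<le> \<theta> i \<longrightarrow> Lo (z - e + t *\<^sub>R x i))" if "Lo z" for z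
    proof -
      have z: "z \<in> interior K" "Q z e \<le> \<eta>" "\<eta> < 1" using that \<eta> by (auto simp: Lo_def)
      show ?thesis
      proof (rule lower_step_point[OF z], goal_cases)
        case (1 \<theta>)
        then show ?case using False by (intro exI[of _ \<theta>]) (auto simp: Lo_def step_budget_def)
      qed
    qed
    ultimately show ?thesis unfolding z0_def by (intro exI[of _ Lo]) (auto simp: Lo_def)
  qed
qed

lemma two_sided_sparsifier:
  assumes \<eta>: "0 < \<eta>" "\<eta> < 3 / 8" and N: "real N = \<nu> * ((3 - 2 * \<eta>) / (3 * \<eta>))\<^sup>2"
  obtains S c where "S \<subseteq> I" "card S \<le> N" "\<And>i. i \<in> S \<Longrightarrow> 0 < c i"
    "(\<Sum>i\<in>S. c i *\<^sub>R x i) - lower_end \<nu> \<eta> *\<^sub>R e \<in> K"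
    "upper_end \<nu> \<eta> *\<^sub>R e - (\<Sum>i\<in>S. c i *\<^sub>R x i) \<in> K"
proof -
  define R where "R = step_budget \<eta>"
  have R: "0 < R" using step_budget_pos[OF \<eta>] by (simp add: R_def)
  have \<nu>: "1 \<le> \<nu>" using \<nu>_ge_1[OF e_int e_nz] .
  \<comment> \<open>The minimizer of \<open>\<nu> / cU + N * d\<close> under
    \<open>cU + 1 / d = R\<close> is \<open>R \<delta> / (1 + \<delta>)\<close> with
    \<open>\<delta> = sqrt (\<nu> / N)\<close>; here
    \<open>1 / \<delta> = 1 / \<eta> - 2 / 3\<close>. The minimum
    \<open>(sqrt \<nu> + sqrt N)^2 / R\<close> is \<open>upper_end\<close>.\<close>
  define cU where "cU = 3 * \<eta> * R / (3 + \<eta>)"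
  define d where "d = (3 + \<eta>) / (R * (3 - 2 * \<eta>))"
  have cU: "0 < cU" and d: "0 < d" using R \<eta> by (auto simp: cU_def d_def)
  have cUd: "cU + 1 / d = R"
  proof -
    have "1 / d = R * (3 - 2 * \<eta>) / (3 + \<eta>)" by (simp add: d_def)
    then have "cU + 1 / d = (3 * \<eta> * R + R * (3 - 2 * \<eta>)) / (3 + \<eta>)"
      by (simp add: cU_def add_divide_distrib)
    also have "\<dots> = R * (3 + \<eta>) / (3 + \<eta>)" by (simp add: algebra_simps)
    finally show ?thesis using \<eta> by simp
  qed
  define Up where "Up z \<longleftrightarrow> z \<in> interior K \<and> Q z e \<le> cU" for z
  have Up_step: "\<exists>\<theta>. sum \<theta> I \<le> R \<and>
      (\<forall>i\<in>I. 0 < \<theta> i \<and> (\<forall>t>0. \<theta> i \<le> 1 / t \<longrightarrow> Up (z + d *\<^sub>R e - t *\<^sub>R x i)))" if "Up z" for z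
  proof -
    have z: "z \<in> interior K" "Q z e \<le> cU" using that by (auto simp: Up_def)
    show ?thesis
    proof (rule upper_step[OF z d], goal_cases)
      case (1 \<theta>)
      then show ?case by (intro exI[of _ \<theta>]) (auto simp: Up_def cUd)
    qed
  qed
  have Up0: "Up ((\<nu> / cU) *\<^sub>R e)"
    unfolding Up_def using Q_scale[OF e_int, of "\<nu> / cU" e] Q_self[OF e_int] \<nu> cU
    by (auto intro: int_scale e_int)
  obtain Lo where Lo: "\<And>z. Lo z \<Longrightarrow> z \<in> interior K" "Lo ((\<nu> / \<eta>) *\<^sub>R e)"
    "\<And>z. Lo z \<Longrightarrow> \<exists>\<theta>. R \<le> sum \<theta> I \<and> (\<forall>i\<in>I. \<forall>t>0. 1 / t \<le> \<theta> i \<longrightarrow> Lo (z - e + t *\<^sub>R x i))"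
    using lower_start[OF \<eta>] unfolding R_def by metis
  have "\<exists>S c. S \<subseteq> I \<and> card S \<le> N \<and> (\<forall>i\<in>S. 0 < c i) \<and>
      Lo ((\<nu> / \<eta>) *\<^sub>R e - real N *\<^sub>R e + (\<Sum>i\<in>S. c i *\<^sub>R x i)) \<and>
      Up ((\<nu> / cU) *\<^sub>R e + (real N * d) *\<^sub>R e - (\<Sum>i\<in>S. c i *\<^sub>R x i))"
    by (rule iterate_steps[of Lo R Up d]) (fact Lo(3) Up_step Lo(2) Up0)+
  then obtain S c where S: "S \<subseteq> I" "card S \<le> N" "\<forall>i\<in>S. 0 < c i"
    and LoS: "Lo ((\<nu> / \<eta>) *\<^sub>R e - real N *\<^sub>R e + (\<Sum>i\<in>S. c i *\<^sub>R x i))"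
    and UpS: "Up ((\<nu> / cU) *\<^sub>R e + (real N * d) *\<^sub>R e - (\<Sum>i\<in>S. c i *\<^sub>R x i))"
    by (elim exE conjE) (rule that; assumption)
  have l: "lower_end \<nu> \<eta> = real N - \<nu> / \<eta>"
    unfolding lower_end_def N using \<eta> by (simp add: field_simps power2_eq_square)
  have u: "upper_end \<nu> \<eta> = \<nu> / cU + real N * d"
  proof -
    have u1: "\<nu> / cU = \<nu> * (3 + \<eta>) * (3 * \<eta>) / (9 * \<eta>\<^sup>2 * R)"
      using \<eta> R by (simp add: cU_def field_simps power2_eq_square)
    have u2: "real N * d = \<nu> * (3 + \<eta>) * (3 - 2 * \<eta>) / (9 * \<eta>\<^sup>2 * R)"
      unfolding N d_def using \<eta> R by (simp add: power2_eq_square mult_ac)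
    have u3: "\<nu> * (3 + \<eta>) * (3 * \<eta>) + \<nu> * (3 + \<eta>) * (3 - 2 * \<eta>) = \<nu> * (3 + \<eta>)\<^sup>2"
      by (simp add: power2_eq_square algebra_simps)
    show ?thesis
      by (simp only: upper_end_def R_def[symmetric] u1 u2 u3[symmetric] add_divide_distrib)
  qed
  show ?thesis
  proof (rule that[of S c])
    show "(\<Sum>i\<in>S. c i *\<^sub>R x i) - lower_end \<nu> \<eta> *\<^sub>R e \<in> K"
      using int_K[OF Lo(1)[OF LoS]] by (simp add: l algebra_simps)
    show "upper_end \<nu> \<eta> *\<^sub>R e - (\<Sum>i\<in>S. c i *\<^sub>R x i) \<in> K"
      using UpS int_K by (simp add: Up_def u algebra_simps)
  qed (use S in auto)
qed

end

section \<open>Symmetry of second derivatives\<close>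

lemma directional_derivative:
  fixes f :: "'a::euclidean_space \<Rightarrow> real"
  assumes "f differentiable (at (p + t *\<^sub>R v))"
  shows "((\<lambda>t. f (p + t *\<^sub>R v)) has_real_derivative frechet_derivative f (at (p + t *\<^sub>R v)) v) (at t)"
proof -
  have f: "(f has_derivative frechet_derivative f (at (p + t *\<^sub>R v))) (at (p + t *\<^sub>R v))"
    using assms frechet_derivative_works by blast
  have "((\<lambda>t. p + t *\<^sub>R v) has_derivative (\<lambda>s. s *\<^sub>R v)) (at t)"
    by (auto intro!: derivative_eq_intros)
  from has_derivative_compose[OF this f]
  have "((\<lambda>t. f (p + t *\<^sub>R v)) has_derivative (\<lambda>s. frechet_derivative f (at (p + t *\<^sub>R v)) (s *\<^sub>R v))) (at t)" .
  moreover have "(\<lambda>s. frechet_derivative f (at (p + t *\<^sub>R v)) (s *\<^sub>R v)) = (*) (frechet_derivative f (at (p + t *\<^sub>R v)) v)"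
    using linear_scale[OF linear_frechet_derivative[OF assms], of _ v] by (auto simp: mult.commute)
  ultimately show ?thesis by (simp add: has_field_derivative_def)
qed

text \<open>The mean value theorem, applied in direction \<open>a\<close> and then in direction
  \<open>b\<close>. The left side is symmetric in \<open>a\<close> and \<open>b\<close>, so
  exchanging them compares the two mixed derivatives.\<close>

lemma second_difference:
  fixes f :: "'a::euclidean_space \<Rightarrow> real"
  assumes f: "\<And>p. p \<in> ball x r \<Longrightarrow> f differentiable (at p)"
    and f1: "\<And>p. p \<in> ball x r \<Longrightarrow> (\<lambda>p. frechet_derivative f (at p) a) differentiable (at p)"
    and s: "0 < s" "s * (norm a + norm b) < r"
  shows "\<exists>p\<in>ball x r. f (x + s *\<^sub>R a + s *\<^sub>R b) - f (x + s *\<^sub>R a) - f (x + s *\<^sub>R b) + f x =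
     s * s * frechet_derivative (\<lambda>p. frechet_derivative f (at p) a) (at p) b"
proof -
  have ball: "x + \<sigma> *\<^sub>R a + \<tau> *\<^sub>R b \<in> ball x r" if "0 \<le> \<sigma>" "\<sigma> \<le> s" "0 \<le> \<tau>" "\<tau> \<le> s" for \<sigma> \<tau>
  proof -
    have "norm (\<sigma> *\<^sub>R a + \<tau> *\<^sub>R b) \<le> \<sigma> * norm a + \<tau> * norm b"
      using norm_triangle_ineq[of "\<sigma> *\<^sub>R a" "\<tau> *\<^sub>R b"] that by simp
    also have "\<dots> \<le> s * norm a + s * norm b" using that by (intro add_mono mult_right_mono) auto
    finally have "norm (\<sigma> *\<^sub>R a + \<tau> *\<^sub>R b) < r" using s(2) by (simp add: algebra_simps)
    moreover have "dist x (x + \<sigma> *\<^sub>R a + \<tau> *\<^sub>R b) = norm (\<sigma> *\<^sub>R a + \<tau> *\<^sub>R b)"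
      by (metis add.assoc add_diff_cancel_left' dist_commute dist_norm)
    ultimately show ?thesis by simp
  qed
  let ?f1 = "\<lambda>p. frechet_derivative f (at p) a"
  define \<psi> where "\<psi> \<sigma> = f (x + s *\<^sub>R b + \<sigma> *\<^sub>R a) - f (x + \<sigma> *\<^sub>R a)" for \<sigma>
  have "\<exists>\<sigma>. 0 < \<sigma> \<and> \<sigma> < s \<and> \<psi> s - \<psi> 0 = (s - 0) * (?f1 (x + s *\<^sub>R b + \<sigma> *\<^sub>R a) - ?f1 (x + \<sigma> *\<^sub>R a))"
  proof (rule MVT2[OF s(1)])
    fix \<sigma> assume \<sigma>: "0 \<le> \<sigma>" "\<sigma> \<le> s"
    have "x + s *\<^sub>R b + \<sigma> *\<^sub>R a \<in> ball x r" "x + \<sigma> *\<^sub>R a \<in> ball x r"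
      using ball[OF \<sigma>, of s] ball[OF \<sigma>, of 0] s by (auto simp: algebra_simps)
    then show "(\<psi> has_real_derivative ?f1 (x + s *\<^sub>R b + \<sigma> *\<^sub>R a) - ?f1 (x + \<sigma> *\<^sub>R a)) (at \<sigma>)"
      unfolding \<psi>_def by (intro DERIV_diff directional_derivative f)
  qed
  then obtain \<sigma> where \<sigma>: "0 < \<sigma>" "\<sigma> < s"
    "\<psi> s - \<psi> 0 = s * (?f1 (x + s *\<^sub>R b + \<sigma> *\<^sub>R a) - ?f1 (x + \<sigma> *\<^sub>R a))" by auto
  have "\<exists>\<tau>. 0 < \<tau> \<and> \<tau> < s \<and> ?f1 (x + \<sigma> *\<^sub>R a + s *\<^sub>R b) - ?f1 (x + \<sigma> *\<^sub>R a + 0 *\<^sub>R b) =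
     (s - 0) * frechet_derivative ?f1 (at (x + \<sigma> *\<^sub>R a + \<tau> *\<^sub>R b)) b"
  proof (rule MVT2[OF s(1)])
    fix \<tau> assume \<tau>: "0 \<le> \<tau>" "\<tau> \<le> s"
    have "x + \<sigma> *\<^sub>R a + \<tau> *\<^sub>R b \<in> ball x r" using ball[OF _ _ \<tau>] \<sigma> by simp
    then show "((\<lambda>\<tau>. ?f1 (x + \<sigma> *\<^sub>R a + \<tau> *\<^sub>R b)) has_real_derivative
       frechet_derivative ?f1 (at (x + \<sigma> *\<^sub>R a + \<tau> *\<^sub>R b)) b) (at \<tau>)"
      by (intro directional_derivative f1)
  qed
  then obtain \<tau> where \<tau>: "0 < \<tau>" "\<tau> < s" "?f1 (x + s *\<^sub>R b + \<sigma> *\<^sub>R a) - ?f1 (x + \<sigma> *\<^sub>R a) =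
     s * frechet_derivative ?f1 (at (x + \<sigma> *\<^sub>R a + \<tau> *\<^sub>R b)) b" by (auto simp: algebra_simps)
  have "\<psi> s - \<psi> 0 = f (x + s *\<^sub>R a + s *\<^sub>R b) - f (x + s *\<^sub>R a) - f (x + s *\<^sub>R b) + f x"
    by (simp add: \<psi>_def algebra_simps)
  then have "f (x + s *\<^sub>R a + s *\<^sub>R b) - f (x + s *\<^sub>R a) - f (x + s *\<^sub>R b) + f x =
     s * s * frechet_derivative ?f1 (at (x + \<sigma> *\<^sub>R a + \<tau> *\<^sub>R b)) b"
    using \<sigma>(3) \<tau>(3) by (metis mult.assoc)
  then show ?thesis using ball[of \<sigma> \<tau>] \<sigma> \<tau> by (intro bexI[of _ "x + \<sigma> *\<^sub>R a + \<tau> *\<^sub>R b"]) auto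
qed

text \<open>Schwarz's theorem. It is needed at two levels: for the symmetry of \<open>H\<close>, and
  with a first derivative in place of \<open>f\<close> for the third derivative in
  \<open>third_sym\<close>.\<close>

lemma second_derivative_symmetric:
  fixes f :: "'a::euclidean_space \<Rightarrow> real"
  assumes S: "open S" "x \<in> S" and C2: "continuously_differentiable_on 2 S f"
  shows "frechet_derivative (\<lambda>p. frechet_derivative f (at p) a) (at x) b =
    frechet_derivative (\<lambda>p. frechet_derivative f (at p) b) (at x) a"
proof -
  let ?F = "\<lambda>a b p. frechet_derivative (\<lambda>p. frechet_derivative f (at p) a) (at p) b"
  have f: "\<And>p. p \<in> S \<Longrightarrow> f differentiable (at p)"
    and f1: "\<And>p v. p \<in> S \<Longrightarrow> (\<lambda>p. frechet_derivative f (at p) v) differentiable (at p)"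
    and f2: "\<And>a b. continuous_on S (?F a b)"
    using C2 by (auto simp: numeral_2_eq_2)
  have "\<bar>?F a b x - ?F b a x\<bar> \<le> 0"
  proof (rule field_le_epsilon)
    fix k :: real assume k: "0 < k"
    have near: "eventually (\<lambda>p. \<bar>?F a b p - ?F a b x\<bar> < k / 2) (at x)" for a b
    proof -
      have "(?F a b \<longlongrightarrow> ?F a b x) (at x)"
        using f2[of a b] S by (simp add: continuous_on_eq_continuous_at isCont_def)
      from tendstoD[OF this, of "k / 2"] show ?thesis using k by (simp add: dist_real_def)
    qed
    have "eventually (\<lambda>p. p \<in> S) (at x)" using S by (simp add: eventually_at_topological) blast
    then have "eventually (\<lambda>p. p \<in> S \<and> \<bar>?F a b p - ?F a b x\<bar> < k / 2 \<and> \<bar>?F b a p - ?F b a x\<bar> < k / 2) (at x)"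
      using near[of a b] near[of b a] by eventually_elim auto
    then obtain r where r: "0 < r" and near_r: "\<And>p. p \<in> ball x r \<Longrightarrow>
        p \<in> S \<and> \<bar>?F a b p - ?F a b x\<bar> < k / 2 \<and> \<bar>?F b a p - ?F b a x\<bar> < k / 2"
      unfolding eventually_at using S k
      by (metis (no_types, lifting) UNIV_I abs_zero cancel_comm_monoid_add_class.diff_cancel dist_commute half_gt_zero mem_ball)
    define s where "s = r / (2 * (norm a + norm b + 1))"
    have n: "0 < norm a + norm b + 1" by (simp add: add_nonneg_pos)
    have s: "0 < s" using r n by (simp add: s_def)
    have "s * (norm a + norm b) < s * (2 * (norm a + norm b + 1))"
      using s n by (intro mult_strict_left_mono) auto
    also have "\<dots> = r" using n by (simp add: s_def)
    finally have sr: "s * (norm a + norm b) < r" .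
    obtain p where p: "p \<in> ball x r" "f (x + s *\<^sub>R a + s *\<^sub>R b) - f (x + s *\<^sub>R a) - f (x + s *\<^sub>R b) + f x = s * s * ?F a b p"
      using second_difference[of x r f a s b, OF f f1 s sr] near_r by blast
    have sr': "s * (norm b + norm a) < r" using sr by (simp add: add.commute)
    obtain q where q: "q \<in> ball x r" "f (x + s *\<^sub>R b + s *\<^sub>R a) - f (x + s *\<^sub>R b) - f (x + s *\<^sub>R a) + f x = s * s * ?F b a q"
      using second_difference[of x r f b s a, OF f f1 s sr'] near_r by blast
    have "s * s * ?F a b p = s * s * ?F b a q" unfolding p(2)[symmetric] q(2)[symmetric] by (simp add: algebra_simps)
    then have "?F a b p = ?F b a q" using s by simp
    then show "\<bar>?F a b x - ?F b a x\<bar> \<le> 0 + k" using near_r[OF p(1)] near_r[OF q(1)] by linarith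
  qed
  then show ?thesis by simp
qed

lemma Dk_1:
  assumes "f differentiable (at x)"
  shows "Dk f x [u] = frechet_derivative f (at x) u"
  using DERIV_imp_deriv[OF directional_derivative[of f x 0 u]] assms by simp

text \<open>The formula \<open>g\<close> must hold on a whole neighbourhood, since the outer
  derivative looks at nearby points.\<close>

lemma Dk_Cons:
  assumes S: "open S" "x \<in> S" and eq: "\<And>p. p \<in> S \<Longrightarrow> Dk f p us = g p" and g: "g differentiable (at x)"
  shows "Dk f x (u # us) = frechet_derivative g (at x) u"
proof -
  have d: "((\<lambda>t. g (x + t *\<^sub>R u)) has_real_derivative frechet_derivative g (at x) u) (at 0)"
    using directional_derivative[of g x 0 u] g by simp
  have ev: "eventually (\<lambda>t. Dk f (x + t *\<^sub>R u) us = g (x + t *\<^sub>R u)) (nhds 0)"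
  proof -
    have "((\<lambda>t. x + t *\<^sub>R u) \<longlongrightarrow> x + 0 *\<^sub>R u) (nhds 0)"
      by (intro tendsto_intros filterlim_ident)
    then have "eventually (\<lambda>t. x + t *\<^sub>R u \<in> S) (nhds 0)"
      using S by (intro topological_tendstoD) auto
    then show ?thesis by eventually_elim (rule eq)
  qed
  have "((\<lambda>t. Dk f (x + t *\<^sub>R u) us) has_real_derivative frechet_derivative g (at x) u) (at 0)"
    by (rule iffD2[OF DERIV_cong_ev[OF refl ev refl] d])
  then show ?thesis by (simp add: DERIV_imp_deriv)
qed

section \<open>From self-concordant barriers to the abstract setting\<close>

declare Dk.simps [simp del]

lemma proper_cone_locale:
  fixes K :: "'a::euclidean_space set"
  assumes "proper_cone K" shows "closed_pointed_cone K"
proof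
  show "closed K" "convex_cone K" using assms by (auto simp: proper_cone_def)
  show "x = 0" if "x \<in> K" "- x \<in> K" for x
  proof -
    have "x \<in> K \<inter> uminus ` K" using that by (auto intro: image_eqI[of _ _ "- x"])
    then show ?thesis using assms by (auto simp: proper_cone_def pointed_def)
  qed
qed

text \<open>For \<open>u\<close> in \<open>K\<close> the lower half of the two-sided condition is
  automatic. The infimum is meaningful because a negative \<open>t\<close> in the set would put
  \<open>- z\<close> into \<open>K\<close>.\<close>

lemma (in closed_pointed_cone) local_norm_le:
  assumes "z \<in> interior K" "u \<in> K" "0 \<le> h" "h *\<^sub>R z - u \<in> K"
  shows "local_norm K z u \<le> h"
  unfolding local_norm_def
proof (rule cInf_lower)
  show "h \<in> {t. cone_le K (- t *\<^sub>R z) u \<and> cone_le K u (t *\<^sub>R z)}"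
    using assms int_K by (auto simp: cone_le_def intro: K_add K_scale)
  show "bdd_below {t. cone_le K (- t *\<^sub>R z) u \<and> cone_le K u (t *\<^sub>R z)}"
  proof -
    obtain w :: 'a where "w \<in> Basis" using nonempty_Basis by blast
    then have z0: "z \<noteq> 0" using int_nonzero[OF assms(1) nonzero_Basis] by blast
    have "0 \<le> t" if t: "u + t *\<^sub>R z \<in> K" "t *\<^sub>R z - u \<in> K" for t
    proof (rule ccontr)
      assume "\<not> 0 \<le> t"
      then have "(1 / (- 2 * t)) *\<^sub>R ((u + t *\<^sub>R z) + (t *\<^sub>R z - u)) \<in> K"
        using \<open>\<not> 0 \<le> t\<close> by (intro K_scale K_add[OF t]) auto
      moreover have "(u + t *\<^sub>R z) + (t *\<^sub>R z - u) = (2 * t) *\<^sub>R z" by (simp only: scaleR_scaleR[symmetric] scaleR_2) simp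
      ultimately have "- z \<in> K" using \<open>\<not> 0 \<le> t\<close> by simp
      then show False using pointed_K int_K assms(1) z0 by blast
    qed
    then show ?thesis by (intro bdd_belowI[of _ 0]) (auto simp: cone_le_def add.commute)
  qed
qed

text \<open>If \<open>d z - u\<close> were in \<open>K\<close> for all \<open>d > 0\<close>,
  closedness would put \<open>- u\<close> into \<open>K\<close>. Positivity lets the sign of the
  second derivative be read off from the pairwise inequality.\<close>

lemma (in closed_pointed_cone) local_norm_pos:
  assumes "z \<in> interior K" "u \<in> K" "u \<noteq> 0"
  shows "0 < local_norm K z u"
proof -
  obtain d where d: "0 < d" "d *\<^sub>R z - u \<notin> K"
  proof (rule ccontr)
    assume "\<not> thesis"
    then have "(1 / real (Suc n)) *\<^sub>R z - u \<in> K" for n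
      using that by (metis divide_pos_pos of_nat_0_less_iff zero_less_Suc zero_less_one)
    moreover have "(\<lambda>n. (1 / real (Suc n)) *\<^sub>R z - u) \<longlonglongrightarrow> 0 *\<^sub>R z - u"
      using LIMSEQ_inverse_real_of_nat
      by (intro tendsto_intros) (simp add: inverse_eq_divide)
    ultimately have "- u \<in> K" using closed_sequentially[OF closed_K] by force
    then show False using pointed_K assms by blast
  qed
  have "d \<le> local_norm K z u"
    unfolding local_norm_def
  proof (rule cInf_greatest)
    obtain h where "0 < h" "h *\<^sub>R z - u \<in> K" using int_dominates[OF assms(1)] by blast
    then show "{t. cone_le K (- t *\<^sub>R z) u \<and> cone_le K u (t *\<^sub>R z)} \<noteq> {}"
      using assms int_K by (auto simp: cone_le_def intro!: exI[of _ h] K_add K_scale)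
    fix t assume "t \<in> {t. cone_le K (- t *\<^sub>R z) u \<and> cone_le K u (t *\<^sub>R z)}"
    then have t: "t *\<^sub>R z - u \<in> K" by (simp add: cone_le_def)
    show "d \<le> t"
    proof (rule ccontr)
      assume "\<not> d \<le> t"
      then have "(t *\<^sub>R z - u) + (d - t) *\<^sub>R z \<in> K" using t assms int_K by (intro K_add K_scale) auto
      then show False using d(2) by (simp add: algebra_simps)
    qed
  qed
  then show ?thesis using d by linarith
qed

locale psc_barrier =
  fixes K D :: "'a::euclidean_space set" and \<nu> :: real and \<phi> :: "'a \<Rightarrow> real"
  assumes proper: "proper_cone K" and psc: "pairwise_self_concordant_barrier \<nu> K D \<phi>"
begin

sublocale closed_pointed_cone K using proper_cone_locale[OF proper] .

lemma lhb: "log_homogeneous_barrier \<nu> K D \<phi>" and sc: "self_concordant D \<phi>"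
  using psc by (auto simp: pairwise_self_concordant_barrier_def log_homogeneous_barrier_def)

lemma D_open: "open D" and D_convex: "convex D" and epi_closed: "closed (epigraph D \<phi>)"
  using sc by (auto simp: self_concordant_def convex_on_def)

text \<open>An open convex set is the interior of its closure.\<close>

lemma D_eq: "D = interior K"
proof -
  have "closure D = K" using lhb by (simp add: log_homogeneous_barrier_def)
  then show ?thesis using convex_interior_closure[OF D_convex] interior_open[OF D_open] by simp
qed

definition "\<phi>1 = (\<lambda>v p. frechet_derivative \<phi> (at p) v)"
definition "\<phi>2 = (\<lambda>v u p. frechet_derivative (\<phi>1 v) (at p) u)"

lemma C3: "continuously_differentiable_on 3 D \<phi>"
  using sc by (simp add: self_concordant_def)

lemma C2_\<phi>1: "continuously_differentiable_on 2 D (\<phi>1 v)"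
  using C3 by (simp add: \<phi>1_def numeral_3_eq_3 numeral_2_eq_2)

lemma C2_\<phi>: "continuously_differentiable_on 2 D \<phi>"
  using C3
  by (auto simp: numeral_3_eq_3 numeral_2_eq_2
    intro!: continuous_at_imp_continuous_on differentiable_imp_continuous_within)

lemma diff_\<phi>: "p \<in> D \<Longrightarrow> \<phi> differentiable (at p)"
  using C3 by (simp add: numeral_3_eq_3)

lemma diff_\<phi>1: "p \<in> D \<Longrightarrow> \<phi>1 v differentiable (at p)"
  using C3 by (simp add: \<phi>1_def numeral_3_eq_3)

lemma diff_\<phi>2: "p \<in> D \<Longrightarrow> \<phi>2 v u differentiable (at p)"
  using C3 by (simp add: \<phi>1_def \<phi>2_def numeral_3_eq_3)

lemma \<phi>2_sym: "p \<in> D \<Longrightarrow> \<phi>2 v u p = \<phi>2 u v p"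
  using second_derivative_symmetric[OF D_open _ C2_\<phi>, of p v u] by (simp add: \<phi>2_def \<phi>1_def)

lemma Dk1: "p \<in> D \<Longrightarrow> Dk \<phi> p [u] = \<phi>1 u p"
  using Dk_1[OF diff_\<phi>] by (simp add: \<phi>1_def)

text \<open>The arguments swap because the last list entry is differentiated first, whereas \<phi>2
  takes the first direction first.\<close>

lemma Dk2: "p \<in> D \<Longrightarrow> Dk \<phi> p [v, u] = \<phi>2 u v p"
  using Dk_Cons[OF D_open _ Dk1 diff_\<phi>1] by (simp add: \<phi>2_def)

lemma Dk3: "p \<in> D \<Longrightarrow> Dk \<phi> p [w, v, u] = frechet_derivative (\<phi>2 u v) (at p) w"
  using Dk_Cons[OF D_open _ Dk2 diff_\<phi>2] by simp

text \<open>Differentiating \<open>H (z + t u) v u\<close> in \<open>t\<close> puts \<open>u\<close>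
  outermost, but the pairwise inequality has \<open>v\<close> there.\<close>

lemma third_sym:
  assumes "p \<in> D"
  shows "frechet_derivative (\<phi>2 u v) (at p) u = Dk \<phi> p [v, u, u]"
proof -
  have "frechet_derivative (\<phi>2 u v) (at p) u = frechet_derivative (\<phi>2 u u) (at p) v"
    using second_derivative_symmetric[OF D_open assms C2_\<phi>1[of u], of v u] by (simp add: \<phi>2_def)
  then show ?thesis using Dk3[OF assms] by simp
qed

definition "Q z v = - \<phi>1 v z"
definition "H z u v = \<phi>2 v u z"

lemma \<phi>1_deriv:
  assumes "z + t *\<^sub>R a \<in> D"
  shows "((\<lambda>t. \<phi> (z + t *\<^sub>R a)) has_real_derivative \<phi>1 a (z + t *\<^sub>R a)) (at t)"
  using directional_derivative[OF diff_\<phi>[OF assms]] by (simp add: \<phi>1_def)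

lemma \<phi>2_deriv:
  assumes "z + t *\<^sub>R a \<in> D"
  shows "((\<lambda>t. \<phi>1 b (z + t *\<^sub>R a)) has_real_derivative \<phi>2 b a (z + t *\<^sub>R a)) (at t)"
  using directional_derivative[OF diff_\<phi>1[OF assms]] by (simp add: \<phi>2_def)

lemma H_lin: "z \<in> D \<Longrightarrow> linear (H z a)"
proof -
  assume z: "z \<in> D"
  have "H z a = (\<lambda>b. frechet_derivative (\<phi>1 a) (at z) b)"
    using \<phi>2_sym[OF z] by (auto simp: H_def \<phi>2_def)
  then show ?thesis using linear_frechet_derivative[OF diff_\<phi>1[OF z]] by simp
qed

lemma pairwise:
  assumes "z \<in> D" "u \<in> K" "v \<in> K"
  shows "0 \<le> - Dk \<phi> z [v, u, u]" "- Dk \<phi> z [v, u, u] \<le> 2 * H z v u * local_norm K z u"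
proof -
  have "0 \<le> - Dk \<phi> z [v, u, u] \<and> - Dk \<phi> z [v, u, u] \<le> 2 * Dk \<phi> z [v, u] * local_norm K z u"
    using psc assms unfolding pairwise_self_concordant_barrier_def D_eq by blast
  then show "0 \<le> - Dk \<phi> z [v, u, u]" "- Dk \<phi> z [v, u, u] \<le> 2 * H z v u * local_norm K z u"
    unfolding H_def Dk2[OF assms(1), symmetric] by blast+
qed

lemma H_ge_0:
  assumes "z \<in> D" "u \<in> K" "v \<in> K" shows "0 \<le> H z v u"
proof (cases "u = 0")
  case True
  then show ?thesis using linear_0[OF H_lin[OF assms(1)], of v] by simp
next
  case False
  have "0 \<le> 2 * H z v u * local_norm K z u" using pairwise[OF assms] by linarith
  then show ?thesis
    using local_norm_pos[OF _ assms(2) False, of z] assms(1) by (simp add: D_eq zero_le_mult_iff)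
qed

lemma H_deriv_bound:
  assumes z: "z \<in> D" and uv: "u \<in> K" "v \<in> K"
  shows "\<exists>T. ((\<lambda>t. H (z + t *\<^sub>R u) v u) has_real_derivative - T) (at 0) \<and> 0 \<le> T \<and>
          (\<forall>h\<ge>0. h *\<^sub>R z - u \<in> K \<longrightarrow> T \<le> 2 * H z v u * h)"
proof (intro exI[of _ "- Dk \<phi> z [v, u, u]"] conjI allI impI)
  have "((\<lambda>t. \<phi>2 u v (z + t *\<^sub>R u)) has_real_derivative frechet_derivative (\<phi>2 u v) (at z) u) (at 0)"
    using directional_derivative[of "\<phi>2 u v" z 0 u] diff_\<phi>2[OF z] by simp
  then show "((\<lambda>t. H (z + t *\<^sub>R u) v u) has_real_derivative - (- Dk \<phi> z [v, u, u])) (at 0)"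
    by (simp add: H_def third_sym[OF z])
  show "0 \<le> - Dk \<phi> z [v, u, u]" using pairwise(1)[OF z uv] .
  fix h :: real assume h: "0 \<le> h" "h *\<^sub>R z - u \<in> K"
  have "- Dk \<phi> z [v, u, u] \<le> 2 * H z v u * local_norm K z u" using pairwise(2)[OF z uv] .
  also have "\<dots> \<le> 2 * H z v u * h"
    using H_ge_0[OF z uv] local_norm_le[OF _ uv(1) h] z by (intro mult_left_mono) (auto simp: D_eq)
  finally show "- Dk \<phi> z [v, u, u] \<le> 2 * H z v u * h" .
qed

section \<open>Identities from logarithmic homogeneity\<close>

lemma homogeneous: "z \<in> D \<Longrightarrow> 0 < t \<Longrightarrow> \<phi> (t *\<^sub>R z) = \<phi> z - \<nu> * ln t"
  using lhb by (simp add: log_homogeneous_barrier_def)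

lemma near_D:
  assumes "z \<in> D" shows "eventually (\<lambda>t. z + t *\<^sub>R a \<in> D) (nhds 0)"
proof -
  have "((\<lambda>t. z + t *\<^sub>R a) \<longlongrightarrow> z + 0 *\<^sub>R a) (nhds 0)"
    by (intro tendsto_intros filterlim_ident)
  then show ?thesis using assms D_open by (intro topological_tendstoD) auto
qed

lemma D_scale: "z \<in> D \<Longrightarrow> 0 < t \<Longrightarrow> t *\<^sub>R z \<in> D"
  using int_scale by (simp add: D_eq)

lemma Q_self':
  assumes z: "z \<in> D" shows "Q z z = \<nu>"
proof -
  have "((\<lambda>t. \<phi> (z + t *\<^sub>R z)) has_real_derivative \<phi>1 z z) (at 0)"
    using \<phi>1_deriv[of z 0 z] z by simp
  moreover have "((\<lambda>t. \<phi> (z + t *\<^sub>R z)) has_real_derivative - \<nu>) (at 0)"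
  proof (rule iffD2[OF DERIV_cong_ev[OF refl _ refl]])
    show "((\<lambda>t. \<phi> z - \<nu> * ln (1 + t)) has_real_derivative - \<nu>) (at 0)"
      by (auto intro!: derivative_eq_intros)
    have "eventually (\<lambda>t::real. -1 < t) (nhds 0)" 
      using eventually_nhds_in_open[of "{-1<..}" "0::real"] by simp
    then show "eventually (\<lambda>t. \<phi> (z + t *\<^sub>R z) = \<phi> z - \<nu> * ln (1 + t)) (nhds 0)"
    proof eventually_elim
      case (elim t)
      then show ?case using homogeneous[OF z, of "1 + t"] by (simp add: scaleR_add_left)
    qed
  qed
  ultimately have "\<phi>1 z z = - \<nu>" by (rule DERIV_unique)
  then show ?thesis by (simp add: Q_def)
qed

lemma Q_scale':
  assumes z: "z \<in> D" and t: "0 < t" shows "Q (t *\<^sub>R z) v = Q z v / t"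
proof -
  have "((\<lambda>s. \<phi> (t *\<^sub>R z + s *\<^sub>R v)) has_real_derivative \<phi>1 v (t *\<^sub>R z)) (at 0)"
    using \<phi>1_deriv[of "t *\<^sub>R z" 0 v] D_scale[OF z t] by simp
  moreover have "((\<lambda>s. \<phi> (t *\<^sub>R z + s *\<^sub>R v)) has_real_derivative \<phi>1 v z / t) (at 0)"
  proof (rule iffD2[OF DERIV_cong_ev[OF refl _ refl]])
    have "((\<lambda>s. \<phi> (z + s *\<^sub>R ((1 / t) *\<^sub>R v))) has_real_derivative \<phi>1 ((1 / t) *\<^sub>R v) z) (at 0)"
      using \<phi>1_deriv[of z 0 "(1 / t) *\<^sub>R v"] z by simp
    moreover have "\<phi>1 ((1 / t) *\<^sub>R v) z = \<phi>1 v z / t"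
      using linear_scale[OF linear_frechet_derivative[OF diff_\<phi>[OF z]], of "1 / t" v] by (simp add: \<phi>1_def)
    ultimately show "((\<lambda>s. \<phi> (z + s *\<^sub>R ((1 / t) *\<^sub>R v)) - \<nu> * ln t) has_real_derivative \<phi>1 v z / t) (at 0)"
      by (auto intro!: derivative_eq_intros)
    show "eventually (\<lambda>s. \<phi> (t *\<^sub>R z + s *\<^sub>R v) = \<phi> (z + s *\<^sub>R ((1 / t) *\<^sub>R v)) - \<nu> * ln t) (nhds 0)"
      using near_D[OF z, of "(1 / t) *\<^sub>R v"]
    proof eventually_elim
      case (elim s)
      then show ?case using homogeneous[OF elim t] t by (simp add: scaleR_add_right)
    qed
  qed
  ultimately have "\<phi>1 v (t *\<^sub>R z) = \<phi>1 v z / t" by (rule DERIV_unique)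
  then show ?thesis by (simp add: Q_def)
qed

lemma H_self':
  assumes z: "z \<in> D" shows "H z z v = Q z v"
proof -
  have "((\<lambda>t. \<phi>1 v (z + t *\<^sub>R z)) has_real_derivative \<phi>2 v z z) (at 0)"
    using \<phi>2_deriv[of z 0 z v] z by simp
  moreover have "((\<lambda>t. \<phi>1 v (z + t *\<^sub>R z)) has_real_derivative - \<phi>1 v z) (at 0)"
  proof (rule iffD2[OF DERIV_cong_ev[OF refl _ refl]])
    show "((\<lambda>t. \<phi>1 v z / (1 + t)) has_real_derivative - \<phi>1 v z) (at 0)"
      by (auto intro!: derivative_eq_intros)
    have "eventually (\<lambda>t::real. -1 < t) (nhds 0)" 
      using eventually_nhds_in_open[of "{-1<..}" "0::real"] by simp
    then show "eventually (\<lambda>t. \<phi>1 v (z + t *\<^sub>R z) = \<phi>1 v z / (1 + t)) (nhds 0)"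
    proof eventually_elim
      case (elim t)
      then show ?case using Q_scale'[OF z, of "1 + t" v] by (simp add: scaleR_add_left Q_def)
    qed
  qed
  ultimately have "\<phi>2 v z z = - \<phi>1 v z" by (rule DERIV_unique)
  then show ?thesis by (simp add: Q_def H_def)
qed

lemma N_deriv:
  assumes "z - r *\<^sub>R x \<in> D" "x \<in> K"
  shows "\<exists>T. ((\<lambda>r. H (z - r *\<^sub>R x) x x) has_real_derivative T) (at r) \<and>
    T \<le> 2 * (H (z - r *\<^sub>R x) x x * sqrt (H (z - r *\<^sub>R x) x x))"
proof (intro exI conjI)
  let ?p = "z - r *\<^sub>R x"
  have "((\<lambda>t. \<phi>2 x x (?p + t *\<^sub>R (- x))) has_real_derivative frechet_derivative (\<phi>2 x x) (at ?p) (- x)) (at 0)"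
    using directional_derivative[of "\<phi>2 x x" ?p 0 "- x"] diff_\<phi>2[OF assms(1)] by simp
  moreover have "frechet_derivative (\<phi>2 x x) (at ?p) (- x) = - Dk \<phi> ?p [x, x, x]"
    using linear_neg[OF linear_frechet_derivative[OF diff_\<phi>2[OF assms(1)]]] Dk3[OF assms(1)] by simp
  ultimately have "((\<lambda>t. \<phi>2 x x (z - (t + r) *\<^sub>R x)) has_real_derivative - Dk \<phi> ?p [x, x, x]) (at 0)"
    by (simp add: algebra_simps)
  then show "((\<lambda>r. H (z - r *\<^sub>R x) x x) has_real_derivative - Dk \<phi> ?p [x, x, x]) (at r)"
    using DERIV_shift[of "\<lambda>t. \<phi>2 x x (z - t *\<^sub>R x)" _ 0 r] by (simp add: H_def)
  have "\<bar>Dk \<phi> ?p [x, x, x]\<bar> \<le> 2 * (Dk \<phi> ?p [x, x]) powr (3 / 2)"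
    using sc assms(1) unfolding self_concordant_def by blast
  moreover have "(Dk \<phi> ?p [x, x]) powr (3 / 2) = H ?p x x * sqrt (H ?p x x)"
  proof -
    have n: "0 \<le> H ?p x x" using H_ge_0[OF assms(1,2,2)] .
    have "H ?p x x powr (3 / 2) = H ?p x x powr (1 + 1 / 2)" by simp
    also have "\<dots> = H ?p x x * sqrt (H ?p x x)" using n by (simp only: powr_add powr_half_sqrt powr_one)
    finally show ?thesis using Dk2[OF assms(1)] by (simp add: H_def)
  qed
  ultimately show "- Dk \<phi> ?p [x, x, x] \<le> 2 * (H ?p x x * sqrt (H ?p x x))" by linarith
qed

text \<open>Dikin's ellipsoid. Self-concordance bounds \<open>D\<^sup>2\<phi>[x, x]\<close>, hence \<open>\<phi>\<close>, along the segment, and a closed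
  function is unbounded along a segment that leaves its open domain.\<close>

lemma dikin_segment:
  assumes z: "z \<in> D" and x: "x \<in> K" and k: "0 < k" and s1: "0 \<le> s1" "s1 * sqrt (H z x x + k) < 1"
  shows "z - s1 *\<^sub>R x \<in> D"
proof (rule ccontr)
  assume out: "z - s1 *\<^sub>R x \<notin> D"
  define B where "B = (\<lambda>s. z - s *\<^sub>R x) -` (- D) \<inter> {0..s1}"
  define s0 where "s0 = Inf B"
  have "closed B" unfolding B_def by (intro closed_vimage_Int closed_Compl D_open continuous_intros)
  moreover have "bdd_below B" by (rule bdd_belowI[of _ 0]) (auto simp: B_def)
  moreover have "s1 \<in> B" using out s1 by (simp add: B_def)
  ultimately have s0B: "s0 \<in> B" unfolding s0_def using closed_contains_Inf[of B] by blast
  have inD: "z - r *\<^sub>R x \<in> D" if "0 \<le> r" "r < s0" for r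
  proof (rule ccontr)
    assume "z - r *\<^sub>R x \<notin> D"
    then have "r \<in> B" using that s0B by (auto simp: B_def)
    then have "s0 \<le> r" unfolding s0_def using \<open>bdd_below B\<close> by (intro cInf_lower)
    then show False using that by simp
  qed
  have s0: "0 < s0" "s0 \<le> s1" using s0B z by (auto simp: B_def less_le)
  define N where "N r = H (z - r *\<^sub>R x) x x" for r
  have N0: "0 \<le> N r" if "0 \<le> r" "r < s0" for r unfolding N_def using H_ge_0[OF inD[OF that] x x] .
  define n where "n = sqrt (N 0 + k)"
  have n: "0 < n" using N0[of 0] s0 k by (simp add: n_def)
  define \<rho> where "\<rho> = 1 / n - s0"
  have \<rho>: "0 < \<rho>"
  proof -
    have "s0 * n \<le> s1 * n" using s0 n by simp
    also have "s1 * n < 1" using s1 by (simp add: n_def N_def)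
    finally show ?thesis using n by (simp add: \<rho>_def field_simps)
  qed
  have N_le: "N r \<le> 1 / \<rho>\<^sup>2" if r: "0 \<le> r" "r < s0" for r
  proof -
    \<comment> \<open>From \<open>N' \<le> 2 N^(3/2) \<le> 2 (N + k)^(3/2)\<close>, the reciprocal
      root decreases at rate at most 1. The positive \<open>k\<close> keeps the root differentiable
      and nonzero where \<open>N\<close> vanishes.\<close>
    have "1 / sqrt (N 0 + k) + 0 \<le> 1 / sqrt (N r + k) + r"
    proof (rule DERIV_nonneg_imp_nondecreasing[OF r(1)])
      fix a assume a: "0 \<le> a" "a \<le> r"
      then have as: "a < s0" using r by linarith
      obtain T where T: "(N has_real_derivative T) (at a)" "T \<le> 2 * (N a * sqrt (N a))"
        using N_deriv[OF inD[OF a(1) as] x] unfolding N_def by blast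
      define w where "w = sqrt (N a + k)"
      have w: "0 < w" "w\<^sup>2 = N a + k" using N0[OF a(1) as] k by (auto simp: w_def)
      have d: "((\<lambda>r. sqrt (N r + k)) has_real_derivative T / (2 * w)) (at a)"
        using N0[OF a(1) as] k by (auto intro!: derivative_eq_intros T(1) simp: w_def field_simps)
      have "((\<lambda>r. inverse (sqrt (N r + k)) + r) has_real_derivative
          - (inverse w * (T / (2 * w)) * inverse w) + 1) (at a)"
        using DERIV_add[OF DERIV_inverse'[OF d] DERIV_ident] w(1) by (simp add: w_def)
      then have "((\<lambda>r. 1 / sqrt (N r + k) + r) has_real_derivative - (T / (2 * w)) / w\<^sup>2 + 1) (at a)"
        by (simp add: inverse_eq_divide power2_eq_square mult_ac)
      moreover have "T / (2 * w) / w\<^sup>2 \<le> 1"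
      proof -
        have "N a * sqrt (N a) \<le> w\<^sup>2 * w"
          using N0[OF a(1) as] k by (intro mult_mono) (auto simp: w w_def)
        then have "T \<le> 2 * (w\<^sup>2 * w)" using T(2) by linarith
        then show ?thesis using w(1) by (simp add: pos_divide_le_eq mult_ac)
      qed
      ultimately show "\<exists>y. ((\<lambda>r. 1 / sqrt (N r + k) + r) has_real_derivative y) (at a) \<and> 0 \<le> y"
        by (intro exI[of _ "- (T / (2 * w)) / w\<^sup>2 + 1"]) simp
    qed
    then have "\<rho> \<le> 1 / sqrt (N r + k)" using r by (simp add: \<rho>_def n_def)
    moreover have sq: "0 < sqrt (N r + k)" using N0[OF r] k by simp
    ultimately have "sqrt (N r + k) \<le> 1 / \<rho>" using \<rho> by (simp add: field_simps)
    then have "(sqrt (N r + k))\<^sup>2 \<le> (1 / \<rho>)\<^sup>2" using sq by (intro power_mono) auto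
    then show ?thesis using N0[OF r] k by (simp add: power_divide)
  qed
  define q where "q r = Q (z - r *\<^sub>R x) x" for r
  have "((\<lambda>r. \<phi> (z - r *\<^sub>R x)) has_real_derivative q r) (at r)
      \<and> (q has_real_derivative N r) (at r)" if r: "0 \<le> r" "r < s0" for r
  proof -
    have p: "z + (- r) *\<^sub>R x \<in> D" using inD[OF r] by simp
    have "((\<lambda>r. \<phi> (z + (- r) *\<^sub>R x)) has_real_derivative - \<phi>1 x (z + (- r) *\<^sub>R x)) (at r)"
      using iffD1[OF DERIV_mirror \<phi>1_deriv[OF p]] .
    moreover have "((\<lambda>r. \<phi>1 x (z + (- r) *\<^sub>R x)) has_real_derivative - \<phi>2 x x (z + (- r) *\<^sub>R x)) (at r)"
      using iffD1[OF DERIV_mirror \<phi>2_deriv[OF p]] .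
    from DERIV_minus[OF this] have "(q has_real_derivative N r) (at r)"
      by (simp add: q_def[abs_def] N_def Q_def H_def)
    ultimately show ?thesis by (simp add: q_def Q_def)
  qed
  then have f_deriv: "((\<lambda>r. \<phi> (z - r *\<^sub>R x)) has_real_derivative q r) (at r)"
    and q_deriv: "(q has_real_derivative N r) (at r)" if "0 \<le> r" "r < s0" for r using that by auto
  define C1 where "C1 = q 0 + s0 / \<rho>\<^sup>2"
  have q_le: "q r \<le> C1" if r: "0 \<le> r" "r < s0" for r
  proof -
    have "q r - r / \<rho>\<^sup>2 \<le> q 0 - 0 / \<rho>\<^sup>2"
    proof (rule DERIV_nonpos_imp_nonincreasing[OF r(1)])
      fix a assume a: "0 \<le> a" "a \<le> r"
      then have as: "a < s0" using r by linarith
      have "((\<lambda>r. q r - r / \<rho>\<^sup>2) has_real_derivative N a - 1 / \<rho>\<^sup>2) (at a)"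
        by (intro DERIV_diff q_deriv[OF a(1) as] DERIV_cdivide DERIV_ident)
      then show "\<exists>y. ((\<lambda>r. q r - r / \<rho>\<^sup>2) has_real_derivative y) (at a) \<and> y \<le> 0"
        using N_le[OF a(1) as] by (intro exI[of _ "N a - 1 / \<rho>\<^sup>2"]) simp
    qed
    moreover have "r / \<rho>\<^sup>2 \<le> s0 / \<rho>\<^sup>2" using r by (intro divide_right_mono) auto
    ultimately show ?thesis by (simp add: C1_def)
  qed
  \<comment> \<open>The absolute value makes the bound increase with \<open>r\<close>, so one
    constant serves up to \<open>s0\<close>.\<close>
  define C where "C = \<phi> z + s0 * \<bar>C1\<bar>"
  have f_le: "\<phi> (z - r *\<^sub>R x) \<le> C" if r: "0 \<le> r" "r < s0" for r
  proof -
    have "\<phi> (z - r *\<^sub>R x) - r * \<bar>C1\<bar> \<le> \<phi> (z - 0 *\<^sub>R x) - 0 * \<bar>C1\<bar>"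
    proof (rule DERIV_nonpos_imp_nonincreasing[OF r(1)])
      fix a assume a: "0 \<le> a" "a \<le> r"
      then have as: "a < s0" using r by linarith
      have "((\<lambda>r. \<phi> (z - r *\<^sub>R x) - r * \<bar>C1\<bar>) has_real_derivative q a - \<bar>C1\<bar>) (at a)"
        by (auto intro!: derivative_eq_intros f_deriv a as)
      then show "\<exists>y. ((\<lambda>r. \<phi> (z - r *\<^sub>R x) - r * \<bar>C1\<bar>) has_real_derivative y) (at a) \<and> y \<le> 0"
        using q_le[OF a(1) as] by (intro exI[of _ "q a - \<bar>C1\<bar>"]) simp
    qed
    moreover have "r * \<bar>C1\<bar> \<le> s0 * \<bar>C1\<bar>" using r by (intro mult_right_mono) auto
    ultimately show ?thesis by (simp add: C_def)
  qed
  define r where "r i = s0 * (1 - inverse (real (Suc i)))" for i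
  have r: "0 \<le> r i" "r i < s0" for i
    using s0 inverse_le_1_iff[of "real (Suc i)"] by (auto simp: r_def intro!: mult_nonneg_nonneg)
  have lim: "(\<lambda>i. (z - r i *\<^sub>R x, C)) \<longlonglongrightarrow> (z - (s0 * (1 - 0)) *\<^sub>R x, C)"
    unfolding r_def by (intro tendsto_intros LIMSEQ_inverse_real_of_nat)
  have "(z - r i *\<^sub>R x, C) \<in> epigraph D \<phi>" for i
    using inD[OF r] f_le[OF r] by (simp add: mem_epigraph)
  from closed_sequentially[OF epi_closed this lim]
  have "(z - (s0 * (1 - 0)) *\<^sub>R x, C) \<in> epigraph D \<phi>" .
  then show False using s0B by (simp add: mem_epigraph B_def)
qed

text \<open>Every \<open>t > n\<close> leaves room for a positive \<open>k\<close> in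
  \<open>dikin_segment\<close>; the value \<open>n\<close> itself follows because \<open>K\<close>
  is closed.\<close>

lemma dikin':
  assumes z: "z \<in> D" and x: "x \<in> K"
  shows "sqrt (H z x x) *\<^sub>R z - x \<in> K"
proof -
  define n where "n = sqrt (H z x x)"
  have n: "0 \<le> n" "n\<^sup>2 = H z x x" using H_ge_0[OF z x x] by (auto simp: n_def)
  have above: "t *\<^sub>R z - x \<in> K" if t: "n < t" for t
  proof -
    define k where "k = (t\<^sup>2 - n\<^sup>2) / 2"
    have "n\<^sup>2 < t\<^sup>2" using t n by (intro power_strict_mono) auto
    then have k: "0 < k" "n\<^sup>2 + k < t\<^sup>2" by (auto simp: k_def field_simps)
    have t0: "0 < t" using n t by linarith
    have "sqrt (H z x x + k) < sqrt (t\<^sup>2)" using k n by (intro real_sqrt_less_mono) simp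
    then have "z - (1 / t) *\<^sub>R x \<in> D" using t0 by (intro dikin_segment[OF z x k(1)]) auto
    then have "t *\<^sub>R (z - (1 / t) *\<^sub>R x) \<in> K" using t0 int_K by (intro K_scale) (auto simp: D_eq)
    then show ?thesis using t0 by (simp add: scaleR_diff_right)
  qed
  have lim: "(\<lambda>i. (n + inverse (real (Suc i))) *\<^sub>R z - x) \<longlonglongrightarrow> (n + 0) *\<^sub>R z - x"
    by (intro tendsto_intros LIMSEQ_inverse_real_of_nat)
  have "(n + inverse (real (Suc i))) *\<^sub>R z - x \<in> K" for i by (intro above) simp
  from closed_sequentially[OF closed_K this lim] have "(n + 0) *\<^sub>R z - x \<in> K" .
  then show ?thesis by (simp add: n_def)
qed

sublocale pairwise_barrier K \<nu> Q H
proof (intro pairwise_barrier.intro pairwise_barrier_axioms.intro closed_pointed_cone_axioms)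
  fix z a b u v x :: 'a and t :: real
  assume "z \<in> interior K"
  then have z: "z \<in> D" by (simp add: D_eq)
  show "linear (Q z)"
    using linear_compose_neg[OF linear_frechet_derivative[OF diff_\<phi>[OF z]]] by (simp add: Q_def[abs_def] \<phi>1_def)
  show "linear (H z a)" using H_lin[OF z] .
  show "H z a b = H z b a" using \<phi>2_sym[OF z] by (simp add: H_def)
  show "((\<lambda>t. Q (z + t *\<^sub>R a) b) has_real_derivative - H z a b) (at 0)"
    using DERIV_minus[OF \<phi>2_deriv[of z 0 a b]] z by (simp add: Q_def H_def)
  show "Q z z = \<nu>" using Q_self'[OF z] .
  show "H z z v = Q z v" using H_self'[OF z] .
  show "0 < t \<Longrightarrow> Q (t *\<^sub>R z) v = Q z v / t" using Q_scale'[OF z] .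
  show "x \<in> K \<Longrightarrow> sqrt (H z x x) *\<^sub>R z - x \<in> K" using dikin'[OF z] .
  show "u \<in> K \<Longrightarrow> v \<in> K \<Longrightarrow> \<exists>T. ((\<lambda>t. H (z + t *\<^sub>R u) v u) has_real_derivative - T) (at 0) \<and> 0 \<le> T \<and>
          (\<forall>h\<ge>0. h *\<^sub>R z - u \<in> K \<longrightarrow> T \<le> 2 * H z v u * h)"
    using H_deriv_bound[OF z] .
qed

end

section \<open>The sparsification function\<close>

text \<open>Rescaling the interval between the ends by 2 over their sum centers it at 1; this is
  then its half-width.\<close>

definition accuracy :: "real \<Rightarrow> real \<Rightarrow> real" where
  "accuracy \<nu> \<eta> = (upper_end \<nu> \<eta> - lower_end \<nu> \<eta>) / (upper_end \<nu> \<eta> + lower_end \<nu> \<eta>)"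

definition sparsifies :: "'a::euclidean_space set \<Rightarrow> nat \<Rightarrow> real \<Rightarrow> bool" where
  "sparsifies K n \<epsilon> \<longleftrightarrow> (\<forall>(m::nat) (x::nat \<Rightarrow> 'a) e.
     (\<forall>i\<in>{1..m}. x i \<in> K) \<and> (\<Sum>i=1..m. x i) = e \<and> e \<in> rel_interior K \<longrightarrow>
     (\<exists>S (c::nat \<Rightarrow> real). S \<subseteq> {1..m} \<and> card S \<le> n \<and> (\<forall>i\<in>S. 0 < c i) \<and>
        cone_le K ((1 - \<epsilon>) *\<^sub>R e) (\<Sum>i\<in>S. c i *\<^sub>R x i) \<and>
        cone_le K (\<Sum>i\<in>S. c i *\<^sub>R x i) ((1 + \<epsilon>) *\<^sub>R e)))"

lemma sparsifies_weaken:
  fixes K :: "'a::euclidean_space set"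
  assumes K: "convex_cone K" and s: "sparsifies K n \<epsilon>" and le: "\<epsilon> \<le> \<epsilon>'" and n: "n \<le> n'"
  shows "sparsifies K n' \<epsilon>'"
  unfolding sparsifies_def
proof (intro allI impI)
  fix m and x :: "nat \<Rightarrow> 'a" and e
  assume a: "(\<forall>i\<in>{1..m}. x i \<in> K) \<and> (\<Sum>i=1..m. x i) = e \<and> e \<in> rel_interior K"
  from s[unfolded sparsifies_def, THEN spec, THEN spec, THEN spec, THEN mp, OF this]
  obtain S and c :: "nat \<Rightarrow> real" where S: "S \<subseteq> {1..m}" "card S \<le> n" "\<forall>i\<in>S. 0 < c i"
    "cone_le K ((1 - \<epsilon>) *\<^sub>R e) (\<Sum>i\<in>S. c i *\<^sub>R x i)"
    "cone_le K (\<Sum>i\<in>S. c i *\<^sub>R x i) ((1 + \<epsilon>) *\<^sub>R e)"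
    by (elim exE conjE) (rule that; assumption)
  have "e \<in> K" using a rel_interior_subset by blast
  then have d: "(\<epsilon>' - \<epsilon>) *\<^sub>R e \<in> K" using K le by (simp add: convex_cone_def conic_def)
  let ?A = "\<Sum>i\<in>S. c i *\<^sub>R x i"
  have "(?A - (1 - \<epsilon>) *\<^sub>R e) + (\<epsilon>' - \<epsilon>) *\<^sub>R e \<in> K" "((1 + \<epsilon>) *\<^sub>R e - ?A) + (\<epsilon>' - \<epsilon>) *\<^sub>R e \<in> K"
    using S(4,5) d convex_cone_add[OF K] by (auto simp: cone_le_def)
  moreover have "(?A - (1 - \<epsilon>) *\<^sub>R e) + (\<epsilon>' - \<epsilon>) *\<^sub>R e = ?A - (1 - \<epsilon>') *\<^sub>R e"
    "((1 + \<epsilon>) *\<^sub>R e - ?A) + (\<epsilon>' - \<epsilon>) *\<^sub>R e = (1 + \<epsilon>') *\<^sub>R e - ?A"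
    by (simp_all add: algebra_simps)
  ultimately have "cone_le K ((1 - \<epsilon>') *\<^sub>R e) ?A" "cone_le K ?A ((1 + \<epsilon>') *\<^sub>R e)"
    by (simp_all add: cone_le_def)
  moreover have "card S \<le> n'" using S(2) n by linarith
  ultimately show "\<exists>S (c::nat \<Rightarrow> real). S \<subseteq> {1..m} \<and> card S \<le> n' \<and> (\<forall>i\<in>S. 0 < c i) \<and>
        cone_le K ((1 - \<epsilon>') *\<^sub>R e) (\<Sum>i\<in>S. c i *\<^sub>R x i) \<and>
        cone_le K (\<Sum>i\<in>S. c i *\<^sub>R x i) ((1 + \<epsilon>') *\<^sub>R e)"
    using S(1,3) by (intro exI[of _ S] exI[of _ c] conjI)
qed

text \<open>A sparsification function needs a finite value at every accuracy, also below the one of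
  interest. Caratheodory's theorem, applied to \<open>e / m\<close> as a mean of the
  \<open>x i\<close>, gives a bound independent of the accuracy.\<close>

lemma sparsifies_0_caratheodory:
  fixes K :: "'a::euclidean_space set"
  assumes K: "convex_cone K"
  shows "sparsifies K (DIM('a) + 1) 0"
  unfolding sparsifies_def
proof (intro allI impI)
  fix m and x :: "nat \<Rightarrow> 'a" and e
  assume a: "(\<forall>i\<in>{1..m}. x i \<in> K) \<and> (\<Sum>i=1..m. x i) = e \<and> e \<in> rel_interior K"
  have "\<exists>S (c::nat \<Rightarrow> real). S \<subseteq> {1..m} \<and> card S \<le> DIM('a) + 1 \<and> (\<forall>i\<in>S. 0 < c i) \<and>
      (\<Sum>i\<in>S. c i *\<^sub>R x i) = e"
  proof (cases "m = 0")
    case True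
    then show ?thesis using a by (intro exI[of _ "{}"]) auto
  next
    case False
    have "(\<Sum>i\<in>{1..m}. (1 / real m) *\<^sub>R x i) \<in> convex hull (x ` {1..m})"
      using False by (intro convex_sum) (auto intro: hull_inc)
    moreover have "(\<Sum>i\<in>{1..m}. (1 / real m) *\<^sub>R x i) = (1 / real m) *\<^sub>R e"
      using a by (simp flip: scaleR_sum_right)
    ultimately obtain F where F: "finite F" "F \<subseteq> x ` {1..m}" "card F \<le> DIM('a) + 1"
      "(1 / real m) *\<^sub>R e \<in> convex hull F"
      unfolding caratheodory[of "x ` {1..m}"] by auto
    then obtain u where u: "\<And>v. v \<in> F \<Longrightarrow> 0 \<le> u v" "(\<Sum>v\<in>F. u v *\<^sub>R v) = (1 / real m) *\<^sub>R e"
      unfolding convex_hull_finite[OF F(1)] by auto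
    define F' where "F' = {v \<in> F. u v \<noteq> 0}"
    \<comment> \<open>One index is chosen per vector, as the \<open>x i\<close> may repeat.\<close>
    define g where "g = inv_into {1..m} x"
    have g: "g v \<in> {1..m}" "x (g v) = v" if "v \<in> F'" for v
    proof -
      have "v \<in> x ` {1..m}" using that F(2) by (auto simp: F'_def)
      then show "g v \<in> {1..m}" "x (g v) = v"
        unfolding g_def by (rule inv_into_into, rule f_inv_into_f)
    qed
    have inj: "inj_on g F'" using g(2) by (metis inj_onI)
    have "(\<Sum>i\<in>g ` F'. (real m * u (x i)) *\<^sub>R x i) = (\<Sum>v\<in>F'. (real m * u v) *\<^sub>R v)"
      unfolding sum.reindex[OF inj] by (intro sum.cong) (auto simp: g)
    also have "\<dots> = (\<Sum>v\<in>F. (real m * u v) *\<^sub>R v)"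
      using F(1) by (intro sum.mono_neutral_left) (auto simp: F'_def)
    also have "\<dots> = real m *\<^sub>R (\<Sum>v\<in>F. u v *\<^sub>R v)" by (simp add: scaleR_sum_right)
    also have "\<dots> = e" using u(2) False by simp
    finally have "(\<Sum>i\<in>g ` F'. (real m * u (x i)) *\<^sub>R x i) = e" .
    moreover have "card (g ` F') \<le> DIM('a) + 1"
      using card_image[OF inj] card_mono[OF F(1), of F'] F(3) by (auto simp: F'_def)
    moreover have "\<forall>i\<in>g ` F'. 0 < real m * u (x i)"
    proof
      fix i assume "i \<in> g ` F'"
      then obtain v where v: "v \<in> F'" "x i = v" using g(2) by blast
      then have "0 < u v" using u(1)[of v] by (simp add: F'_def less_le)
      then show "0 < real m * u (x i)" using v False by simp
    qed
    moreover have "g ` F' \<subseteq> {1..m}" using g by blast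
    ultimately show ?thesis
      by (intro exI[of _ "g ` F'"] exI[of _ "\<lambda>i. real m * u (x i)"] conjI)
  qed
  then obtain S and c :: "nat \<Rightarrow> real" where S: "S \<subseteq> {1..m}" "card S \<le> DIM('a) + 1"
    "\<forall>i\<in>S. 0 < c i" "(\<Sum>i\<in>S. c i *\<^sub>R x i) = e"
    by (elim exE conjE) (rule that; assumption)
  moreover have "0 \<in> K" using K convex_cone_contains_0 by blast
  ultimately show "\<exists>S (c::nat \<Rightarrow> real). S \<subseteq> {1..m} \<and> card S \<le> DIM('a) + 1 \<and> (\<forall>i\<in>S. 0 < c i) \<and>
      cone_le K ((1 - 0) *\<^sub>R e) (\<Sum>i\<in>S. c i *\<^sub>R x i) \<and>
      cone_le K (\<Sum>i\<in>S. c i *\<^sub>R x i) ((1 + 0) *\<^sub>R e)"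
    by (intro exI[of _ S] exI[of _ c]) (simp add: cone_le_def)
qed

text \<open>A sparsification function must be upper semicontinuous, hence left-continuous, whereas
  \<open>\<lceil>4 \<nu> / \<epsilon>\<^sup>2\<rceil>\<close> is not; so \<open>n\<close> elements are required for some accuracy strictly better than \<open>\<epsilon>\<close>.\<close>

lemma sp_le:
  fixes K :: "'a::euclidean_space set"
  assumes K: "convex_cone K" and s: "sparsifies K n \<epsilon>'" and le: "\<epsilon>' < \<epsilon>"
  shows "sp K \<epsilon> \<le> ereal (real n)"
proof -
  define N where "N = max n (DIM('a) + 1)"
  \<comment> \<open>At the jump the larger value \<open>N\<close> is taken, which gives upper
    semicontinuity; the maximum in \<open>N\<close> gives monotonicity.\<close>
  define \<alpha> where "\<alpha> = (\<lambda>t. if \<epsilon>' < t then real n else real N)"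
  have all: "sparsifies K (if \<epsilon>' < t then n else N) t" if "0 < t" for t
    using sparsifies_weaken[OF K s, of t n] sparsifies_weaken[OF K sparsifies_0_caratheodory[OF K], of t N] that
    by (simp add: N_def)
  have "sparsification_function K \<alpha>"
    unfolding sparsification_function_def
  proof (intro conjI allI impI)
    show "antimono_on {0<..<1} \<alpha>" by (auto simp: monotone_on_def \<alpha>_def N_def)
    show "upper_semicontinuous_on {0<..<1} \<alpha>"
      unfolding upper_semicontinuous_on_def
    proof (intro ballI allI impI)
      fix t a assume t: "t \<in> {0<..<1}" "\<alpha> t < a"
      show "eventually (\<lambda>y. \<alpha> y < a) (at t within {0<..<1})"
      proof (cases "\<epsilon>' < t")
        case True
        have "eventually (\<lambda>y. \<epsilon>' < y) (at t within {0<..<1})"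
          using order_tendstoD(1)[OF tendsto_ident_at True] .
        then show ?thesis by eventually_elim (use t True in \<open>auto simp: \<alpha>_def\<close>)
      next
        case False
        then have "\<alpha> y < a" for y using t by (auto simp: \<alpha>_def N_def)
        then show ?thesis by simp
      qed
    qed
    fix m and x :: "nat \<Rightarrow> 'a" and e and \<epsilon> :: real
    assume a: "(\<forall>i\<in>{1..m}. x i \<in> K) \<and> (\<Sum>i=1..m. x i) = e \<and> e \<in> rel_interior K \<and> 0 < \<epsilon> \<and> \<epsilon> < 1"
    define k where "k = (if \<epsilon>' < \<epsilon> then n else N)"
    have k: "\<alpha> \<epsilon> = real k" by (simp add: \<alpha>_def k_def)
    have "sparsifies K k \<epsilon>" using all[of \<epsilon>] a unfolding k_def by blast
    moreover have "(\<forall>i\<in>{1..m}. x i \<in> K) \<and> (\<Sum>i=1..m. x i) = e \<and> e \<in> rel_interior K" using a by blast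
    ultimately show "\<exists>S (c::nat \<Rightarrow> real).
           S \<subseteq> {1..m} \<and> real (card S) \<le> \<alpha> \<epsilon> \<and> (\<forall>i\<in>S. 0 < c i) \<and>
           cone_le K ((1 - \<epsilon>) *\<^sub>R e) (\<Sum>i\<in>S. c i *\<^sub>R x i) \<and>
           cone_le K (\<Sum>i\<in>S. c i *\<^sub>R x i) ((1 + \<epsilon>) *\<^sub>R e)"
      unfolding sparsifies_def k of_nat_le_iff by (elim allE impE)
  qed
  then have "sp K \<epsilon> \<le> ereal (\<alpha> \<epsilon>)" unfolding sp_def by (intro INF_lower) simp
  then show ?thesis using le by (simp add: \<alpha>_def)
qed

context psc_barrier begin

lemma D_nonempty: "D \<noteq> {}"
proof -
  have "closure D = K" using lhb by (simp add: log_homogeneous_barrier_def)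
  then show ?thesis using K_0 by auto
qed

lemma sparsifies_accuracy:
  assumes \<eta>: "0 < \<eta>" "\<eta> < 3 / 8" and N: "real N = \<nu> * ((3 - 2 * \<eta>) / (3 * \<eta>))\<^sup>2"
  shows "sparsifies K N (accuracy \<nu> \<eta>)"
  unfolding sparsifies_def
proof (intro allI impI)
  fix m and x :: "nat \<Rightarrow> 'a" and e
  assume a: "(\<forall>i\<in>{1..m}. x i \<in> K) \<and> (\<Sum>i=1..m. x i) = e \<and> e \<in> rel_interior K"
  \<comment> \<open>The relative interior is the interior, since the domain of the barrier is
    nonempty and open.\<close>
  have e: "e \<in> interior K" using a D_nonempty rel_interior_nonempty_interior[of K] by (simp add: D_eq)
  obtain w :: 'a where "w \<in> Basis" using nonempty_Basis by blast
  then have e0: "e \<noteq> 0" and \<nu>: "1 \<le> \<nu>"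
    using int_nonzero[OF e nonzero_Basis] \<nu>_ge_1[OF e nonzero_Basis] by blast+
  define I where "I = {i\<in>{1..m}. x i \<noteq> 0}"
  have sum_I: "sum x I = e"
  proof -
    have "sum x I = (\<Sum>i=1..m. x i)" by (intro sum.mono_neutral_left) (auto simp: I_def)
    then show ?thesis using a by simp
  qed
  interpret sparsification_instance K \<nu> Q H I x e
  proof
    show "I \<noteq> {}" using sum_I e0 by auto
  qed (use a e sum_I in \<open>auto simp: I_def\<close>)
  obtain S c where S: "S \<subseteq> I" "card S \<le> N" "\<And>i. i \<in> S \<Longrightarrow> 0 < c i"
    and l: "(\<Sum>i\<in>S. c i *\<^sub>R x i) - lower_end \<nu> \<eta> *\<^sub>R e \<in> K"
    and u: "upper_end \<nu> \<eta> *\<^sub>R e - (\<Sum>i\<in>S. c i *\<^sub>R x i) \<in> K"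
    by (rule two_sided_sparsifier[OF \<eta> N]) (rule that)
  define A where "A = (\<Sum>i\<in>S. c i *\<^sub>R x i)"
  have "0 < upper_end \<nu> \<eta>"
    using step_budget_pos[OF \<eta>] \<nu> \<eta> by (simp add: upper_end_def)
  then have p: "0 < upper_end \<nu> \<eta> + lower_end \<nu> \<eta>" using lower_end_pos[OF \<nu> \<eta>] by linarith
  define k where "k = 2 / (upper_end \<nu> \<eta> + lower_end \<nu> \<eta>)"
  have k: "0 < k" using p by (simp add: k_def)
  have k': "1 - accuracy \<nu> \<eta> = k * lower_end \<nu> \<eta>" "1 + accuracy \<nu> \<eta> = k * upper_end \<nu> \<eta>"
    using p by (simp_all add: accuracy_def k_def field_simps)
  have kA: "(\<Sum>i\<in>S. (k * c i) *\<^sub>R x i) = k *\<^sub>R A" by (simp add: A_def scaleR_sum_right)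
  have "k *\<^sub>R (A - lower_end \<nu> \<eta> *\<^sub>R e) \<in> K" "k *\<^sub>R (upper_end \<nu> \<eta> *\<^sub>R e - A) \<in> K"
    using l u k by (auto simp: A_def intro: K_scale)
  then have "cone_le K ((1 - accuracy \<nu> \<eta>) *\<^sub>R e) (\<Sum>i\<in>S. (k * c i) *\<^sub>R x i)"
    "cone_le K (\<Sum>i\<in>S. (k * c i) *\<^sub>R x i) ((1 + accuracy \<nu> \<eta>) *\<^sub>R e)"
    unfolding kA k' cone_le_def by (simp_all add: scaleR_diff_right)
  moreover have "S \<subseteq> {1..m}" using S(1) by (auto simp: I_def)
  moreover have "\<forall>i\<in>S. 0 < k * c i" using S(3) k by simp
  ultimately show "\<exists>S (c::nat \<Rightarrow> real). S \<subseteq> {1..m} \<and> card S \<le> N \<and> (\<forall>i\<in>S. 0 < c i) \<and>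
        cone_le K ((1 - accuracy \<nu> \<eta>) *\<^sub>R e) (\<Sum>i\<in>S. c i *\<^sub>R x i) \<and>
        cone_le K (\<Sum>i\<in>S. c i *\<^sub>R x i) ((1 + accuracy \<nu> \<eta>) *\<^sub>R e)"
    using S(2) by (intro exI[of _ S] exI[of _ "\<lambda>i. k * c i"]) auto
qed

lemma sp_bound:
  assumes \<epsilon>: "0 < \<epsilon>" "\<epsilon> < 1"
  shows "sp K \<epsilon> \<le> ereal (real_of_int \<lceil>4 * \<nu> / \<epsilon>\<^sup>2\<rceil>)"
proof -
  obtain z where z: "z \<in> interior K" using D_nonempty by (auto simp: D_eq)
  obtain w :: 'a where "w \<in> Basis" using nonempty_Basis by blast
  then have \<nu>: "1 \<le> \<nu>" using \<nu>_ge_1[OF z nonzero_Basis] by blast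
  define N where "N = nat \<lceil>4 * \<nu> / \<epsilon>\<^sup>2\<rceil>"
  have q: "0 < 4 * \<nu> / \<epsilon>\<^sup>2" using \<nu> \<epsilon> by simp
  then have N: "real N = real_of_int \<lceil>4 * \<nu> / \<epsilon>\<^sup>2\<rceil>" by (simp add: N_def)
  have N_ge: "4 * \<nu> / \<epsilon>\<^sup>2 \<le> real N" unfolding N by (rule le_of_int_ceiling)
  then have N0: "0 < real N" using q by linarith
  \<comment> \<open>Computed from the rounded \<open>N\<close>, so that the number of steps is
    exactly \<open>4 \<nu> / y^2\<close>; rounding up only makes \<open>y\<close> smaller than
    \<epsilon>.\<close>
  define y where "y = 2 * sqrt (\<nu> / real N)"
  have y0: "0 < y" using \<nu> N0 by (simp add: y_def)
  have y2: "y\<^sup>2 = 4 * \<nu> / real N" using \<nu> N0 by (simp add: y_def power_mult_distrib)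
  have "y\<^sup>2 \<le> \<epsilon>\<^sup>2" 
  proof -
    have "4 * \<nu> \<le> real N * \<epsilon>\<^sup>2" using N_ge \<epsilon> by (simp add: pos_divide_le_eq)
    then show ?thesis unfolding y2 using N0 by (simp add: pos_divide_le_eq mult.commute)
  qed
  then have y_le: "y \<le> \<epsilon>" using \<epsilon> by (intro power2_le_imp_le[of y \<epsilon>]) auto
  then have y1: "y < 1" using \<epsilon> by linarith
  define \<eta> where "\<eta> = 3 * y / (6 + 2 * y)"
  have \<eta>: "0 < \<eta>" "\<eta> < 3 / 8" using y0 y1 by (auto simp: \<eta>_def field_simps)
  have "(3 - 2 * \<eta>) * y = 6 * \<eta>" using y0 by (simp add: \<eta>_def field_simps)
  then have \<eta>y: "6 * \<eta> / (3 - 2 * \<eta>) = y" "(3 - 2 * \<eta>) / (3 * \<eta>) = 2 / y"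
    using \<eta> y0 by (auto simp: field_simps)
  have "real N = \<nu> * ((3 - 2 * \<eta>) / (3 * \<eta>))\<^sup>2"
    unfolding \<eta>y power_divide y2 using \<nu> N0 by simp
  from sparsifies_accuracy[OF \<eta> this] have s: "sparsifies K N (accuracy \<nu> \<eta>)" .
  have "accuracy \<nu> \<eta> < y"
  proof -
    have "0 < upper_end \<nu> \<eta>" using step_budget_pos[OF \<eta>] \<nu> \<eta> by (simp add: upper_end_def)
    then have "0 < upper_end \<nu> \<eta> + lower_end \<nu> \<eta>" using lower_end_pos[OF \<nu> \<eta>] by linarith
    moreover have "upper_end \<nu> \<eta> * (1 - y) < lower_end \<nu> \<eta> * (1 + y)"
      using ends_close[OF \<nu> \<eta>] by (simp add: \<eta>y)
    ultimately show ?thesis by (simp add: accuracy_def pos_divide_less_eq algebra_simps)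
  qed
  then have "accuracy \<nu> \<eta> < \<epsilon>" using y_le by linarith
  from sp_le[OF cone_K s this] show ?thesis by (simp add: N)
qed

end

theorem theorem1p5:
  fixes K :: "(real ^ 'n) set" and \<nu> :: real
  assumes "proper_cone K"
    and "\<exists>D \<phi>. pairwise_self_concordant_barrier \<nu> K D \<phi>"
  shows "\<forall>\<epsilon>::real. 0 < \<epsilon> \<and> \<epsilon> < 1 \<longrightarrow>
           sp K \<epsilon> \<le> ereal (real_of_int \<lceil>4 * \<nu> / \<epsilon>\<^sup>2\<rceil>)"
proof (intro allI impI)
  fix \<epsilon> :: real assume \<epsilon>: "0 < \<epsilon> \<and> \<epsilon> < 1"
  obtain D \<phi> where "pairwise_self_concordant_barrier \<nu> K D \<phi>" using assms(2) by blast
  then interpret psc_barrier K D \<nu> \<phi> using assms(1) by unfold_locales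
  show "sp K \<epsilon> \<le> ereal (real_of_int \<lceil>4 * \<nu> / \<epsilon>\<^sup>2\<rceil>)" using sp_bound \<epsilon> by blast
qed

end
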